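(* Let $R^x$ be a BESQ with index $\mu\ge 0$ starting from $x>0$, and write $R=R^1$. Let $\hat R(t)=\hat R_t=t^2R\big(\tfrac1t\big)$. Then for any fixed $t\ge 0$ the following equivalence in law holds: $$\Big(t^2R\Big(\frac1t+a\Big),\ a\ge 0\Big)\stackrel{(law)}{=}\Big(S^{\hat R_t}_{t^2a},\ a\ge 0\Big),$$ where $S$ is a squared Bessel process with index $\mu$ independent of $\hat R$.
   Context: BESQ$(\mu)$ denotes the squared Bessel process with index $\mu\ge 0$ (dimension $\delta=2(\mu+1)$), i.e. the nonnegative continuous process solving $dR(t)=2\sqrt{R(t)}\,dB_t+\delta\,dt$ with $B$ a standard Brownian motion. By the paper's convention $R$ without superscript starts from $1$, and a superscript denotes the starting point: $S^{x}$ is the squared Bessel process $S$ started from $x$, so $S^{\hat R_t}$ is started from the random point $\hat R_t$. At $t=0$ the expressions involving $1/t$ are understood as limits as $t\downarrow 0$; in particular $\hat R(0)=0$. *)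

theory Defs
  imports "HOL-Probability.Probability"
begin

text \<open>Processes are functions of type \<open>real \<Rightarrow> 'a \<Rightarrow> real\<close> (time first); only times in \<open>{0..}\<close> matter.
  A filtration is indexed by all of \<open>real\<close>, but its \<open>\<sigma>\<close>-algebras at negative times play no role. No
  completeness or right-continuity is required of a filtration.\<close>

subsection \<open>Laws of processes\<close>

definition sample_path :: "(real \<Rightarrow> 'a \<Rightarrow> real) \<Rightarrow> 'a \<Rightarrow> real \<Rightarrow> real" where
  "sample_path X \<omega> = (\<lambda>t\<in>{0..}. X t \<omega>)"

definition path_space :: "(real \<Rightarrow> real) measure" where
  "path_space = (\<Pi>\<^sub>M t\<in>{0..}. borel)"

definition process_sigma :: "'a measure \<Rightarrow> (real \<Rightarrow> 'a \<Rightarrow> real) \<Rightarrow> 'a measure" where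
  "process_sigma M X = vimage_algebra (space M) (sample_path X) path_space"

text \<open>Measurability is part of the notion, because \<open>distr\<close> is meaningless without it.\<close>

definition equal_in_law :: "'a measure \<Rightarrow> (real \<Rightarrow> 'a \<Rightarrow> real) \<Rightarrow> (real \<Rightarrow> 'a \<Rightarrow> real) \<Rightarrow> bool" where
  "equal_in_law M X Y \<longleftrightarrow>
     sample_path X \<in> measurable M path_space \<and> sample_path Y \<in> measurable M path_space \<and>
     distr M path_space (sample_path X) = distr M path_space (sample_path Y)"

subsection \<open>Brownian motion relative to a filtration\<close>

definition brownian_motion ::
    "'a measure \<Rightarrow> (real \<Rightarrow> 'a measure) \<Rightarrow> (real \<Rightarrow> 'a \<Rightarrow> real) \<Rightarrow> bool" where
  "brownian_motion M F B \<longleftrightarrow>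
     prob_space M \<and> filtration (space M) F \<and> (\<forall>t\<ge>0. subalgebra M (F t)) \<and>
     (\<forall>t\<ge>0. B t \<in> borel_measurable (F t)) \<and>
     (\<forall>\<omega>\<in>space M. continuous_on {0..} (\<lambda>t. B t \<omega>)) \<and>
     (AE \<omega> in M. B 0 \<omega> = 0) \<and>
     (\<forall>s t. 0 \<le> s \<and> s < t \<longrightarrow>
        distributed M lborel (\<lambda>\<omega>. B t \<omega> - B s \<omega>) (normal_density 0 (sqrt (t - s))) \<and>
        prob_space.indep_set M (sets (F s))
          (sets (vimage_algebra (space M) (\<lambda>\<omega>. B t \<omega> - B s \<omega>) borel)))"

subsection \<open>The Ito integral\<close>

text \<open>A simple integrand is \<open>\<Sum>k<n. \<xi>\<^sub>k 1\<^bsub>(\<tau>\<^sub>k, \<tau>\<^sub>k\<^sub>+\<^sub>1]\<^esub>\<close> with deterministic times \<open>\<tau>\<^sub>k\<close> and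
  bounded \<open>F\<^bsub>\<tau>\<^sub>k\<^esub>\<close>-measurable coefficients \<open>\<xi>\<^sub>k\<close>.\<close>

definition simple_integrand ::
    "'a measure \<Rightarrow> (real \<Rightarrow> 'a measure) \<Rightarrow> nat \<Rightarrow> (nat \<Rightarrow> real) \<Rightarrow> (nat \<Rightarrow> 'a \<Rightarrow> real) \<Rightarrow> bool" where
  "simple_integrand M F n \<tau> \<xi> \<longleftrightarrow>
     0 \<le> \<tau> 0 \<and> (\<forall>k<n. \<tau> k \<le> \<tau> (Suc k)) \<and>
     (\<forall>k<n. \<xi> k \<in> borel_measurable (F (\<tau> k)) \<and> (\<exists>C. \<forall>\<omega>\<in>space M. \<bar>\<xi> k \<omega>\<bar> \<le> C))"

definition simple_process ::
    "nat \<Rightarrow> (nat \<Rightarrow> real) \<Rightarrow> (nat \<Rightarrow> 'a \<Rightarrow> real) \<Rightarrow> real \<Rightarrow> 'a \<Rightarrow> real" where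
  "simple_process n \<tau> \<xi> s \<omega> = (\<Sum>k<n. \<xi> k \<omega> * indicator {\<tau> k<..\<tau> (Suc k)} s)"

definition simple_integral ::
    "(real \<Rightarrow> 'a \<Rightarrow> real) \<Rightarrow> nat \<Rightarrow> (nat \<Rightarrow> real) \<Rightarrow> (nat \<Rightarrow> 'a \<Rightarrow> real) \<Rightarrow> real \<Rightarrow> 'a \<Rightarrow> real" where
  "simple_integral B n \<tau> \<xi> t \<omega> =
     (\<Sum>k<n. \<xi> k \<omega> * (B (min t (\<tau> (Suc k))) \<omega> - B (min t (\<tau> k)) \<omega>))"

definition vanishes_in_prob :: "'a measure \<Rightarrow> (nat \<Rightarrow> 'a \<Rightarrow> ennreal) \<Rightarrow> bool" where
  "vanishes_in_prob M X \<longleftrightarrow>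
     (\<forall>\<epsilon>>0. (\<lambda>m. measure M {\<omega>\<in>space M. ennreal \<epsilon> < X m \<omega>}) \<longlonglongrightarrow> 0)"

text \<open>\<open>I\<close> is a version of \<open>\<integral>\<^sub>0\<^sup>t H dB\<close>: the limit in probability of the integrals of simple
  integrands that approximate \<open>H\<close> in \<open>L\<^sup>2([0,t])\<close> in probability. For a Brownian motion \<open>B\<close> the
  limit is a.s. unique and does not depend on the approximating sequence. The integral is stated
  as a relation so that it needs no choice of a version.\<close>

definition ito_integral ::
    "'a measure \<Rightarrow> (real \<Rightarrow> 'a measure) \<Rightarrow> (real \<Rightarrow> 'a \<Rightarrow> real) \<Rightarrow> (real \<Rightarrow> 'a \<Rightarrow> real) \<Rightarrow> real
      \<Rightarrow> ('a \<Rightarrow> real) \<Rightarrow> bool" where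
  "ito_integral M F B H t I \<longleftrightarrow>
     (\<forall>s\<ge>0. H s \<in> borel_measurable (F s)) \<and>
     (\<lambda>(s, \<omega>). H s \<omega>) \<in> borel_measurable (restrict_space borel {0..} \<Otimes>\<^sub>M M) \<and>
     I \<in> borel_measurable M \<and>
     (\<exists>n \<tau> \<xi>.
        (\<forall>m. simple_integrand M F (n m) (\<tau> m) (\<xi> m)) \<and>
        vanishes_in_prob M (\<lambda>m \<omega>.
          \<integral>\<^sup>+s\<in>{0..t}. ennreal ((simple_process (n m) (\<tau> m) (\<xi> m) s \<omega> - H s \<omega>)\<^sup>2) \<partial>lborel) \<and>
        vanishes_in_prob M (\<lambda>m \<omega>.
          ennreal \<bar>simple_integral B (n m) (\<tau> m) (\<xi> m) t \<omega> - I \<omega>\<bar>))"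

subsection \<open>Squared Bessel processes\<close>

text \<open>\<open>R\<close> is a squared Bessel process of index \<open>\<mu>\<close>, i.e. of dimension \<open>2 * (\<mu> + 1)\<close>, started from
  the deterministic point \<open>x\<close>: a nonnegative continuous (weak) solution of
  \<open>dR = 2 sqrt R dB + 2 (\<mu> + 1) dt\<close> with \<open>R\<^sub>0 = x\<close>.\<close>

definition besq :: "'a measure \<Rightarrow> real \<Rightarrow> real \<Rightarrow> (real \<Rightarrow> 'a \<Rightarrow> real) \<Rightarrow> bool" where
  "besq M \<mu> x R \<longleftrightarrow>
     (\<forall>\<omega>\<in>space M. continuous_on {0..} (\<lambda>t. R t \<omega>) \<and> (\<forall>t\<ge>0. 0 \<le> R t \<omega>)) \<and>
     (AE \<omega> in M. R 0 \<omega> = x) \<and>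
     (\<exists>F B. brownian_motion M F B \<and>
        (\<forall>t\<ge>0. R t \<in> borel_measurable (F t)) \<and>
        (\<forall>t\<ge>0. \<exists>I. ito_integral M F B (\<lambda>s \<omega>. sqrt (R s \<omega>)) t I \<and>
           (AE \<omega> in M. R t \<omega> = R 0 \<omega> + 2 * I \<omega> + 2 * (\<mu> + 1) * t)))"

text \<open>A family \<open>S\<close> of squared Bessel processes in which \<open>S y\<close> starts from \<open>y\<close>, the randomness of
  the family being contained in the \<open>\<sigma>\<close>-algebra \<open>G\<close>. Joint measurability in the starting point and
  the outcome with respect to \<open>G\<close> (not merely \<open>M\<close>) is what makes \<open>S (\<xi> \<omega>) u \<omega>\<close> the process \<open>S\<close>
  started from a random point \<open>\<xi>\<close> independent of \<open>G\<close>: otherwise each single \<open>S y\<close> could be altered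
  on the null set where \<open>\<xi> = y\<close>.\<close>

definition besq_family ::
    "'a measure \<Rightarrow> 'a measure \<Rightarrow> real \<Rightarrow> (real \<Rightarrow> real \<Rightarrow> 'a \<Rightarrow> real) \<Rightarrow> bool" where
  "besq_family M G \<mu> S \<longleftrightarrow>
     subalgebra M G \<and>
     (\<forall>y\<ge>0. besq M \<mu> y (S y)) \<and>
     (\<forall>u\<ge>0. (\<lambda>(y, \<omega>). S y u \<omega>) \<in> borel_measurable (restrict_space borel {0..} \<Otimes>\<^sub>M G))"

subsection \<open>Time inversion\<close>

text \<open>At \<open>t = 0\<close> the process is the pathwise limit as \<open>t \<down> 0\<close>. For a squared Bessel process the
  limit exists a.s.; on the exceptional null set \<open>Lim\<close> has an unspecified value.\<close>

definition inverted_shift :: "(real \<Rightarrow> 'a \<Rightarrow> real) \<Rightarrow> real \<Rightarrow> real \<Rightarrow> 'a \<Rightarrow> real" where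
  "inverted_shift R t a \<omega> =
     (if t = 0 then Lim (at_right 0) (\<lambda>s. s\<^sup>2 * R (1 / s + a) \<omega>) else t\<^sup>2 * R (1 / t + a) \<omega>)"

text \<open>The value \<open>0\<close> at \<open>t = 0\<close> is the a.s. value of the limit as \<open>t \<down> 0\<close>; fixing it on every path makes
  this process nonnegative everywhere, so that it can serve as a starting point.\<close>

definition time_inversion :: "(real \<Rightarrow> 'a \<Rightarrow> real) \<Rightarrow> real \<Rightarrow> 'a \<Rightarrow> real" where
  "time_inversion R t \<omega> = (if t = 0 then 0 else t\<^sup>2 * R (1 / t) \<omega>)"

end

theory Submission
  imports Defs "HOL-Real_Asymp.Real_Asymp"
begin

text \<open>For \<open>t > 0\<close> the left-hand process is a squared Bessel process that is observed after time \<open>1/t\<close> and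
multiplied by \<open>t\<^sup>2\<close>. By the Markov property the law of \<open>R(1/t + a)\<close> given the past is that of the process
started afresh at \<open>R(1/t)\<close>, and by scaling multiplication of the values by \<open>t\<^sup>2\<close> amounts to running the
clock at speed \<open>t\<^sup>2\<close>. With \<open>\<delta> = 2(\<mu> + 1)\<close>, both facts, and uniqueness in law as well, are contained in
the conditional Laplace transform
\<open>E[exp(-\<rho> R\<^sub>t) | F\<^sub>s] = (1 + 2\<rho>(t - s)) powr (-\<delta>/2) \<cdot> exp(-\<rho> R\<^sub>s / (1 + 2\<rho>(t - s)))\<close>, proved in
\<open>laplace_transition\<close> for every solution of the stochastic differential equation. Iterated over
several times (\<open>laplace_multi\<close>) it determines the finite-dimensional laws
(\<open>finite_dimensional_unique\<close>); its scaling behaviour (\<open>laplace_exponent_scale\<close>) and Fubini's theorem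
for the independent starting point (\<open>besq_random_start_laplace\<close>) give the theorem.

The Laplace transform comes from an exponential martingale. If \<open>\<theta>' = 2\<theta>\<^sup>2\<close>, then formally
\<open>exp(-\<theta>(u) R\<^sub>u + \<delta> \<integral>\<theta>)\<close> is, up to a constant factor, the exponential of \<open>\<integral>H dB - \<integral>H\<^sup>2/2\<close> with
\<open>H = -2 \<theta> sqrt R\<close>, so its expectation does not change. The proof uses only sums over grids. For simple
integrands the exponential has mean one because Brownian increments are Gaussian and independent of
the past (\<open>exponential_sum\<close>). For constant \<open>\<theta>\<close> on a short interval \<open>[u,v]\<close> one passes to the limit in
the approximation that defines the Ito integral (\<open>window_approximation\<close>). Fatou's lemma gives one
inequality (\<open>one_step_upper\<close>). The opposite inequality holds up to an error that is controlled by
\<open>P(4\<theta>\<^sup>2 \<integral>R > 1/2)\<close> (\<open>one_step_lower\<close>); truncation of the quadratic variation at level one provides the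
uniform integrability. The Riccati equation for \<open>\<theta>\<close> makes the sum of the discretisation errors over a
grid of mesh \<open>(t - s)/n\<close> vanish as \<open>n\<close> grows (\<open>riccati_error_tendsto_0\<close>).

The probabilities in the error terms are negligible because the maximum of \<open>R\<close> on a compact interval
has an exponential tail (\<open>exceed_tail\<close>). This follows from the upper inequality alone: with the positive
solution \<open>\<eta>(u) = 1/(2(T + u))\<close> of \<open>\<eta>' = -2\<eta>\<^sup>2\<close> it produces a positive supermartingale, to which the
maximal inequality applies.

For \<open>t = 0\<close> both processes vanish almost surely at each time: on the right the starting point is \<open>0\<close>
and the time is \<open>0\<close>, on the left the exponential tail and the Borel-Cantelli lemma give
\<open>R\<^sub>u / u\<^sup>2 \<longlonglongrightarrow> 0\<close> (\<open>subquadratic_growth\<close>). Measurability of the pathwise limit has to be proved on the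
whole space, including the null set on which it does not exist (\<open>measurable_Lim_at_right_0\<close>).\<close>

section \<open>Exponentials of sums against Brownian increments\<close>

lemma chain_le:
  fixes \<sigma> :: "nat \<Rightarrow> real"
  assumes "\<And>k. k < n \<Longrightarrow> \<sigma> k \<le> \<sigma> (Suc k)" "i \<le> j" "j \<le> n"
  shows "\<sigma> i \<le> \<sigma> j"
  using assms(2,3)
proof (induction j rule: dec_induct)
  case (step m)
  then show ?case using assms(1)[of m] by simp
qed simp

text \<open>Independence of \<open>X\<close> from a sub-\<open>\<sigma>\<close>-algebra in the form needed for Fubini's theorem. The identity,
viewed as a random variable with values in \<open>A\<close>, carries all \<open>A\<close>-measurable quantities at once, so that an
expectation involving them and \<open>X\<close> becomes a double integral.\<close>

lemma (in prob_space) distr_pair_indep: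
  assumes id: "(\<lambda>\<omega>. \<omega>) \<in> measurable M A" and X: "X \<in> measurable M N"
    and ind: "indep_set (sets A) D"
    and D: "\<And>C. C \<in> sets N \<Longrightarrow> X -` C \<inter> space M \<in> D"
    and space: "space A = space M"
  shows "distr M (A \<Otimes>\<^sub>M N) (\<lambda>\<omega>. (\<omega>, X \<omega>)) = distr M A (\<lambda>\<omega>. \<omega>) \<Otimes>\<^sub>M distr M N X"
proof (rule pair_measure_eqI[symmetric])
  interpret 1: prob_space "distr M A (\<lambda>\<omega>. \<omega>)" by (rule prob_space_distr[OF id])
  interpret 2: prob_space "distr M N X" by (rule prob_space_distr[OF X])
  show "sigma_finite_measure (distr M A (\<lambda>\<omega>. \<omega>))" "sigma_finite_measure (distr M N X)"
    by unfold_locales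
  have pair: "(\<lambda>\<omega>. (\<omega>, X \<omega>)) \<in> measurable M (A \<Otimes>\<^sub>M N)"
    by (rule measurable_Pair[OF id X])
  fix a C assume a: "a \<in> sets (distr M A (\<lambda>\<omega>. \<omega>))" and C: "C \<in> sets (distr M N X)"
  then have a': "a \<in> sets A" and C': "C \<in> sets N" by auto
  have sub: "a \<subseteq> space M" using sets.sets_into_space[OF a'] space by simp
  have "(\<lambda>\<omega>. (\<omega>, X \<omega>)) -` (a \<times> C) \<inter> space M = a \<inter> (X -` C \<inter> space M)"
    using sub by auto
  moreover have "prob (a \<inter> (X -` C \<inter> space M)) = prob a * prob (X -` C \<inter> space M)"
    by (rule indep_setD[OF ind a' D[OF C']])
  moreover have "(\<lambda>\<omega>. \<omega>) -` a \<inter> space M = a" using sub by auto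
  ultimately show "emeasure (distr M A (\<lambda>\<omega>. \<omega>)) a * emeasure (distr M N X) C
      = emeasure (distr M (A \<Otimes>\<^sub>M N) (\<lambda>\<omega>. (\<omega>, X \<omega>))) (a \<times> C)"
    using a' C' pair by (simp add: emeasure_distr id X emeasure_eq_measure ennreal_mult)
qed simp

locale brownian = prob_space M for M :: "'a measure" +
  fixes F :: "real \<Rightarrow> 'a measure" and B :: "real \<Rightarrow> 'a \<Rightarrow> real"
  assumes bm: "brownian_motion M F B"
begin

lemma space_F: "space (F t) = space M"
  using bm by (auto simp: brownian_motion_def filtration_def)

lemma measurable_F_mono:
  "f \<in> measurable (F s) N \<Longrightarrow> s \<le> t \<Longrightarrow> f \<in> measurable (F t) N"
  using bm measurable_mono[of N N "F s" "F t"]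
  by (auto simp: brownian_motion_def filtration_def)

lemma measurable_F_M:
  "f \<in> measurable (F t) N \<Longrightarrow> 0 \<le> t \<Longrightarrow> f \<in> measurable M N"
  using bm measurable_mono[of N N "F t" "M"]
  by (auto simp: brownian_motion_def subalgebra_def)

lemma B_adapted: "0 \<le> s \<Longrightarrow> s \<le> t \<Longrightarrow> B s \<in> borel_measurable (F t)"
  using bm measurable_F_mono[of "B s" s borel t] by (auto simp: brownian_motion_def)

lemma B_increment_indep:
  assumes "0 \<le> s" "s < t"
  shows "distr M (F s \<Otimes>\<^sub>M borel) (\<lambda>\<omega>. (\<omega>, B t \<omega> - B s \<omega>)) =
    distr M (F s) (\<lambda>\<omega>. \<omega>) \<Otimes>\<^sub>M density lborel (normal_density 0 (sqrt (t - s)))"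
proof -
  have B: "(\<lambda>\<omega>. B t \<omega> - B s \<omega>) \<in> borel_measurable M"
    using assms by (intro measurable_F_M[of _ t] borel_measurable_diff B_adapted) auto
  have id: "(\<lambda>\<omega>. \<omega>) \<in> measurable M (F s)"
    using assms by (intro measurable_F_M[OF measurable_ident_sets[OF refl]]) simp
  have ind: "indep_set (sets (F s)) (sets (vimage_algebra (space M) (\<lambda>\<omega>. B t \<omega> - B s \<omega>) borel))"
   and dist: "distributed M lborel (\<lambda>\<omega>. B t \<omega> - B s \<omega>) (normal_density 0 (sqrt (t - s)))"
    using bm assms by (auto simp: brownian_motion_def)
  have "distr M (F s \<Otimes>\<^sub>M borel) (\<lambda>\<omega>. (\<omega>, B t \<omega> - B s \<omega>)) =
    distr M (F s) (\<lambda>\<omega>. \<omega>) \<Otimes>\<^sub>M distr M borel (\<lambda>\<omega>. B t \<omega> - B s \<omega>)"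
    by (rule distr_pair_indep[OF id B ind]) (auto intro: in_vimage_algebra simp: space_F)
  also have "distr M borel (\<lambda>\<omega>. B t \<omega> - B s \<omega>) = distr M lborel (\<lambda>\<omega>. B t \<omega> - B s \<omega>)"
    by (rule distr_cong) auto
  also have "\<dots> = density lborel (normal_density 0 (sqrt (t - s)))"
    using dist by (simp add: distributed_def)
  finally show ?thesis .
qed

end

text \<open>Completing the square turns the integrand into the density of the normal law with mean \<open>x v\<close>.\<close>

lemma normal_exponential_moment:
  fixes x v :: real
  assumes "0 < v"
  shows "(\<integral>\<^sup>+z. ennreal (exp (x * z - x\<^sup>2 * v / 2)) \<partial>density lborel (normal_density 0 (sqrt v))) = 1"
proof -
  have "normal_density 0 (sqrt v) z * exp (x * z - x\<^sup>2 * v / 2) = normal_density (x * v) (sqrt v) z" for z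
  proof -
    have "- (z - 0)\<^sup>2 / (2 * v) + (x * z - x\<^sup>2 * v / 2) = - (z - x * v)\<^sup>2 / (2 * v)"
      using assms by (simp add: divide_simps power2_eq_square) algebra
    then show ?thesis
      using assms by (simp add: normal_density_def mult_exp_exp)
  qed
  then have "(\<integral>\<^sup>+z. ennreal (exp (x * z - x\<^sup>2 * v / 2)) \<partial>density lborel (normal_density 0 (sqrt v)))
    = (\<integral>\<^sup>+z. ennreal (normal_density (x * v) (sqrt v) z) \<partial>lborel)"
    by (subst nn_integral_density) (auto simp: ennreal_mult[symmetric])
  also have "\<dots> = 1"
    using assms by (simp add: nn_integral_eq_integral)
  finally show ?thesis .
qed

context brownian
begin

text \<open>Given the past, the exponent is Gaussian with variance \<open>\<xi>\<^sup>2 (t - s)\<close>, and the compensator \<open>\<xi>\<^sup>2 (t - s) / 2\<close>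
is the logarithm of its exponential moment. The integrals take values in \<open>[0,\<infinity>]\<close>, so \<open>\<xi>\<close> and \<open>Y\<close> may be
unbounded.\<close>

lemma exponential_step:
  assumes st: "0 \<le> s" "s \<le> t"
    and [measurable]: "\<xi> \<in> borel_measurable (F s)" "Y \<in> borel_measurable (F s)"
  shows "(\<integral>\<^sup>+\<omega>. Y \<omega> * ennreal (exp (\<xi> \<omega> * (B t \<omega> - B s \<omega>) - (\<xi> \<omega>)\<^sup>2 * (t - s) / 2)) \<partial>M) = (\<integral>\<^sup>+\<omega>. Y \<omega> \<partial>M)"
proof (cases "s = t")
  case False
  then have st: "0 \<le> s" "s < t" using st by auto
  let ?N = "density lborel (normal_density 0 (sqrt (t - s)))"
  interpret N: prob_space ?N by (rule prob_space_normal_density) (use st in auto)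
  have B: "(\<lambda>\<omega>. B t \<omega> - B s \<omega>) \<in> borel_measurable M"
    using st by (intro measurable_F_M[of _ t] borel_measurable_diff B_adapted) auto
  have id: "(\<lambda>\<omega>. \<omega>) \<in> measurable M (F s)"
    using st by (intro measurable_F_M[OF measurable_ident_sets[OF refl]]) simp
  define f where "f = (\<lambda>(\<omega>, z). Y \<omega> * ennreal (exp (\<xi> \<omega> * z - (\<xi> \<omega>)\<^sup>2 * (t - s) / 2)))"
  have f: "f \<in> borel_measurable (F s \<Otimes>\<^sub>M borel)" unfolding f_def by measurable
  have "(\<integral>\<^sup>+\<omega>. Y \<omega> * ennreal (exp (\<xi> \<omega> * (B t \<omega> - B s \<omega>) - (\<xi> \<omega>)\<^sup>2 * (t - s) / 2)) \<partial>M)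
    = (\<integral>\<^sup>+\<omega>. f (\<omega>, B t \<omega> - B s \<omega>) \<partial>M)" by (simp add: f_def)
  also have "\<dots> = (\<integral>\<^sup>+p. f p \<partial>distr M (F s \<Otimes>\<^sub>M borel) (\<lambda>\<omega>. (\<omega>, B t \<omega> - B s \<omega>)))"
    using f by (subst nn_integral_distr) (auto intro!: measurable_Pair B id)
  also have "\<dots> = (\<integral>\<^sup>+p. f p \<partial>(distr M (F s) (\<lambda>\<omega>. \<omega>) \<Otimes>\<^sub>M ?N))"
    by (simp add: B_increment_indep[OF st])
  also have "\<dots> = (\<integral>\<^sup>+\<omega>. \<integral>\<^sup>+z. f (\<omega>, z) \<partial>?N \<partial>distr M (F s) (\<lambda>\<omega>. \<omega>))"
    using f by (subst N.nn_integral_fst[symmetric]) (auto cong: measurable_cong_sets)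
  also have "\<dots> = (\<integral>\<^sup>+\<omega>. Y \<omega> \<partial>distr M (F s) (\<lambda>\<omega>. \<omega>))"
    using st by (intro nn_integral_cong) (simp add: f_def nn_integral_cmult normal_exponential_moment)
  also have "\<dots> = (\<integral>\<^sup>+\<omega>. Y \<omega> \<partial>M)"
    by (subst nn_integral_distr) (auto intro: id)
  finally show ?thesis .
qed simp

lemma exponential_sum:
  assumes "0 \<le> \<sigma> 0" and mono: "\<And>k. k < n \<Longrightarrow> \<sigma> k \<le> \<sigma> (Suc k)"
    and ad: "\<And>k. k < n \<Longrightarrow> \<xi> k \<in> borel_measurable (F (\<sigma> k))"
    and Y: "Y \<in> borel_measurable (F (\<sigma> 0))"
  shows "(\<integral>\<^sup>+\<omega>. Y \<omega> * ennreal (exp ((\<Sum>k<n. \<xi> k \<omega> * (B (\<sigma> (Suc k)) \<omega> - B (\<sigma> k) \<omega>))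
            - (\<Sum>k<n. (\<xi> k \<omega>)\<^sup>2 * (\<sigma> (Suc k) - \<sigma> k)) / 2)) \<partial>M) = (\<integral>\<^sup>+\<omega>. Y \<omega> \<partial>M)"
  using mono ad
proof (induction n)
  case (Suc n)
  define X where "X = (\<lambda>\<omega>. \<Sum>k<n. \<xi> k \<omega> * (B (\<sigma> (Suc k)) \<omega> - B (\<sigma> k) \<omega>))"
  define q where "q = (\<lambda>\<omega>. \<Sum>k<n. (\<xi> k \<omega>)\<^sup>2 * (\<sigma> (Suc k) - \<sigma> k))"
  have le: "\<sigma> i \<le> \<sigma> j" if "i \<le> j" "j \<le> Suc n" for i j
    by (rule chain_le[OF _ that]) (rule Suc.prems(1))
  have \<sigma>0: "0 \<le> \<sigma> k" if "k \<le> Suc n" for k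
    using le[of 0 k] that assms(1) by simp
  have xi [measurable]: "\<xi> k \<in> borel_measurable (F (\<sigma> n))" if "k < Suc n" for k
    using measurable_F_mono[OF Suc.prems(2)[OF that], of "\<sigma> n"] le[of k n] that by simp
  have B [measurable]: "B (\<sigma> k) \<in> borel_measurable (F (\<sigma> n))" if "k \<le> n" for k
    using that by (intro B_adapted \<sigma>0 le) auto
  have [measurable]: "X \<in> borel_measurable (F (\<sigma> n))" "q \<in> borel_measurable (F (\<sigma> n))"
    unfolding X_def q_def by (auto intro!: borel_measurable_sum borel_measurable_times borel_measurable_diff B xi)
  have [measurable]: "Y \<in> borel_measurable (F (\<sigma> n))"
    using le[of 0 n] by (intro measurable_F_mono[OF Y]) auto
  have "exp (X \<omega> + \<xi> n \<omega> * (B (\<sigma> (Suc n)) \<omega> - B (\<sigma> n) \<omega>) - (q \<omega> + (\<xi> n \<omega>)\<^sup>2 * (\<sigma> (Suc n) - \<sigma> n)) / 2)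
      = exp (X \<omega> - q \<omega> / 2) * exp (\<xi> n \<omega> * (B (\<sigma> (Suc n)) \<omega> - B (\<sigma> n) \<omega>) - (\<xi> n \<omega>)\<^sup>2 * (\<sigma> (Suc n) - \<sigma> n) / 2)" for \<omega>
    by (simp add: mult_exp_exp field_simps)
  then have "(\<integral>\<^sup>+\<omega>. Y \<omega> * ennreal (exp (X \<omega> + \<xi> n \<omega> * (B (\<sigma> (Suc n)) \<omega> - B (\<sigma> n) \<omega>)
        - (q \<omega> + (\<xi> n \<omega>)\<^sup>2 * (\<sigma> (Suc n) - \<sigma> n)) / 2)) \<partial>M)
    = (\<integral>\<^sup>+\<omega>. (Y \<omega> * ennreal (exp (X \<omega> - q \<omega> / 2)))
        * ennreal (exp (\<xi> n \<omega> * (B (\<sigma> (Suc n)) \<omega> - B (\<sigma> n) \<omega>) - (\<xi> n \<omega>)\<^sup>2 * (\<sigma> (Suc n) - \<sigma> n) / 2)) \<partial>M)"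
    by (simp add: ennreal_mult mult.assoc)
  also have "\<dots> = (\<integral>\<^sup>+\<omega>. Y \<omega> * ennreal (exp (X \<omega> - q \<omega> / 2)) \<partial>M)"
    by (rule exponential_step) (auto intro!: \<sigma>0 le xi)
  also have "\<dots> = (\<integral>\<^sup>+\<omega>. Y \<omega> \<partial>M)"
    using Suc unfolding X_def q_def by simp
  finally show ?case by (simp add: X_def q_def)
qed simp

text \<open>When integrands are replaced by their limit, the equality of the preceding lemma may become a strict
inequality. This version survives the limit because its right-hand side involves only bounded
functions of the sum \<open>X\<close> and its quadratic variation \<open>q\<close>. The coefficient of step \<open>k\<close> is known at the
start of that step, so the sum can be stopped just before its quadratic variation exceeds \<open>1\<close>. The
stopped exponential has mean one and second moment at most \<open>exp 1\<close>, and it equals the original one on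
\<open>q \<le> 1\<close>.\<close>

lemma exponential_sum_truncated:
  assumes s0: "0 \<le> \<sigma> 0" and mono: "\<And>k. k < n \<Longrightarrow> \<sigma> k \<le> \<sigma> (Suc k)"
    and ad: "\<And>k. k < n \<Longrightarrow> \<xi> k \<in> borel_measurable (F (\<sigma> k))"
    and Y: "Y \<in> borel_measurable (F (\<sigma> 0))" and Y01: "\<And>\<omega>. 0 \<le> Y \<omega>" "\<And>\<omega>. Y \<omega> \<le> (1::real)"
    and X: "\<And>\<omega>. X \<omega> = (\<Sum>k<n. \<xi> k \<omega> * (B (\<sigma> (Suc k)) \<omega> - B (\<sigma> k) \<omega>))"
    and q: "\<And>\<omega>. q \<omega> = (\<Sum>k<n. (\<xi> k \<omega>)\<^sup>2 * (\<sigma> (Suc k) - \<sigma> k))"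
    and L: "0 < L"
  shows "(\<integral>\<^sup>+\<omega>. Y \<omega> \<partial>M) \<le> (\<integral>\<^sup>+\<omega>. ennreal (min (Y \<omega> * exp (X \<omega> - q \<omega> / 2)) L) \<partial>M)
     + ennreal L * emeasure M {\<omega>\<in>space M. 1 < q \<omega>} + ennreal (exp 1 / L)"
proof -
  define \<zeta> where "\<zeta> = (\<lambda>k \<omega>. if (\<Sum>i<Suc k. (\<xi> i \<omega>)\<^sup>2 * (\<sigma> (Suc i) - \<sigma> i)) \<le> 1 then \<xi> k \<omega> else 0)"
  define X' where "X' = (\<lambda>\<omega>. \<Sum>k<n. \<zeta> k \<omega> * (B (\<sigma> (Suc k)) \<omega> - B (\<sigma> k) \<omega>))"
  define q' where "q' = (\<lambda>\<omega>. \<Sum>k<n. (\<zeta> k \<omega>)\<^sup>2 * (\<sigma> (Suc k) - \<sigma> k))"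
  have le: "\<sigma> i \<le> \<sigma> j" if "i \<le> j" "j \<le> n" for i j
    by (rule chain_le[OF _ that]) (rule mono)
  have \<sigma>0: "0 \<le> \<sigma> k" if "k \<le> n" for k
    using le[of 0 k] that s0 by simp
  have xi_M: "\<xi> k \<in> borel_measurable M" if "k < n" for k
    using that by (intro measurable_F_M[OF ad] \<sigma>0) auto
  have B_M: "B (\<sigma> k) \<in> borel_measurable M" if "k \<le> n" for k
    using that by (intro measurable_F_M[OF B_adapted] \<sigma>0) (auto intro: \<sigma>0)
  have zeta: "\<zeta> k \<in> borel_measurable (F (\<sigma> k))" if k: "k < n" for k
  proof -
    have x: "\<xi> i \<in> borel_measurable (F (\<sigma> k))" if "i < Suc k" for i
      using that k by (intro measurable_F_mono[OF ad] le) auto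
    have [measurable]: "(\<lambda>\<omega>. \<Sum>i<Suc k. (\<xi> i \<omega>)\<^sup>2 * (\<sigma> (Suc i) - \<sigma> i)) \<in> borel_measurable (F (\<sigma> k))"
      by (intro borel_measurable_sum borel_measurable_times borel_measurable_power x) auto
    have [measurable]: "\<xi> k \<in> borel_measurable (F (\<sigma> k))" using x by simp
    show ?thesis unfolding \<zeta>_def by measurable
  qed
  have zeta_M: "\<zeta> k \<in> borel_measurable M" if "k < n" for k
    using that by (intro measurable_F_M[OF zeta] \<sigma>0) auto
  have X_eq: "X = (\<lambda>\<omega>. \<Sum>k<n. \<xi> k \<omega> * (B (\<sigma> (Suc k)) \<omega> - B (\<sigma> k) \<omega>))"
   and q_eq: "q = (\<lambda>\<omega>. \<Sum>k<n. (\<xi> k \<omega>)\<^sup>2 * (\<sigma> (Suc k) - \<sigma> k))"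
    using X q by auto
  have [measurable]: "X \<in> borel_measurable M" "q \<in> borel_measurable M"
      "X' \<in> borel_measurable M" "q' \<in> borel_measurable M"
    unfolding X_eq q_eq X'_def q'_def
    by (auto intro!: borel_measurable_sum borel_measurable_times borel_measurable_power borel_measurable_diff B_M xi_M zeta_M)
  have [measurable]: "Y \<in> borel_measurable M" using measurable_F_M[OF Y s0] .
  have q'_le: "q' \<omega> \<le> 1" for \<omega>
  proof -
    have "m \<le> n \<Longrightarrow> (\<Sum>k<m. (\<zeta> k \<omega>)\<^sup>2 * (\<sigma> (Suc k) - \<sigma> k)) \<le> 1" for m
    proof (induction m)
      case (Suc m)
      show ?case
      proof (cases "(\<Sum>i<Suc m. (\<xi> i \<omega>)\<^sup>2 * (\<sigma> (Suc i) - \<sigma> i)) \<le> 1")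
        case True
        have "(\<Sum>k<Suc m. (\<zeta> k \<omega>)\<^sup>2 * (\<sigma> (Suc k) - \<sigma> k)) \<le> (\<Sum>i<Suc m. (\<xi> i \<omega>)\<^sup>2 * (\<sigma> (Suc i) - \<sigma> i))"
          using Suc.prems by (intro sum_mono mult_right_mono) (auto simp: \<zeta>_def mono)
        then show ?thesis using True by simp
      next
        case False
        then have "\<zeta> m \<omega> = 0" by (simp add: \<zeta>_def)
        then show ?thesis using Suc by simp
      qed
    qed simp
    from this[of n] show ?thesis by (simp add: q'_def)
  qed
  have same: "X' \<omega> = X \<omega> \<and> q' \<omega> = q \<omega>" if "q \<omega> \<le> 1" for \<omega>
  proof -
    have "\<zeta> k \<omega> = \<xi> k \<omega>" if k: "k < n" for k
    proof -
      have "(\<Sum>i<Suc k. (\<xi> i \<omega>)\<^sup>2 * (\<sigma> (Suc i) - \<sigma> i)) \<le> q \<omega>"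
        unfolding q using k mono by (intro sum_mono2) auto
      then show ?thesis using \<open>q \<omega> \<le> 1\<close> by (simp add: \<zeta>_def)
    qed
    then show ?thesis by (simp add: X q X'_def q'_def)
  qed
  \<comment> \<open>Either \<open>z \<le> L\<close> or \<open>z \<le> z\<^sup>2 / L\<close>: the part above \<open>L\<close> is paid for by the second moment.\<close>
  have pw: "ennreal (Y \<omega> * exp (X' \<omega> - q' \<omega> / 2)) \<le>
      ennreal (min (Y \<omega> * exp (X \<omega> - q \<omega> / 2)) L) + ennreal L * indicator {\<omega>\<in>space M. 1 < q \<omega>} \<omega>
      + ennreal (exp 1 / L) * ennreal (exp (2 * X' \<omega> - 4 * q' \<omega> / 2))" if "\<omega> \<in> space M" for \<omega>
  proof -
    define z where "z = exp (X' \<omega> - q' \<omega> / 2)"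
    have z: "0 < z" by (simp add: z_def)
    have "z\<^sup>2 = exp (2 * X' \<omega> - 4 * q' \<omega> / 2) * exp (q' \<omega>)"
      by (simp add: z_def mult_exp_exp power2_eq_square)
    also have "\<dots> \<le> exp (2 * X' \<omega> - 4 * q' \<omega> / 2) * exp 1"
      using q'_le by (intro mult_left_mono) auto
    finally have z2: "z\<^sup>2 / L \<le> exp 1 / L * exp (2 * X' \<omega> - 4 * q' \<omega> / 2)"
      using L by (simp add: divide_simps mult.commute)
    have zL: "z \<le> z\<^sup>2 / L" if "L < z"
      using that L z by (simp add: field_simps power2_eq_square)
    have yz: "Y \<omega> * z \<le> z" "0 \<le> Y \<omega> * z"
      using Y01[of \<omega>] z by (auto simp: mult_left_le_one_le)
    have "Y \<omega> * z \<le> min (Y \<omega> * exp (X \<omega> - q \<omega> / 2)) L + L * indicator {\<omega>\<in>space M. 1 < q \<omega>} \<omega> + z\<^sup>2 / L"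
    proof (cases "q \<omega> \<le> 1")
      case True
      then have e: "exp (X \<omega> - q \<omega> / 2) = z" using same by (simp add: z_def)
      show ?thesis
        using True yz zL L by (cases "Y \<omega> * z \<le> L") (auto simp: e)
    next
      case False
      then have "indicator {\<omega>\<in>space M. 1 < q \<omega>} \<omega> = (1::real)" using that by simp
      moreover have "0 \<le> min (Y \<omega> * exp (X \<omega> - q \<omega> / 2)) L" using Y01[of \<omega>] L by simp
      moreover have "Y \<omega> * z \<le> L + z\<^sup>2 / L"
      proof (cases "z \<le> L")
        case True
        have "0 \<le> z\<^sup>2 / L" using L by simp
        then show ?thesis using True yz by linarith
      qed (use yz zL L in linarith)
      ultimately show ?thesis by (simp only: mult_1_right)
    qed
    also have "\<dots> \<le> min (Y \<omega> * exp (X \<omega> - q \<omega> / 2)) L + L * indicator {\<omega>\<in>space M. 1 < q \<omega>} \<omega>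
       + exp 1 / L * exp (2 * X' \<omega> - 4 * q' \<omega> / 2)" using z2 by simp
    finally have "ennreal (Y \<omega> * z) \<le> ennreal (min (Y \<omega> * exp (X \<omega> - q \<omega> / 2)) L
       + L * indicator {\<omega>\<in>space M. 1 < q \<omega>} \<omega> + exp 1 / L * exp (2 * X' \<omega> - 4 * q' \<omega> / 2))"
      by (rule ennreal_leI)
    also have "\<dots> = ennreal (min (Y \<omega> * exp (X \<omega> - q \<omega> / 2)) L) + ennreal (L * indicator {\<omega>\<in>space M. 1 < q \<omega>} \<omega>)
       + ennreal (exp 1 / L * exp (2 * X' \<omega> - 4 * q' \<omega> / 2))"
      using Y01[of \<omega>] L by (simp add: ennreal_plus)
    also have "\<dots> = ennreal (min (Y \<omega> * exp (X \<omega> - q \<omega> / 2)) L) + ennreal L * indicator {\<omega>\<in>space M. 1 < q \<omega>} \<omega>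
       + ennreal (exp 1 / L) * ennreal (exp (2 * X' \<omega> - 4 * q' \<omega> / 2))"
    proof -
      have "ennreal (exp 1 / L * exp (2 * X' \<omega> - 4 * q' \<omega> / 2)) = ennreal (exp 1 / L) * ennreal (exp (2 * X' \<omega> - 4 * q' \<omega> / 2))"
        using L by (intro ennreal_mult) auto
      then show ?thesis by (simp add: indicator_def)
    qed
    finally show ?thesis by (simp add: z_def)
  qed
  have "(\<integral>\<^sup>+\<omega>. Y \<omega> \<partial>M) = (\<integral>\<^sup>+\<omega>. ennreal (Y \<omega>) * ennreal (exp (X' \<omega> - q' \<omega> / 2)) \<partial>M)"
    unfolding X'_def q'_def using Y
    by (intro exponential_sum[symmetric] s0 mono zeta) auto
  also have "\<dots> = (\<integral>\<^sup>+\<omega>. ennreal (Y \<omega> * exp (X' \<omega> - q' \<omega> / 2)) \<partial>M)"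
    using Y01 by (simp add: ennreal_mult)
  also have "\<dots> \<le> (\<integral>\<^sup>+\<omega>. ennreal (min (Y \<omega> * exp (X \<omega> - q \<omega> / 2)) L) + ennreal L * indicator {\<omega>\<in>space M. 1 < q \<omega>} \<omega>
      + ennreal (exp 1 / L) * ennreal (exp (2 * X' \<omega> - 4 * q' \<omega> / 2)) \<partial>M)"
    by (rule nn_integral_mono) (rule pw)
  also have "\<dots> = (\<integral>\<^sup>+\<omega>. ennreal (min (Y \<omega> * exp (X \<omega> - q \<omega> / 2)) L) \<partial>M)
     + L * emeasure M {\<omega>\<in>space M. 1 < q \<omega>}
     + ennreal (exp 1 / L) * (\<integral>\<^sup>+\<omega>. ennreal (exp (2 * X' \<omega> - 4 * q' \<omega> / 2)) \<partial>M)"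
    by (simp add: nn_integral_add nn_integral_cmult nn_integral_cmult_indicator)
  \<comment> \<open>This is the exponential of the doubled coefficients, whose quadratic variation is \<open>4 q'\<close>.\<close>
  also have "(\<integral>\<^sup>+\<omega>. ennreal (exp (2 * X' \<omega> - 4 * q' \<omega> / 2)) \<partial>M) = 1"
  proof -
    have "(\<integral>\<^sup>+\<omega>. 1 * ennreal (exp ((\<Sum>k<n. (2 * \<zeta> k \<omega>) * (B (\<sigma> (Suc k)) \<omega> - B (\<sigma> k) \<omega>))
            - (\<Sum>k<n. (2 * \<zeta> k \<omega>)\<^sup>2 * (\<sigma> (Suc k) - \<sigma> k)) / 2)) \<partial>M) = (\<integral>\<^sup>+\<omega>. 1 \<partial>M)"
      using zeta by (intro exponential_sum s0 mono) auto
    moreover have "(\<Sum>k<n. (2 * \<zeta> k \<omega>) * (B (\<sigma> (Suc k)) \<omega> - B (\<sigma> k) \<omega>)) = 2 * X' \<omega>"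
      "(\<Sum>k<n. (2 * \<zeta> k \<omega>)\<^sup>2 * (\<sigma> (Suc k) - \<sigma> k)) = 4 * q' \<omega>" for \<omega>
      by (simp_all add: X'_def q'_def sum_distrib_left power_mult_distrib mult.assoc)
    ultimately show ?thesis by (simp add: emeasure_space_1)
  qed
  finally show ?thesis by simp
qed

end

section \<open>Sums along adapted grids and convergence in probability\<close>

text \<open>Convergence in \<open>L\<^sup>2\<close> implies convergence of the squared norms, because
\<open>\<bar>x\<^sup>2 - y\<^sup>2\<bar> \<le> \<epsilon> y\<^sup>2 + (1 + 1/\<epsilon>)(x - y)\<^sup>2\<close>.\<close>

lemma nn_integral_square_tendsto:
  fixes h :: "nat \<Rightarrow> 'b \<Rightarrow> real"
  assumes [measurable]: "\<And>m. h m \<in> borel_measurable N" "g \<in> borel_measurable N"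
    and A: "\<And>m. (\<integral>\<^sup>+s. ennreal ((h m s)\<^sup>2) \<partial>N) = ennreal (A m)" "\<And>m. 0 \<le> A m"
    and G: "(\<integral>\<^sup>+s. ennreal ((g s)\<^sup>2) \<partial>N) = ennreal G" "0 \<le> G"
    and lim: "(\<lambda>m. \<integral>\<^sup>+s. ennreal ((h m s - g s)\<^sup>2) \<partial>N) \<longlonglongrightarrow> 0"
  shows "A \<longlonglongrightarrow> G"
proof (rule LIMSEQ_I)
  fix r :: real assume r: "0 < r"
  define \<epsilon> where "\<epsilon> = r / (2 * (G + 1))"
  have \<epsilon>: "0 < \<epsilon>" using r G by (simp add: \<epsilon>_def)
  have \<epsilon>G: "\<epsilon> * G < r / 2 + 0"
  proof -
    have "\<epsilon> * G < \<epsilon> * (G + 1)" using \<epsilon> by simp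
    also have "\<dots> = r / 2" using G by (simp add: \<epsilon>_def field_simps)
    finally show ?thesis by simp
  qed
  define K where "K = 1 + 1 / \<epsilon>"
  have K: "0 < K" using \<epsilon> by (simp add: K_def add_pos_pos)
  have pw: "x\<^sup>2 \<le> y\<^sup>2 + \<epsilon> * y\<^sup>2 + K * (x - y)\<^sup>2" "y\<^sup>2 \<le> x\<^sup>2 + \<epsilon> * y\<^sup>2 + K * (x - y)\<^sup>2" for x y :: real
  proof -
    have "0 \<le> (\<epsilon> * y - (x - y))\<^sup>2 / \<epsilon>" "0 \<le> (\<epsilon> * y + (x - y))\<^sup>2 / \<epsilon>" using \<epsilon> by auto
    then have "2 * y * (x - y) \<le> \<epsilon> * y\<^sup>2 + (x - y)\<^sup>2 / \<epsilon>" "- (2 * y * (x - y)) \<le> \<epsilon> * y\<^sup>2 + (x - y)\<^sup>2 / \<epsilon>"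
      using \<epsilon> by (simp_all add: power2_eq_square field_simps)
    moreover have "x\<^sup>2 = y\<^sup>2 + 2 * y * (x - y) + (x - y)\<^sup>2" by (simp add: power2_eq_square algebra_simps)
    moreover have "K * (x - y)\<^sup>2 = (x - y)\<^sup>2 + (x - y)\<^sup>2 / \<epsilon>" by (simp add: K_def algebra_simps)
    ultimately show "x\<^sup>2 \<le> y\<^sup>2 + \<epsilon> * y\<^sup>2 + K * (x - y)\<^sup>2" "y\<^sup>2 \<le> x\<^sup>2 + \<epsilon> * y\<^sup>2 + K * (x - y)\<^sup>2"
      using zero_le_power2[of "x - y"] by linarith+
  qed
  have "eventually (\<lambda>m. (\<integral>\<^sup>+s. ennreal ((h m s - g s)\<^sup>2) \<partial>N) < ennreal (r / (2 * K))) sequentially"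
    using lim r K by (intro order_tendstoD(2)[of _ 0]) auto
  then have "eventually (\<lambda>m. norm (A m - G) < r) sequentially"
  proof eventually_elim
    case (elim m)
    then obtain d where d: "(\<integral>\<^sup>+s. ennreal ((h m s - g s)\<^sup>2) \<partial>N) = ennreal d" "0 \<le> d"
      by (cases "(\<integral>\<^sup>+s. ennreal ((h m s - g s)\<^sup>2) \<partial>N)") auto
    have "d < r / (2 * K)" using elim d r K by (simp add: ennreal_less_iff)
    then have Kd: "K * d < r / 2" using K by (simp add: field_simps)
    have e1: "ennreal (a\<^sup>2 + \<epsilon> * b\<^sup>2 + K * c\<^sup>2) = ennreal (a\<^sup>2) + ennreal \<epsilon> * ennreal (b\<^sup>2) + ennreal K * ennreal (c\<^sup>2)" for a b c
      using \<epsilon> K by (simp add: ennreal_plus ennreal_mult)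
    have "ennreal (A m) \<le> (\<integral>\<^sup>+s. ennreal ((g s)\<^sup>2 + \<epsilon> * (g s)\<^sup>2 + K * (h m s - g s)\<^sup>2) \<partial>N)"
      unfolding A(1)[symmetric] by (intro nn_integral_mono ennreal_leI pw)
    also have "\<dots> = ennreal (G + \<epsilon> * G + K * d)"
      unfolding e1 using G d \<epsilon> K by (simp add: nn_integral_add nn_integral_cmult ennreal_plus ennreal_mult)
    finally have 1: "A m \<le> G + \<epsilon> * G + K * d"
      using G d \<epsilon> K by (subst (asm) ennreal_le_iff) auto
    have "ennreal G \<le> (\<integral>\<^sup>+s. ennreal ((h m s)\<^sup>2 + \<epsilon> * (g s)\<^sup>2 + K * (h m s - g s)\<^sup>2) \<partial>N)"
      unfolding G(1)[symmetric] by (intro nn_integral_mono ennreal_leI pw)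
    also have "\<dots> = ennreal (A m + \<epsilon> * G + K * d)"
      unfolding e1 using A G d \<epsilon> K by (simp add: nn_integral_add nn_integral_cmult ennreal_plus ennreal_mult)
    finally have 2: "G \<le> A m + \<epsilon> * G + K * d"
      using A G d \<epsilon> K by (subst (asm) ennreal_le_iff) auto
    show ?case using 1 2 Kd \<epsilon>G by (simp add: abs_less_iff)
  qed
  then show "\<exists>no. \<forall>n\<ge>no. norm (A n - G) < r" by (simp add: eventually_sequentially)
qed

text \<open>Convergence in probability is handled as convergence of \<open>E[min 1 X\<^sub>m]\<close>, which is stable under sums and
gives an almost surely convergent subsequence by completeness of \<open>L\<^sup>1\<close>.\<close>

lemma nn_integral_tendsto_0_AE_subseq:
  fixes f :: "nat \<Rightarrow> 'a \<Rightarrow> ennreal"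
  assumes [measurable]: "\<And>m. f m \<in> borel_measurable M" and "finite_measure M"
    and lim: "(\<lambda>m. \<integral>\<^sup>+\<omega>. min 1 (f m \<omega>) \<partial>M) \<longlonglongrightarrow> 0"
  shows "\<exists>r::nat\<Rightarrow>nat. strict_mono r \<and> (AE \<omega> in M. (\<lambda>m. f (r m) \<omega>) \<longlonglongrightarrow> 0)"
proof -
  interpret finite_measure M by fact
  define u where "u = (\<lambda>m \<omega>. enn2real (min 1 (f m \<omega>)))"
  have fin: "min 1 (f m \<omega>) < top" for m \<omega>
    by (simp add: min_less_iff_disj)
  have u: "ennreal (u m \<omega>) = min 1 (f m \<omega>)" for m \<omega>
    unfolding u_def by (rule ennreal_enn2real[OF fin])
  have u1: "0 \<le> u m \<omega>" "u m \<omega> \<le> 1" for m \<omega>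
  proof -
    show "0 \<le> u m \<omega>" by (simp add: u_def)
    have "ennreal (u m \<omega>) \<le> ennreal 1" unfolding u by simp
    then show "u m \<omega> \<le> 1" by (subst (asm) ennreal_le_iff) auto
  qed
  have [measurable]: "u m \<in> borel_measurable M" for m unfolding u_def by measurable
  have int: "integrable M (u m)" for m
    using u1 by (intro integrable_const_bound[where B = 1]) auto
  have "ennreal (\<integral>\<omega>. norm (u m \<omega>) \<partial>M) = (\<integral>\<^sup>+\<omega>. min 1 (f m \<omega>) \<partial>M)" for m
    using nn_integral_eq_integral[OF int[of m]] u1 by (simp add: u)
  then have "(\<lambda>m. ennreal (\<integral>\<omega>. norm (u m \<omega>) \<partial>M)) \<longlonglongrightarrow> ennreal 0" using lim by simp
  then have "(\<lambda>m. \<integral>\<omega>. norm (u m \<omega>) \<partial>M) \<longlonglongrightarrow> 0"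
    by (subst (asm) tendsto_ennreal_iff) auto
  from tendsto_L1_AE_subseq[OF int this] obtain r :: "nat \<Rightarrow> nat" where
    r: "strict_mono r" "AE \<omega> in M. (\<lambda>m. u (r m) \<omega>) \<longlonglongrightarrow> 0" by blast
  have "(\<lambda>m. f (r m) \<omega>) \<longlonglongrightarrow> 0" if "(\<lambda>m. u (r m) \<omega>) \<longlonglongrightarrow> 0" for \<omega>
  proof -
    have l: "(\<lambda>m. min 1 (f (r m) \<omega>)) \<longlonglongrightarrow> 0"
      using tendsto_ennrealI[OF that] by (simp add: u)
    have "eventually (\<lambda>m. min 1 (f (r m) \<omega>) < 1) sequentially"
      by (rule order_tendstoD(2)[OF l]) simp
    then have "eventually (\<lambda>m. min 1 (f (r m) \<omega>) = f (r m) \<omega>) sequentially"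
      by eventually_elim (auto simp: min_def split: if_splits)
    then show ?thesis using l by (simp cong: tendsto_cong)
  qed
  then show ?thesis using r by (intro exI[of _ r]) auto
qed

lemma ennreal_tendsto_0I:
  fixes f :: "'b \<Rightarrow> ennreal"
  assumes "\<And>e. 0 < e \<Longrightarrow> eventually (\<lambda>m. f m \<le> ennreal e) F"
  shows "(f \<longlongrightarrow> 0) F"
proof (rule order_tendstoI)
  fix a :: ennreal assume "0 < a"
  then obtain b where b: "0 < b" "b < a" using dense by blast
  then have "b < top" by (auto intro: less_trans simp: less_top[symmetric])
  then obtain e where e: "b = ennreal e" "0 \<le> e" by (cases b) auto
  with b have "0 < e" by (simp add: ennreal_less_zero_iff)
  from assms[OF this] show "eventually (\<lambda>m. f m < a) F"
    by eventually_elim (use b e in auto)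
qed simp

lemma (in prob_space) vanishes_in_prob_nn_integral:
  fixes X :: "nat \<Rightarrow> 'a \<Rightarrow> ennreal"
  assumes [measurable]: "\<And>m. X m \<in> borel_measurable M" and v: "vanishes_in_prob M X"
  shows "(\<lambda>m. \<integral>\<^sup>+\<omega>. min 1 (X m \<omega>) \<partial>M) \<longlonglongrightarrow> 0"
proof (rule ennreal_tendsto_0I)
  fix e :: real assume e: "0 < e"
  have "eventually (\<lambda>m. measure M {\<omega>\<in>space M. ennreal (e / 2) < X m \<omega>} < e / 2) sequentially"
    using v e unfolding vanishes_in_prob_def by (intro order_tendstoD(2)[of _ 0]) auto
  then show "eventually (\<lambda>m. (\<integral>\<^sup>+\<omega>. min 1 (X m \<omega>) \<partial>M) \<le> ennreal e) sequentially"
  proof eventually_elim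
    case (elim m)
    have "(\<integral>\<^sup>+\<omega>. min 1 (X m \<omega>) \<partial>M) \<le>
      (\<integral>\<^sup>+\<omega>. ennreal (e / 2) + indicator {\<omega>\<in>space M. ennreal (e / 2) < X m \<omega>} \<omega> \<partial>M)"
    proof (rule nn_integral_mono)
      fix \<omega> assume "\<omega> \<in> space M"
      then show "min 1 (X m \<omega>) \<le> ennreal (e / 2) + indicator {\<omega>\<in>space M. ennreal (e / 2) < X m \<omega>} \<omega>"
        by (cases "ennreal (e / 2) < X m \<omega>") (auto simp: min_le_iff_disj intro: add_increasing)
    qed
    also have "\<dots> = ennreal (e / 2) + emeasure M {\<omega>\<in>space M. ennreal (e / 2) < X m \<omega>}"
      by (simp add: nn_integral_add emeasure_space_1)
    also have "\<dots> \<le> ennreal (e / 2) + ennreal (e / 2)"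
      using elim by (intro add_left_mono) (simp add: emeasure_eq_measure ennreal_leI)
    also have "\<dots> = ennreal e" using e by (simp flip: ennreal_plus)
    finally show ?case .
  qed
qed

context brownian
begin

text \<open>\<open>X\<close> is a stochastic integral of a step process that starts at time \<open>u\<close> or later, and \<open>q\<close> is its quadratic
variation \<open>\<integral>H\<^sup>2\<close>. The grid and the coefficients are hidden, since the limit arguments only use the
exponential identities satisfied by the pair.\<close>

definition adapted_sum :: "real \<Rightarrow> ('a \<Rightarrow> real) \<Rightarrow> ('a \<Rightarrow> real) \<Rightarrow> bool" where
  "adapted_sum u X q \<longleftrightarrow> (\<exists>n \<sigma> \<xi>. u \<le> \<sigma> 0 \<and> (\<forall>k<n. \<sigma> k \<le> \<sigma> (Suc k)) \<and>
     (\<forall>k<n. \<xi> k \<in> borel_measurable (F (\<sigma> k))) \<and>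
     X = (\<lambda>\<omega>. \<Sum>k<n. \<xi> k \<omega> * (B (\<sigma> (Suc k)) \<omega> - B (\<sigma> k) \<omega>)) \<and>
     q = (\<lambda>\<omega>. \<Sum>k<n. (\<xi> k \<omega>)\<^sup>2 * (\<sigma> (Suc k) - \<sigma> k)))"

lemma adapted_sum_scale:
  assumes "adapted_sum u X q"
  shows "adapted_sum u (\<lambda>\<omega>. c * X \<omega>) (\<lambda>\<omega>. c\<^sup>2 * q \<omega>)"
proof -
  obtain n \<sigma> \<xi> where *: "u \<le> \<sigma> 0" "\<forall>k<n. \<sigma> k \<le> \<sigma> (Suc k)"
     "\<forall>k<n. \<xi> k \<in> borel_measurable (F (\<sigma> k))"
     "X = (\<lambda>\<omega>. \<Sum>k<n. \<xi> k \<omega> * (B (\<sigma> (Suc k)) \<omega> - B (\<sigma> k) \<omega>))"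
     "q = (\<lambda>\<omega>. \<Sum>k<n. (\<xi> k \<omega>)\<^sup>2 * (\<sigma> (Suc k) - \<sigma> k))"
    using assms unfolding adapted_sum_def by blast
  show ?thesis unfolding adapted_sum_def
    by (rule exI[of _ n], rule exI[of _ \<sigma>], rule exI[of _ "\<lambda>k \<omega>. c * \<xi> k \<omega>"])
       (use * in \<open>auto simp: sum_distrib_left power_mult_distrib mult.assoc\<close>)
qed

lemma adapted_sum_measurable:
  assumes "adapted_sum u X q" "0 \<le> u"
  shows "X \<in> borel_measurable M" "q \<in> borel_measurable M" "0 \<le> q \<omega>"
proof -
  obtain n \<sigma> \<xi> where *: "u \<le> \<sigma> 0" "\<forall>k<n. \<sigma> k \<le> \<sigma> (Suc k)"
     "\<forall>k<n. \<xi> k \<in> borel_measurable (F (\<sigma> k))"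
     and X: "X = (\<lambda>\<omega>. \<Sum>k<n. \<xi> k \<omega> * (B (\<sigma> (Suc k)) \<omega> - B (\<sigma> k) \<omega>))"
     and q: "q = (\<lambda>\<omega>. \<Sum>k<n. (\<xi> k \<omega>)\<^sup>2 * (\<sigma> (Suc k) - \<sigma> k))"
    using assms unfolding adapted_sum_def by blast
  have le: "\<sigma> i \<le> \<sigma> j" if "i \<le> j" "j \<le> n" for i j
    by (rule chain_le[OF _ that]) (use * in auto)
  have \<sigma>0: "0 \<le> \<sigma> k" if "k \<le> n" for k
    using le[of 0 k] that * assms by simp
  have xi_M: "\<xi> k \<in> borel_measurable M" if "k < n" for k
    using that * by (intro measurable_F_M[of _ "\<sigma> k"] \<sigma>0) auto
  have B_M: "B (\<sigma> k) \<in> borel_measurable M" if "k \<le> n" for k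
    using that by (intro measurable_F_M[OF B_adapted] \<sigma>0) (auto intro: \<sigma>0)
  show "X \<in> borel_measurable M" "q \<in> borel_measurable M" unfolding X q
    by (auto intro!: borel_measurable_sum borel_measurable_times borel_measurable_power borel_measurable_diff B_M xi_M)
  show "0 \<le> q \<omega>" unfolding q using * by (auto intro!: sum_nonneg)
qed

lemma adapted_sum_exp:
  assumes "adapted_sum u X q" "0 \<le> u" and Y: "Y \<in> borel_measurable (F u)"
  shows "(\<integral>\<^sup>+\<omega>. Y \<omega> * ennreal (exp (X \<omega> - q \<omega> / 2)) \<partial>M) = (\<integral>\<^sup>+\<omega>. Y \<omega> \<partial>M)"
proof -
  obtain n \<sigma> \<xi> where *: "u \<le> \<sigma> 0" "\<forall>k<n. \<sigma> k \<le> \<sigma> (Suc k)"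
     "\<forall>k<n. \<xi> k \<in> borel_measurable (F (\<sigma> k))"
     and X: "X = (\<lambda>\<omega>. \<Sum>k<n. \<xi> k \<omega> * (B (\<sigma> (Suc k)) \<omega> - B (\<sigma> k) \<omega>))"
     and q: "q = (\<lambda>\<omega>. \<Sum>k<n. (\<xi> k \<omega>)\<^sup>2 * (\<sigma> (Suc k) - \<sigma> k))"
    using assms unfolding adapted_sum_def by blast
  show ?thesis unfolding X q
    by (rule exponential_sum) (use * assms measurable_F_mono[OF Y *(1)] in auto)
qed

lemma adapted_sum_exp_truncated:
  assumes "adapted_sum u X q" "0 \<le> u" and Y: "Y \<in> borel_measurable (F u)"
    and Y01: "\<And>\<omega>. 0 \<le> Y \<omega>" "\<And>\<omega>. Y \<omega> \<le> (1::real)" and L: "0 < L"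
  shows "(\<integral>\<^sup>+\<omega>. Y \<omega> \<partial>M) \<le> (\<integral>\<^sup>+\<omega>. ennreal (min (Y \<omega> * exp (X \<omega> - q \<omega> / 2)) L) \<partial>M)
     + ennreal L * emeasure M {\<omega>\<in>space M. 1 < q \<omega>} + ennreal (exp 1 / L)"
proof -
  obtain n \<sigma> \<xi> where *: "u \<le> \<sigma> 0" "\<forall>k<n. \<sigma> k \<le> \<sigma> (Suc k)"
     "\<forall>k<n. \<xi> k \<in> borel_measurable (F (\<sigma> k))"
     and X: "X = (\<lambda>\<omega>. \<Sum>k<n. \<xi> k \<omega> * (B (\<sigma> (Suc k)) \<omega> - B (\<sigma> k) \<omega>))"
     and q: "q = (\<lambda>\<omega>. \<Sum>k<n. (\<xi> k \<omega>)\<^sup>2 * (\<sigma> (Suc k) - \<sigma> k))"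
    using assms unfolding adapted_sum_def by blast
  show ?thesis
    by (rule exponential_sum_truncated[of \<sigma> n \<xi>])
      (use * assms(2) Y01 L X q measurable_F_mono[OF Y *(1)] in auto)
qed

text \<open>The inequality behind the uniqueness of the Ito integral: a small quadratic variation forces a small
integral. Instead of an isometry it uses the exponential identity for \<open>a X\<close> and \<open>-a X\<close>: where
\<open>\<bar>X\<bar> > \<epsilon>\<close> and \<open>q < \<kappa>\<close>, one of the two exponentials exceeds \<open>exp(a \<epsilon> - a\<^sup>2 \<kappa> / 2)\<close>.\<close>

lemma adapted_sum_tendsto_0:
  assumes as: "\<And>m. adapted_sum u (X m) (q m)" and u: "0 \<le> u"
    and lim: "AE \<omega> in M. (\<lambda>m. q m \<omega>) \<longlonglongrightarrow> 0"
  shows "(\<lambda>m. \<integral>\<^sup>+\<omega>. min 1 (ennreal \<bar>X m \<omega>\<bar>) \<partial>M) \<longlonglongrightarrow> 0"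
proof (rule ennreal_tendsto_0I)
  fix e :: real assume "0 < e"
  \<comment> \<open>The slope \<open>a\<close> and the level \<open>\<kappa>\<close> are such that \<open>a \<epsilon> - a\<^sup>2 \<kappa> / 2 = p\<close>, and \<open>p\<close> is so large that \<open>2 exp(-p) \<le> \<epsilon>\<close>.\<close>
  define \<epsilon> p a \<kappa> where "\<epsilon> = e / 3" and "p = 2 / \<epsilon>" and "a = 2 * p / \<epsilon>" and "\<kappa> = \<epsilon>\<^sup>2 / (2 * p)"
  have pos: "0 < \<epsilon>" "0 < p" "0 < a" "0 < \<kappa>" using \<open>0 < e\<close> by (auto simp: \<epsilon>_def p_def a_def \<kappa>_def)
  have ap: "- a * \<epsilon> + a\<^sup>2 * \<kappa> / 2 = - p"
    using pos by (simp add: a_def \<kappa>_def power2_eq_square field_simps)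
  have "p \<le> exp p" using exp_ge_add_one_self[of p] by linarith
  then have ep: "2 * exp (- p) \<le> \<epsilon>"
    using pos by (simp add: p_def exp_minus field_simps)
  note [measurable] = adapted_sum_measurable(1,2)[OF as u]
  have q0: "0 \<le> q m \<omega>" for m \<omega> using adapted_sum_measurable(3)[OF as u] .
  have "(\<lambda>m. \<integral>\<omega>. min 1 (q m \<omega> / \<kappa>) \<partial>M) \<longlonglongrightarrow> (\<integral>\<omega>. 0 \<partial>M)"
  proof (rule integral_dominated_convergence[where w = "\<lambda>_. 1"])
    show "AE \<omega> in M. (\<lambda>m. min 1 (q m \<omega> / \<kappa>)) \<longlonglongrightarrow> 0"
      using lim
    proof eventually_elim
      case (elim \<omega>)
      have "(\<lambda>m. min 1 (q m \<omega> / \<kappa>)) \<longlonglongrightarrow> min 1 (0 / \<kappa>)"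
        using pos by (intro tendsto_intros elim) auto
      then show ?case by simp
    qed
    show "AE \<omega> in M. norm (min 1 (q m \<omega> / \<kappa>)) \<le> 1" for m
      using q0 pos by (intro AE_I2) (auto simp: min_def)
  qed auto
  then have "eventually (\<lambda>m. (\<integral>\<omega>. min 1 (q m \<omega> / \<kappa>) \<partial>M) < \<epsilon>) sequentially"
    using pos by (intro order_tendstoD(2)[of _ 0]) auto
  then show "eventually (\<lambda>m. (\<integral>\<^sup>+\<omega>. min 1 (ennreal \<bar>X m \<omega>\<bar>) \<partial>M) \<le> ennreal e) sequentially"
  proof eventually_elim
    case (elim m)
    define Z where "Z = (\<lambda>c \<omega>. exp (c * X m \<omega> - c\<^sup>2 * q m \<omega> / 2))"
    have [measurable]: "Z c \<in> borel_measurable M" for c unfolding Z_def by measurable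
    have Z1: "(\<integral>\<^sup>+\<omega>. ennreal (Z c \<omega>) \<partial>M) = 1" for c
      using adapted_sum_exp[OF adapted_sum_scale[OF as] u, of "\<lambda>_. 1" c m]
      by (simp add: Z_def emeasure_space_1)
    have pw: "min 1 \<bar>X m \<omega>\<bar> \<le> \<epsilon> + min 1 (q m \<omega> / \<kappa>) + exp (- p) * Z a \<omega> + exp (- p) * Z (- a) \<omega>" for \<omega>
    proof -
      have nn: "0 \<le> min 1 (q m \<omega> / \<kappa>)" "0 \<le> exp (- p) * Z a \<omega>" "0 \<le> exp (- p) * Z (- a) \<omega>"
        using q0 pos by (auto simp: Z_def)
      consider "\<bar>X m \<omega>\<bar> \<le> \<epsilon>" | "\<kappa> \<le> q m \<omega>" | "\<epsilon> < \<bar>X m \<omega>\<bar>" "q m \<omega> < \<kappa>" by linarith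
      then show ?thesis
      proof cases
        case 2
        then have "min 1 (q m \<omega> / \<kappa>) = 1" using pos by (simp add: min_def)
        then show ?thesis using nn pos by linarith
      next
        case 3
        have "a\<^sup>2 * q m \<omega> / 2 \<le> a\<^sup>2 * \<kappa> / 2" using 3 by (intro divide_right_mono mult_left_mono) auto
        moreover have "a * \<epsilon> \<le> a * \<bar>X m \<omega>\<bar>" using 3 pos by simp
        ultimately have "p \<le> a * \<bar>X m \<omega>\<bar> - a\<^sup>2 * q m \<omega> / 2" using ap by linarith
        then have "1 \<le> exp (- p) * exp (a * \<bar>X m \<omega>\<bar> - a\<^sup>2 * q m \<omega> / 2)"
          by (simp add: mult_exp_exp)
        moreover have "exp (a * \<bar>X m \<omega>\<bar> - a\<^sup>2 * q m \<omega> / 2) \<in> {Z a \<omega>, Z (- a) \<omega>}"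
          by (cases "0 \<le> X m \<omega>") (auto simp: Z_def)
        ultimately have "1 \<le> exp (- p) * Z a \<omega> + exp (- p) * Z (- a) \<omega>" using nn by auto
        then show ?thesis using nn pos by linarith
      qed (use nn in linarith)
    qed
    have int: "integrable M (\<lambda>\<omega>. min 1 (q m \<omega> / \<kappa>))"
      using q0 pos by (intro integrable_const_bound[where B = 1]) (auto simp: min_def)
    have "(\<integral>\<^sup>+\<omega>. min 1 (ennreal \<bar>X m \<omega>\<bar>) \<partial>M) = (\<integral>\<^sup>+\<omega>. ennreal (min 1 \<bar>X m \<omega>\<bar>) \<partial>M)"
      by (simp add: min_ennreal[symmetric])
    also have "\<dots> \<le> (\<integral>\<^sup>+\<omega>. ennreal (\<epsilon> + min 1 (q m \<omega> / \<kappa>) + exp (- p) * Z a \<omega> + exp (- p) * Z (- a) \<omega>) \<partial>M)"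
      by (intro nn_integral_mono ennreal_leI pw)
    also have "\<dots> = (\<integral>\<^sup>+\<omega>. ennreal \<epsilon> + ennreal (min 1 (q m \<omega> / \<kappa>)) + ennreal (exp (- p)) * ennreal (Z a \<omega>)
          + ennreal (exp (- p)) * ennreal (Z (- a) \<omega>) \<partial>M)"
      using pos q0 by (intro nn_integral_cong) (simp add: ennreal_mult Z_def ennreal_plus)
    also have "\<dots> = ennreal \<epsilon> + ennreal (\<integral>\<omega>. min 1 (q m \<omega> / \<kappa>) \<partial>M) + ennreal (exp (- p)) + ennreal (exp (- p))"
      using q0 pos by (simp add: nn_integral_add nn_integral_cmult Z1 emeasure_space_1 nn_integral_eq_integral[OF int])
    also have "\<dots> = ennreal (\<epsilon> + (\<integral>\<omega>. min 1 (q m \<omega> / \<kappa>) \<partial>M) + exp (- p) + exp (- p))"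
    proof -
      have "ennreal (exp (- p)) + ennreal (exp (- p)) = ennreal (2 * exp (- p))"
        by (simp flip: ennreal_plus)
      then show ?thesis using q0 pos by (simp add: ennreal_plus integral_nonneg_AE)
    qed
    also have "\<dots> \<le> ennreal e" using elim ep by (intro ennreal_leI) (simp add: \<epsilon>_def)
    finally show ?case .
  qed
qed

end

section \<open>Restricting simple integrals to a window\<close>

text \<open>A common refinement of several partitions is obtained by sorting the finite set of all their nodes.
The last property says that no node lies strictly between consecutive grid points; it is the only
trace of the original partitions that is used.\<close>

lemma sorted_nodes:
  fixes P :: "real set"
  assumes "finite P" "u \<in> P" "v \<in> P" "P \<subseteq> {u..v}"
  obtains n \<sigma> where "\<sigma> 0 = u" "\<sigma> n = v" "\<And>k. k < n \<Longrightarrow> \<sigma> k < \<sigma> (Suc k)"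
    "\<And>k x. k < n \<Longrightarrow> x \<in> P \<Longrightarrow> x \<le> \<sigma> k \<or> \<sigma> (Suc k) \<le> x"
proof -
  define l where "l = sorted_list_of_set P"
  have l: "set l = P" "sorted l" "distinct l" "l \<noteq> []"
    using assms by (auto simp: l_def)
  define n where "n = length l - 1"
  have len: "length l = Suc n" using l by (cases l) (auto simp: n_def)
  have strict: "l ! i < l ! j" if "i < j" "j \<le> n" for i j
  proof -
    have "l ! i \<le> l ! j" using l that len by (intro sorted_nth_mono) auto
    moreover have "l ! i \<noteq> l ! j" using l that len by (simp add: nth_eq_iff_index_eq)
    ultimately show ?thesis by simp
  qed
  have mono: "l ! i \<le> l ! j" if "i \<le> j" "j \<le> n" for i j
    using l that len by (intro sorted_nth_mono) auto
  have idx: "\<exists>i\<le>n. x = l ! i" if "x \<in> P" for x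
    using that l len by (metis in_set_conv_nth less_Suc_eq_le)
  show ?thesis
  proof
    obtain i where i: "i \<le> n" "u = l ! i" using idx[OF assms(2)] by auto
    have "l ! 0 \<in> P" using l len by (metis nth_mem zero_less_Suc)
    then show "l ! 0 = u" using i mono[of 0 i] assms by force
    obtain j where j: "j \<le> n" "v = l ! j" using idx[OF assms(3)] by auto
    have "l ! n \<in> P" using l len by (metis nth_mem lessI)
    then show "l ! n = v" using j mono[of j n] assms by force
    show "l ! k < l ! Suc k" if "k < n" for k using that by (intro strict) auto
    show "x \<le> l ! k \<or> l ! Suc k \<le> x" if k: "k < n" and x: "x \<in> P" for k x
    proof -
      obtain i where i: "i \<le> n" "x = l ! i" using idx[OF x] by auto
      show ?thesis
        using i k mono[of i k] mono[of "Suc k" i] by (cases "i \<le> k") auto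
    qed
  qed
qed

text \<open>Clamping the grid to \<open>[a,b]\<close> leaves the cells inside \<open>(a,b]\<close> unchanged and collapses the others, so the sum
telescopes.\<close>

lemma indicator_telescope:
  fixes g :: "real \<Rightarrow> real"
  assumes \<sigma>: "\<sigma> 0 = u" "\<sigma> n = v" "\<And>k. k < n \<Longrightarrow> \<sigma> k < \<sigma> (Suc k)"
    and gap: "\<And>k x. k < n \<Longrightarrow> x \<in> {a, b} \<Longrightarrow> x \<le> \<sigma> k \<or> \<sigma> (Suc k) \<le> x"
    and ab: "u \<le> a" "a \<le> b" "b \<le> v"
  shows "(\<Sum>k<n. indicator {a<..b} (\<sigma> (Suc k)) * (g (\<sigma> (Suc k)) - g (\<sigma> k))) = g b - g a"
proof -
  define c where "c = (\<lambda>x. max a (min b x))"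
  have "indicator {a<..b} (\<sigma> (Suc k)) * (g (\<sigma> (Suc k)) - g (\<sigma> k)) = g (c (\<sigma> (Suc k))) - g (c (\<sigma> k))"
    if "k < n" for k
    using gap[OF that, of a] gap[OF that, of b] \<sigma>(3)[OF that] ab
    by (auto simp: c_def indicator_def max_def min_def)
  then have "(\<Sum>k<n. indicator {a<..b} (\<sigma> (Suc k)) * (g (\<sigma> (Suc k)) - g (\<sigma> k)))
    = (\<Sum>k<n. g (c (\<sigma> (Suc k))) - g (c (\<sigma> k)))" by (intro sum.cong) auto
  also have "\<dots> = g (c (\<sigma> n)) - g (c (\<sigma> 0))"
    by (rule sum_lessThan_telescope)
  also have "c (\<sigma> n) = b" unfolding c_def using \<sigma>(2) ab by linarith
  also have "c (\<sigma> 0) = a" unfolding c_def using \<sigma>(1) ab by linarith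
  finally show ?thesis .
qed

lemma nn_integral_step_function:
  fixes H :: "real \<Rightarrow> real"
  assumes \<sigma>: "\<And>k. k < n \<Longrightarrow> \<sigma> k \<le> \<sigma> (Suc k)"
    and [measurable]: "H \<in> borel_measurable borel"
    and const: "\<And>k s. k < n \<Longrightarrow> \<sigma> k < s \<Longrightarrow> s \<le> \<sigma> (Suc k) \<Longrightarrow> H s = H (\<sigma> (Suc k))"
  shows "(\<integral>\<^sup>+s\<in>{\<sigma> 0<..\<sigma> n}. ennreal ((H s)\<^sup>2) \<partial>lborel) = ennreal (\<Sum>k<n. (H (\<sigma> (Suc k)))\<^sup>2 * (\<sigma> (Suc k) - \<sigma> k))"
  using \<sigma> const
proof (induction n)
  case (Suc n)
  have le: "\<sigma> 0 \<le> \<sigma> n" by (rule chain_le[of n]) (use Suc.prems in auto)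
  have leS: "\<sigma> n \<le> \<sigma> (Suc n)" using Suc.prems by auto
  have "(\<integral>\<^sup>+s\<in>{\<sigma> 0<..\<sigma> (Suc n)}. ennreal ((H s)\<^sup>2) \<partial>lborel)
    = (\<integral>\<^sup>+s. ennreal ((H s)\<^sup>2) * indicator {\<sigma> 0<..\<sigma> n} s + ennreal ((H s)\<^sup>2) * indicator {\<sigma> n<..\<sigma> (Suc n)} s \<partial>lborel)"
    using le leS by (intro nn_integral_cong) (auto simp: indicator_def)
  also have "\<dots> = (\<integral>\<^sup>+s\<in>{\<sigma> 0<..\<sigma> n}. ennreal ((H s)\<^sup>2) \<partial>lborel) + (\<integral>\<^sup>+s\<in>{\<sigma> n<..\<sigma> (Suc n)}. ennreal ((H s)\<^sup>2) \<partial>lborel)"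
    by (rule nn_integral_add) auto
  also have "(\<integral>\<^sup>+s\<in>{\<sigma> n<..\<sigma> (Suc n)}. ennreal ((H s)\<^sup>2) \<partial>lborel)
    = (\<integral>\<^sup>+s\<in>{\<sigma> n<..\<sigma> (Suc n)}. ennreal ((H (\<sigma> (Suc n)))\<^sup>2) \<partial>lborel)"
  proof (intro nn_integral_cong)
    fix s
    show "ennreal ((H s)\<^sup>2) * indicator {\<sigma> n<..\<sigma> (Suc n)} s = ennreal ((H (\<sigma> (Suc n)))\<^sup>2) * indicator {\<sigma> n<..\<sigma> (Suc n)} s"
      using Suc.prems(2)[of n s] by (auto simp: indicator_def)
  qed
  also have "\<dots> = ennreal ((H (\<sigma> (Suc n)))\<^sup>2 * (\<sigma> (Suc n) - \<sigma> n))"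
    using leS by (simp add: nn_integral_cmult_indicator ennreal_mult)
  also have "(\<integral>\<^sup>+s\<in>{\<sigma> 0<..\<sigma> n}. ennreal ((H s)\<^sup>2) \<partial>lborel) = ennreal (\<Sum>k<n. (H (\<sigma> (Suc k)))\<^sup>2 * (\<sigma> (Suc k) - \<sigma> k))"
    using Suc by auto
  also have "ennreal (\<Sum>k<n. (H (\<sigma> (Suc k)))\<^sup>2 * (\<sigma> (Suc k) - \<sigma> k)) + ennreal ((H (\<sigma> (Suc n)))\<^sup>2 * (\<sigma> (Suc n) - \<sigma> n))
    = ennreal (\<Sum>k<Suc n. (H (\<sigma> (Suc k)))\<^sup>2 * (\<sigma> (Suc k) - \<sigma> k))"
    using Suc.prems(1) by (subst ennreal_plus[symmetric]) (auto intro!: sum_nonneg)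
  finally show ?case .
qed simp

definition clamp :: "real \<Rightarrow> real \<Rightarrow> real \<Rightarrow> real" where
  "clamp u v x = max u (min v x)"

text \<open>On a grid that contains the nodes of a simple process, clamped to \<open>[u,v]\<close>, the process is constant on
cells with the value at their right end point, and its integral over \<open>(u,v]\<close> is the sum over the grid.
The third claim gives adaptedness: a step that is active on a cell began no later than the cell.\<close>

lemma simple_process_window_sum:
  assumes \<sigma>: "\<sigma> 0 = u" "\<sigma> N = v" "\<And>j. j < N \<Longrightarrow> \<sigma> j < \<sigma> (Suc j)"
    and gap: "\<And>j k. j < N \<Longrightarrow> k \<le> n \<Longrightarrow> clamp u v (\<tau> k) \<le> \<sigma> j \<or> \<sigma> (Suc j) \<le> clamp u v (\<tau> k)"
    and uv: "u \<le> v" and \<tau>: "\<And>k. k < n \<Longrightarrow> \<tau> k \<le> \<tau> (Suc k)"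
  shows "(\<Sum>j<N. simple_process n \<tau> \<xi> (\<sigma> (Suc j)) \<omega> * (B (\<sigma> (Suc j)) \<omega> - B (\<sigma> j) \<omega>))
    = simple_integral B n \<tau> \<xi> v \<omega> - simple_integral B n \<tau> \<xi> u \<omega>"
    and "\<And>j s. j < N \<Longrightarrow> \<sigma> j < s \<Longrightarrow> s \<le> \<sigma> (Suc j) \<Longrightarrow> simple_process n \<tau> \<xi> s \<omega> = simple_process n \<tau> \<xi> (\<sigma> (Suc j)) \<omega>"
    and "\<And>j k. j < N \<Longrightarrow> k < n \<Longrightarrow> \<sigma> (Suc j) \<in> {\<tau> k<..\<tau> (Suc k)} \<Longrightarrow> \<tau> k \<le> \<sigma> j"
proof -
  have bounds: "u \<le> \<sigma> j" "\<sigma> (Suc j) \<le> v" if "j < N" for j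
    using chain_le[of N \<sigma> 0 j] chain_le[of N \<sigma> "Suc j" N] \<sigma> that by (auto intro: less_imp_le)
  have ind: "indicator {\<tau> k<..\<tau> (Suc k)} s = (indicator {clamp u v (\<tau> k)<..clamp u v (\<tau> (Suc k))} s :: real)"
    if "u < s" "s \<le> v" for k s
    using that by (auto simp: clamp_def indicator_def max_def min_def)
  have "(\<Sum>j<N. simple_process n \<tau> \<xi> (\<sigma> (Suc j)) \<omega> * (B (\<sigma> (Suc j)) \<omega> - B (\<sigma> j) \<omega>))
    = (\<Sum>j<N. \<Sum>k<n. \<xi> k \<omega> * (indicator {\<tau> k<..\<tau> (Suc k)} (\<sigma> (Suc j)) * (B (\<sigma> (Suc j)) \<omega> - B (\<sigma> j) \<omega>)))"
    unfolding simple_process_def sum_distrib_right by (simp only: mult.assoc)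
  also have "\<dots> = (\<Sum>k<n. \<Sum>j<N. \<xi> k \<omega> * (indicator {\<tau> k<..\<tau> (Suc k)} (\<sigma> (Suc j)) * (B (\<sigma> (Suc j)) \<omega> - B (\<sigma> j) \<omega>)))"
    by (rule sum.swap)
  also have "\<dots> = (\<Sum>k<n. \<xi> k \<omega> * (\<Sum>j<N. indicator {clamp u v (\<tau> k)<..clamp u v (\<tau> (Suc k))} (\<sigma> (Suc j)) * (B (\<sigma> (Suc j)) \<omega> - B (\<sigma> j) \<omega>)))"
    unfolding sum_distrib_left
  proof (intro sum.cong refl)
    fix j k assume "j \<in> {..<N}"
    then have "u < \<sigma> (Suc j)" "\<sigma> (Suc j) \<le> v" using bounds[of j] \<sigma>(3)[of j] by auto
    from ind[OF this, of k] show "\<xi> k \<omega> * (indicator {\<tau> k<..\<tau> (Suc k)} (\<sigma> (Suc j)) * (B (\<sigma> (Suc j)) \<omega> - B (\<sigma> j) \<omega>))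
      = \<xi> k \<omega> * (indicator {clamp u v (\<tau> k)<..clamp u v (\<tau> (Suc k))} (\<sigma> (Suc j)) * (B (\<sigma> (Suc j)) \<omega> - B (\<sigma> j) \<omega>))"
      by simp
  qed
  also have "\<dots> = (\<Sum>k<n. \<xi> k \<omega> * (B (clamp u v (\<tau> (Suc k))) \<omega> - B (clamp u v (\<tau> k)) \<omega>))"
  proof (intro sum.cong refl arg_cong2[where f="(*)"])
    fix k assume k: "k \<in> {..<n}"
    show "(\<Sum>j<N. indicator {clamp u v (\<tau> k)<..clamp u v (\<tau> (Suc k))} (\<sigma> (Suc j)) * (B (\<sigma> (Suc j)) \<omega> - B (\<sigma> j) \<omega>))
      = B (clamp u v (\<tau> (Suc k))) \<omega> - B (clamp u v (\<tau> k)) \<omega>"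
    proof (rule indicator_telescope[where u = u and v = v, OF \<sigma>])
      show "x \<le> \<sigma> j \<or> \<sigma> (Suc j) \<le> x" if "j < N" "x \<in> {clamp u v (\<tau> k), clamp u v (\<tau> (Suc k))}" for j x
        using gap[of j k] gap[of j "Suc k"] that k by auto
      show "clamp u v (\<tau> k) \<le> clamp u v (\<tau> (Suc k))"
        using \<tau>[of k] k by (auto simp: clamp_def max_def min_def)
    qed (use uv in \<open>auto simp: clamp_def\<close>)
  qed
  also have "\<dots> = (\<Sum>k<n. \<xi> k \<omega> * (B (min v (\<tau> (Suc k))) \<omega> - B (min v (\<tau> k)) \<omega>)
      - \<xi> k \<omega> * (B (min u (\<tau> (Suc k))) \<omega> - B (min u (\<tau> k)) \<omega>))"
  proof (rule sum.cong[OF refl])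
    fix k
    have c: "B (clamp u v x) \<omega> = B (min v x) \<omega> - B (min u x) \<omega> + B u \<omega>" for x
      using uv by (auto simp: clamp_def max_def min_def)
    then show "\<xi> k \<omega> * (B (clamp u v (\<tau> (Suc k))) \<omega> - B (clamp u v (\<tau> k)) \<omega>)
      = \<xi> k \<omega> * (B (min v (\<tau> (Suc k))) \<omega> - B (min v (\<tau> k)) \<omega>)
      - \<xi> k \<omega> * (B (min u (\<tau> (Suc k))) \<omega> - B (min u (\<tau> k)) \<omega>)"
      by (simp only: c) (simp add: algebra_simps)
  qed
  also have "\<dots> = simple_integral B n \<tau> \<xi> v \<omega> - simple_integral B n \<tau> \<xi> u \<omega>"
    by (simp add: simple_integral_def sum_subtractf)
  finally show "(\<Sum>j<N. simple_process n \<tau> \<xi> (\<sigma> (Suc j)) \<omega> * (B (\<sigma> (Suc j)) \<omega> - B (\<sigma> j) \<omega>))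
    = simple_integral B n \<tau> \<xi> v \<omega> - simple_integral B n \<tau> \<xi> u \<omega>" .
  show "simple_process n \<tau> \<xi> s \<omega> = simple_process n \<tau> \<xi> (\<sigma> (Suc j)) \<omega>"
    if j: "j < N" and s: "\<sigma> j < s" "s \<le> \<sigma> (Suc j)" for j s
    unfolding simple_process_def
  proof (intro sum.cong refl arg_cong2[where f="(*)"])
    fix k assume k: "k \<in> {..<n}"
    have b: "u < s" "s \<le> v" "u < \<sigma> (Suc j)" "\<sigma> (Suc j) \<le> v" using bounds[OF j] \<sigma>(3)[OF j] s by auto
    show "indicator {\<tau> k<..\<tau> (Suc k)} s = (indicator {\<tau> k<..\<tau> (Suc k)} (\<sigma> (Suc j)) :: real)"
      unfolding ind[OF b(1,2)] ind[OF b(3,4)]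
      using gap[OF j, of k] gap[OF j, of "Suc k"] s k by (auto simp: indicator_def)
  qed
  show "\<tau> k \<le> \<sigma> j" if "j < N" "k < n" "\<sigma> (Suc j) \<in> {\<tau> k<..\<tau> (Suc k)}" for j k
    using gap[of j k] that bounds[of j] by (auto simp: clamp_def max_def min_def split: if_splits)
qed

lemma simple_process_measurable [measurable]:
  "(\<lambda>s. simple_process n \<tau> \<xi> s \<omega>) \<in> borel_measurable borel"
  unfolding simple_process_def by measurable

context brownian
begin

lemma simple_process_adapted:
  assumes si: "simple_integrand M F n \<tau> \<xi>" and "\<And>k. k < n \<Longrightarrow> y \<in> {\<tau> k<..\<tau> (Suc k)} \<Longrightarrow> \<tau> k \<le> x"
  shows "simple_process n \<tau> \<xi> y \<in> borel_measurable (F x)"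
proof -
  have "(\<lambda>\<omega>. \<xi> k \<omega> * indicator {\<tau> k<..\<tau> (Suc k)} y) \<in> borel_measurable (F x)" if k: "k < n" for k
  proof (cases "y \<in> {\<tau> k<..\<tau> (Suc k)}")
    case True
    then have "\<xi> k \<in> borel_measurable (F x)"
      using si k assms(2)[OF k] measurable_F_mono[of "\<xi> k" "\<tau> k" borel x]
      by (auto simp: simple_integrand_def)
    then show ?thesis by measurable
  next
    case False
    then have "(\<lambda>\<omega>. \<xi> k \<omega> * indicator {\<tau> k<..\<tau> (Suc k)} y) = (\<lambda>\<omega>. 0)" by (auto simp: indicator_def)
    then show ?thesis by simp
  qed
  then show ?thesis
    unfolding simple_process_def[abs_def] by (intro borel_measurable_sum) auto
qed

text \<open>The scalar \<open>c\<close> allows two uses: \<open>c = 0\<close> restricts one simple integral to the window, and \<open>c = 1\<close> compares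
two simple integrals with different partitions.\<close>

lemma simple_integral_window:
  assumes si1: "simple_integrand M F n1 \<tau>1 \<xi>1" and si2: "simple_integrand M F n2 \<tau>2 \<xi>2"
    and uv: "0 \<le> u" "u \<le> v"
  obtains q where
    "adapted_sum u (\<lambda>\<omega>. (simple_integral B n1 \<tau>1 \<xi>1 v \<omega> - simple_integral B n1 \<tau>1 \<xi>1 u \<omega>)
        - c * (simple_integral B n2 \<tau>2 \<xi>2 v \<omega> - simple_integral B n2 \<tau>2 \<xi>2 u \<omega>)) q"
    "\<And>\<omega>. ennreal (q \<omega>) = (\<integral>\<^sup>+s\<in>{u..v}. ennreal ((simple_process n1 \<tau>1 \<xi>1 s \<omega> - c * simple_process n2 \<tau>2 \<xi>2 s \<omega>)\<^sup>2) \<partial>lborel)"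
proof -
  define P where "P = {u, v} \<union> clamp u v ` \<tau>1 ` {..n1} \<union> clamp u v ` \<tau>2 ` {..n2}"
  have "finite P" "u \<in> P" "v \<in> P" "P \<subseteq> {u..v}"
    using uv by (auto simp: P_def clamp_def)
  then obtain N \<sigma> where \<sigma>: "\<sigma> 0 = u" "\<sigma> N = v" "\<And>k. k < N \<Longrightarrow> \<sigma> k < \<sigma> (Suc k)"
    and gap: "\<And>k x. k < N \<Longrightarrow> x \<in> P \<Longrightarrow> x \<le> \<sigma> k \<or> \<sigma> (Suc k) \<le> x"
    using sorted_nodes by metis
  have gap1: "clamp u v (\<tau>1 k) \<le> \<sigma> j \<or> \<sigma> (Suc j) \<le> clamp u v (\<tau>1 k)" if "j < N" "k \<le> n1" for j k
    using that by (intro gap) (auto simp: P_def)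
  have gap2: "clamp u v (\<tau>2 k) \<le> \<sigma> j \<or> \<sigma> (Suc j) \<le> clamp u v (\<tau>2 k)" if "j < N" "k \<le> n2" for j k
    using that by (intro gap) (auto simp: P_def)
  have \<tau>1: "\<And>k. k < n1 \<Longrightarrow> \<tau>1 k \<le> \<tau>1 (Suc k)" and \<tau>2: "\<And>k. k < n2 \<Longrightarrow> \<tau>2 k \<le> \<tau>2 (Suc k)"
    using si1 si2 by (auto simp: simple_integrand_def)
  have w11: "(\<Sum>j<N. simple_process n1 \<tau>1 \<xi>1 (\<sigma> (Suc j)) \<omega> * (B (\<sigma> (Suc j)) \<omega> - B (\<sigma> j) \<omega>))
    = simple_integral B n1 \<tau>1 \<xi>1 v \<omega> - simple_integral B n1 \<tau>1 \<xi>1 u \<omega>" for \<omega>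
    by (rule simple_process_window_sum(1)[where u = u and v = v and \<sigma> = \<sigma> and N = N and \<tau> = \<tau>1 and n = n1 and \<xi> = \<xi>1, OF \<sigma> _ uv(2)]) (use gap1 \<tau>1 in auto)
  have w12: "simple_process n1 \<tau>1 \<xi>1 s \<omega> = simple_process n1 \<tau>1 \<xi>1 (\<sigma> (Suc j)) \<omega>"
    if "j < N" "\<sigma> j < s" "s \<le> \<sigma> (Suc j)" for j s \<omega>
    by (rule simple_process_window_sum(2)[where u = u and v = v and \<sigma> = \<sigma> and N = N and \<tau> = \<tau>1 and n = n1 and \<xi> = \<xi>1, OF \<sigma> _ uv(2)]) (use that gap1 \<tau>1 in auto)
  have w13: "\<tau>1 k \<le> \<sigma> j" if "j < N" "k < n1" "\<sigma> (Suc j) \<in> {\<tau>1 k<..\<tau>1 (Suc k)}" for j k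
    by (rule simple_process_window_sum(3)[where u = u and v = v and \<sigma> = \<sigma> and N = N and \<tau> = \<tau>1 and n = n1, OF \<sigma> _ uv(2)]) (use that gap1 \<tau>1 in auto)
  have w21: "(\<Sum>j<N. simple_process n2 \<tau>2 \<xi>2 (\<sigma> (Suc j)) \<omega> * (B (\<sigma> (Suc j)) \<omega> - B (\<sigma> j) \<omega>))
    = simple_integral B n2 \<tau>2 \<xi>2 v \<omega> - simple_integral B n2 \<tau>2 \<xi>2 u \<omega>" for \<omega>
    by (rule simple_process_window_sum(1)[where u = u and v = v and \<sigma> = \<sigma> and N = N and \<tau> = \<tau>2 and n = n2 and \<xi> = \<xi>2, OF \<sigma> _ uv(2)]) (use gap2 \<tau>2 in auto)
  have w22: "simple_process n2 \<tau>2 \<xi>2 s \<omega> = simple_process n2 \<tau>2 \<xi>2 (\<sigma> (Suc j)) \<omega>"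
    if "j < N" "\<sigma> j < s" "s \<le> \<sigma> (Suc j)" for j s \<omega>
    by (rule simple_process_window_sum(2)[where u = u and v = v and \<sigma> = \<sigma> and N = N and \<tau> = \<tau>2 and n = n2 and \<xi> = \<xi>2, OF \<sigma> _ uv(2)]) (use that gap2 \<tau>2 in auto)
  have w23: "\<tau>2 k \<le> \<sigma> j" if "j < N" "k < n2" "\<sigma> (Suc j) \<in> {\<tau>2 k<..\<tau>2 (Suc k)}" for j k
    by (rule simple_process_window_sum(3)[where u = u and v = v and \<sigma> = \<sigma> and N = N and \<tau> = \<tau>2 and n = n2, OF \<sigma> _ uv(2)]) (use that gap2 \<tau>2 in auto)
  define H where "H = (\<lambda>s \<omega>. simple_process n1 \<tau>1 \<xi>1 s \<omega> - c * simple_process n2 \<tau>2 \<xi>2 s \<omega>)"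
  define q where "q = (\<lambda>\<omega>. \<Sum>k<N. (H (\<sigma> (Suc k)) \<omega>)\<^sup>2 * (\<sigma> (Suc k) - \<sigma> k))"
  have X: "(\<Sum>k<N. H (\<sigma> (Suc k)) \<omega> * (B (\<sigma> (Suc k)) \<omega> - B (\<sigma> k) \<omega>))
     = (simple_integral B n1 \<tau>1 \<xi>1 v \<omega> - simple_integral B n1 \<tau>1 \<xi>1 u \<omega>)
        - c * (simple_integral B n2 \<tau>2 \<xi>2 v \<omega> - simple_integral B n2 \<tau>2 \<xi>2 u \<omega>)" for \<omega>
    by (simp add: H_def left_diff_distrib sum_subtractf mult.assoc sum_distrib_left[symmetric] w11 w21)
  show ?thesis
  proof
    have ad: "H (\<sigma> (Suc k)) \<in> borel_measurable (F (\<sigma> k))" if "k < N" for k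
    proof -
      have "simple_process n1 \<tau>1 \<xi>1 (\<sigma> (Suc k)) \<in> borel_measurable (F (\<sigma> k))"
        "simple_process n2 \<tau>2 \<xi>2 (\<sigma> (Suc k)) \<in> borel_measurable (F (\<sigma> k))"
        using w13[OF that] w23[OF that] that
        by (auto intro!: simple_process_adapted[OF si1] simple_process_adapted[OF si2])
      then show ?thesis unfolding H_def by measurable
    qed
    show "adapted_sum u (\<lambda>\<omega>. (simple_integral B n1 \<tau>1 \<xi>1 v \<omega> - simple_integral B n1 \<tau>1 \<xi>1 u \<omega>)
        - c * (simple_integral B n2 \<tau>2 \<xi>2 v \<omega> - simple_integral B n2 \<tau>2 \<xi>2 u \<omega>)) q"
      unfolding adapted_sum_def
      by (intro exI[of _ N] exI[of _ \<sigma>] exI[of _ "\<lambda>k. H (\<sigma> (Suc k))"])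
         (use \<sigma> ad in \<open>auto simp: X q_def intro: less_imp_le\<close>)
    fix \<omega>
    have const: "H s \<omega> = H (\<sigma> (Suc k)) \<omega>" if "k < N" "\<sigma> k < s" "s \<le> \<sigma> (Suc k)" for k s
      using w12[OF that] w22[OF that] by (simp add: H_def)
    have [measurable]: "(\<lambda>s. H s \<omega>) \<in> borel_measurable borel" unfolding H_def by measurable
    have "ennreal (q \<omega>) = (\<integral>\<^sup>+s\<in>{\<sigma> 0<..\<sigma> N}. ennreal ((H s \<omega>)\<^sup>2) \<partial>lborel)"
      unfolding q_def
    proof (rule nn_integral_step_function[symmetric])
      show "H s \<omega> = H (\<sigma> (Suc k)) \<omega>" if "k < N" "\<sigma> k < s" "s \<le> \<sigma> (Suc k)" for k s
        by (rule const[OF that])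
    qed (use \<sigma>(3) in \<open>auto intro: less_imp_le\<close>)
    also have "\<dots> = (\<integral>\<^sup>+s\<in>{u..v}. ennreal ((H s \<omega>)\<^sup>2) \<partial>lborel)"
      unfolding \<sigma>
    proof (rule nn_integral_cong_AE)
      have "AE s in lborel. s \<noteq> u" by (rule AE_lborel_singleton)
      then show "AE s in lborel. ennreal ((H s \<omega>)\<^sup>2) * indicator {u<..v} s = ennreal ((H s \<omega>)\<^sup>2) * indicator {u..v} s"
        by eventually_elim (auto simp: indicator_def)
    qed
    finally show "ennreal (q \<omega>) = (\<integral>\<^sup>+s\<in>{u..v}. ennreal ((simple_process n1 \<tau>1 \<xi>1 s \<omega> - c * simple_process n2 \<tau>2 \<xi>2 s \<omega>)\<^sup>2) \<partial>lborel)"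
      by (simp add: H_def)
  qed
qed

end

section \<open>Riemann sums and the Riccati recursion\<close>

definition grid :: "real \<Rightarrow> real \<Rightarrow> nat \<Rightarrow> nat \<Rightarrow> real" where
  "grid s t n i = s + (t - s) * real i / real n"

lemma grid_0 [simp]: "grid s t n 0 = s" by (simp add: grid_def)

lemma grid_n [simp]: "0 < n \<Longrightarrow> grid s t n n = t" by (simp add: grid_def)

lemma grid_mono: "s \<le> t \<Longrightarrow> i \<le> j \<Longrightarrow> grid s t n i \<le> grid s t n j"
  by (auto simp: grid_def intro!: divide_right_mono mult_left_mono)

lemma grid_Suc: "grid s t n (Suc i) = grid s t n i + (t - s) / real n"
  by (simp add: grid_def field_simps add_divide_distrib[symmetric])

lemma grid_bounds: "s \<le> t \<Longrightarrow> i \<le> n \<Longrightarrow> s \<le> grid s t n i \<and> grid s t n i \<le> t"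
  using grid_mono[of s t 0 i n] grid_mono[of s t i n n] by (cases n) auto

lemma grid_oscillation:
  fixes f :: "real \<Rightarrow> real"
  assumes f: "continuous_on {s..t} f" and st: "s \<le> t" and e: "0 < e"
  shows "eventually (\<lambda>n. \<forall>i<n. \<forall>w\<in>{grid s t n i..grid s t n (Suc i)}. \<forall>w'\<in>{grid s t n i..grid s t n (Suc i)}.
     \<bar>f w - f w'\<bar> \<le> e) sequentially"
proof -
  have "uniformly_continuous_on {s..t} f"
    using f by (intro compact_uniformly_continuous) auto
  then obtain d where d: "0 < d" "\<And>w w'. w \<in> {s..t} \<Longrightarrow> w' \<in> {s..t} \<Longrightarrow> dist w' w < d \<Longrightarrow> dist (f w') (f w) < e"
    unfolding uniformly_continuous_on_def using e by metis
  have "(\<lambda>n. (t - s) / real n) \<longlonglongrightarrow> 0" by real_asymp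
  then have "eventually (\<lambda>n. (t - s) / real n < d) sequentially"
    using d by (intro order_tendstoD(2)[of _ 0])
  then show ?thesis
  proof eventually_elim
    case (elim n)
    show ?case
    proof (intro allI impI ballI)
      fix i w w' assume i: "i < n" and w: "w \<in> {grid s t n i..grid s t n (Suc i)}" "w' \<in> {grid s t n i..grid s t n (Suc i)}"
      have "s \<le> grid s t n i" "grid s t n (Suc i) \<le> t"
        using grid_bounds[OF st, of i n] grid_bounds[OF st, of "Suc i" n] i by auto
      moreover have "dist w w' < d"
        using w elim by (auto simp: grid_Suc dist_real_def abs_less_iff)
      ultimately have "dist (f w) (f w') < e" using w by (intro d) auto
      then show "\<bar>f w - f w'\<bar> \<le> e" by (simp add: dist_real_def)
    qed
  qed
qed

lemma integral_grid:
  fixes f :: "real \<Rightarrow> real"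
  assumes f: "continuous_on {s..t} f" and st: "s \<le> t" and "k \<le> n"
  shows "(\<Sum>i<k. integral {grid s t n i..grid s t n (Suc i)} f) = integral {s..grid s t n k} f"
  using \<open>k \<le> n\<close>
proof (induction k)
  case (Suc k)
  have b: "s \<le> grid s t n k" "grid s t n k \<le> grid s t n (Suc k)" "grid s t n (Suc k) \<le> t"
    using grid_bounds[OF st, of k n] grid_bounds[OF st, of "Suc k" n] grid_mono[OF st, of k "Suc k" n] Suc by auto
  then have "f integrable_on {s..grid s t n (Suc k)}"
    by (intro integrable_continuous_real continuous_on_subset[OF f]) auto
  from Henstock_Kurzweil_Integration.integral_combine[OF b(1,2) this] show ?case using Suc by simp
qed simp

lemma grid_integral_close:
  fixes f :: "real \<Rightarrow> real"
  assumes f: "continuous_on {s..t} f" and st: "s \<le> t" and i: "i < n"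
    and c: "\<And>w. w \<in> {grid s t n i..grid s t n (Suc i)} \<Longrightarrow> \<bar>f w - c\<bar> \<le> e"
  shows "\<bar>integral {grid s t n i..grid s t n (Suc i)} f - c * ((t - s) / real n)\<bar> \<le> e * ((t - s) / real n)"
proof -
  have b: "s \<le> grid s t n i" "grid s t n i \<le> grid s t n (Suc i)" "grid s t n (Suc i) \<le> t"
    using grid_bounds[OF st, of i n] grid_bounds[OF st, of "Suc i" n] grid_mono[OF st, of i "Suc i" n] i by auto
  have fi: "f integrable_on {grid s t n i..grid s t n (Suc i)}"
    using b by (intro integrable_continuous_real continuous_on_subset[OF f]) auto
  have len: "grid s t n (Suc i) - grid s t n i = (t - s) / real n" by (simp add: grid_Suc)
  have ci: "integral {grid s t n i..grid s t n (Suc i)} (\<lambda>_. a) = a * ((t - s) / real n)" for a :: real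
    using b by (simp add: len[symmetric])
  have "integral {grid s t n i..grid s t n (Suc i)} f \<le> integral {grid s t n i..grid s t n (Suc i)} (\<lambda>_. c + e)"
    using c by (intro integral_le fi) (auto simp: abs_le_iff algebra_simps)
  moreover have "integral {grid s t n i..grid s t n (Suc i)} (\<lambda>_. c - e) \<le> integral {grid s t n i..grid s t n (Suc i)} f"
    using c by (intro integral_le fi) (auto simp: abs_le_iff algebra_simps)
  moreover define h where "h = (t - s) / real n"
  ultimately show ?thesis unfolding ci h_def[symmetric] by (simp add: abs_le_iff algebra_simps)
qed

lemma riemann_sum_tendsto:
  fixes f :: "real \<Rightarrow> real"
  assumes f: "continuous_on {s..t} f" and st: "s \<le> t"
  shows "(\<lambda>n. \<Sum>i<n. f (grid s t n i) * ((t - s) / real n)) \<longlonglongrightarrow> integral {s..t} f"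
proof (rule LIMSEQ_I)
  fix r :: real assume r: "0 < r"
  define D where "D = t - s + 1"
  define e where "e = r / (2 * D)"
  have D: "0 < D" "t - s \<le> D" using st by (auto simp: D_def)
  have e: "0 < e" "e * (t - s) < r"
  proof -
    show "0 < e" using r D by (simp add: e_def)
    then have "e * (t - s) \<le> e * D" using D by (intro mult_left_mono) auto
    also have "\<dots> = r / 2" using D by (simp add: e_def)
    finally show "e * (t - s) < r" using r by simp
  qed
  from grid_oscillation[OF f st e(1)] eventually_gt_at_top[of 0]
  have "eventually (\<lambda>n. norm ((\<Sum>i<n. f (grid s t n i) * ((t - s) / real n)) - integral {s..t} f) < r) sequentially"
  proof eventually_elim
    case (elim n)
    have "\<bar>(\<Sum>i<n. f (grid s t n i) * ((t - s) / real n)) - integral {s..t} f\<bar>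
      = \<bar>\<Sum>i<n. f (grid s t n i) * ((t - s) / real n) - integral {grid s t n i..grid s t n (Suc i)} f\<bar>"
      using integral_grid[OF f st order_refl, of n] elim by (simp add: sum_subtractf)
    also have "\<dots> \<le> (\<Sum>i<n. \<bar>f (grid s t n i) * ((t - s) / real n) - integral {grid s t n i..grid s t n (Suc i)} f\<bar>)"
      by (rule sum_abs)
    also have "\<dots> \<le> (\<Sum>i<n. e * ((t - s) / real n))"
    proof (rule sum_mono)
      fix i assume i: "i \<in> {..<n}"
      have "\<bar>integral {grid s t n i..grid s t n (Suc i)} f - f (grid s t n i) * ((t - s) / real n)\<bar> \<le> e * ((t - s) / real n)"
        using elim i grid_mono[OF st, of i "Suc i" n] by (intro grid_integral_close[OF f st]) auto
      then show "\<bar>f (grid s t n i) * ((t - s) / real n) - integral {grid s t n i..grid s t n (Suc i)} f\<bar> \<le> e * ((t - s) / real n)"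
        by (simp add: abs_minus_commute)
    qed
    also have "\<dots> = e * (t - s)" using elim by simp
    finally show ?case using e by simp
  qed
  then show "\<exists>no. \<forall>n\<ge>no. norm ((\<Sum>i<n. f (grid s t n i) * ((t - s) / real n)) - integral {s..t} f) < r"
    by (simp add: eventually_sequentially)
qed

text \<open>For \<open>\<eta>' = -2\<eta>\<^sup>2\<close> one has the exact difference equation \<open>\<eta>(v) - \<eta>(u) = -2(v - u) \<eta>(u) \<eta>(v)\<close>. After summation by parts
of \<open>\<Sum>\<eta> \<Delta>r\<close>, the first term below comes from the increment of \<open>\<eta>\<close> and the second one from the compensator
\<open>2\<eta>\<^sup>2 \<integral>r\<close>. In the continuous limit they cancel.\<close>

definition riccati_error :: "real \<Rightarrow> real \<Rightarrow> (real \<Rightarrow> real) \<Rightarrow> (real \<Rightarrow> real) \<Rightarrow> nat \<Rightarrow> nat \<Rightarrow> real" where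
  "riccati_error s t \<eta> r n i =
     2 * ((t - s) / real n) * \<eta> (grid s t n i) * \<eta> (grid s t n (Suc i)) * r (grid s t n (Suc i))
     - 2 * (\<eta> (grid s t n i))\<^sup>2 * integral {grid s t n i..grid s t n (Suc i)} r"

lemma riccati_error_bound:
  assumes r: "continuous_on {s..t} r" and st: "s \<le> t" and i: "i < n"
    and C: "\<And>w. w \<in> {s..t} \<Longrightarrow> \<bar>\<eta> w\<bar> \<le> C" and K: "\<And>w. w \<in> {s..t} \<Longrightarrow> 0 \<le> r w \<and> r w \<le> K"
  shows "\<bar>riccati_error s t \<eta> r n i\<bar> \<le> 4 * C\<^sup>2 * K * ((t - s) / real n)"
proof -
  define h where "h = (t - s) / real n"
  define J where "J = integral {grid s t n i..grid s t n (Suc i)} r"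
  define a b where "a = \<eta> (grid s t n i)" and "b = \<eta> (grid s t n (Suc i))"
  define \<rho> where "\<rho> = r (grid s t n (Suc i))"
  have b: "s \<le> grid s t n i" "grid s t n i \<le> grid s t n (Suc i)" "grid s t n (Suc i) \<le> t"
    using grid_bounds[OF st, of i n] grid_bounds[OF st, of "Suc i" n] grid_mono[OF st, of i "Suc i" n] i by auto
  have h: "0 \<le> h" using st by (simp add: h_def)
  have ri: "r integrable_on {grid s t n i..grid s t n (Suc i)}"
    using b by (intro integrable_continuous_real continuous_on_subset[OF r]) auto
  have J0: "0 \<le> J" unfolding J_def using b K by (intro integral_nonneg ri) auto
  have "J \<le> integral {grid s t n i..grid s t n (Suc i)} (\<lambda>_. K)"
    unfolding J_def using b K by (intro integral_le ri) auto
  also have "\<dots> = K * h" using b by (simp add: h_def grid_Suc)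
  finally have J1: "J \<le> K * h" .
  have ab: "\<bar>a\<bar> \<le> C" "\<bar>b\<bar> \<le> C" "0 \<le> \<rho>" "\<rho> \<le> K" using b C K by (auto simp: a_def b_def \<rho>_def)
  then have C0: "0 \<le> C" by linarith
  have "\<bar>a * b\<bar> \<le> C\<^sup>2" unfolding abs_mult power2_eq_square using ab C0 by (intro mult_mono) auto
  then have "\<bar>a * b * \<rho>\<bar> \<le> C\<^sup>2 * K" using ab unfolding abs_mult[of "a * b"] by (intro mult_mono) auto
  then have 1: "\<bar>2 * h * a * b * \<rho>\<bar> \<le> 2 * C\<^sup>2 * K * h"
    using mult_left_mono[of "\<bar>a * b * \<rho>\<bar>" "C\<^sup>2 * K" "2 * h"] h by (simp add: abs_mult ac_simps)
  have "a\<^sup>2 \<le> C\<^sup>2" using ab(1) C0 by (metis abs_le_square_iff abs_of_nonneg)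
  then have "a\<^sup>2 * J \<le> C\<^sup>2 * (K * h)" using J0 J1 by (intro mult_mono) auto
  then have 2: "\<bar>2 * a\<^sup>2 * J\<bar> \<le> 2 * C\<^sup>2 * K * h" using J0 by (simp add: abs_mult)
  have "riccati_error s t \<eta> r n i = 2 * h * a * b * \<rho> - 2 * a\<^sup>2 * J"
    by (simp add: riccati_error_def h_def a_def b_def \<rho>_def J_def)
  then show ?thesis using 1 2 unfolding h_def[symmetric] by linarith
qed

text \<open>The error of one cell is the mesh times the oscillation of \<open>\<eta>\<close> and \<open>r\<close> over the cell, and this
oscillation tends to zero uniformly by compactness.\<close>

lemma riccati_error_tendsto_0:
  assumes r: "continuous_on {s..t} r" and \<eta>: "continuous_on {s..t} \<eta>" and st: "s \<le> t"
  shows "(\<lambda>n. \<Sum>i<n. \<bar>riccati_error s t \<eta> r n i\<bar>) \<longlonglongrightarrow> 0"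
proof (rule LIMSEQ_I)
  fix d :: real assume d: "0 < d"
  have bd: "bounded (\<eta> ` {s..t})" "bounded (r ` {s..t})"
    using r \<eta> by (auto intro!: compact_imp_bounded compact_continuous_image)
  obtain C where C: "0 < C" "\<And>w. w \<in> {s..t} \<Longrightarrow> \<bar>\<eta> w\<bar> \<le> C"
    using bd(1) unfolding bounded_pos by auto
  obtain K where K: "0 < K" "\<And>w. w \<in> {s..t} \<Longrightarrow> \<bar>r w\<bar> \<le> K"
    using bd(2) unfolding bounded_pos by auto
  define D where "D = 2 * C * (K + C) * (t - s) + 1"
  have D: "0 < D" using C K st by (auto simp: D_def intro!: add_nonneg_pos mult_nonneg_nonneg)
  define e where "e = d / D"
  have e: "0 < e" "2 * C * (K + C) * (t - s) * e < d"
  proof -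
    show "0 < e" using d D by (simp add: e_def)
    then have "2 * C * (K + C) * (t - s) * e < D * e" by (simp add: D_def)
    also have "\<dots> = d" using D by (simp add: e_def)
    finally show "2 * C * (K + C) * (t - s) * e < d" .
  qed
  from grid_oscillation[OF r st e(1)] grid_oscillation[OF \<eta> st e(1)] eventually_gt_at_top[of 0]
  have "eventually (\<lambda>n. norm ((\<Sum>i<n. \<bar>riccati_error s t \<eta> r n i\<bar>) - 0) < d) sequentially"
  proof eventually_elim
    case (elim n)
    define h where "h = (t - s) / real n"
    have h: "0 \<le> h" using st by (simp add: h_def)
    have "(\<Sum>i<n. \<bar>riccati_error s t \<eta> r n i\<bar>) \<le> (\<Sum>i<n. 2 * C * (K + C) * e * h)"
    proof (rule sum_mono)
      fix i assume "i \<in> {..<n}"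
      then have i: "i < n" by simp
      define J where "J = integral {grid s t n i..grid s t n (Suc i)} r"
      define a b where "a = \<eta> (grid s t n i)" and "b = \<eta> (grid s t n (Suc i))"
      define \<rho> where "\<rho> = r (grid s t n (Suc i))"
      have bb: "s \<le> grid s t n i" "grid s t n i \<le> grid s t n (Suc i)" "grid s t n (Suc i) \<le> t"
        using grid_bounds[OF st, of i n] grid_bounds[OF st, of "Suc i" n] grid_mono[OF st, of i "Suc i" n] i by auto
      have J: "\<bar>J - \<rho> * h\<bar> \<le> e * h"
        unfolding J_def \<rho>_def h_def using elim(1) i bb by (intro grid_integral_close[OF r st i]) auto
      have ab: "\<bar>b - a\<bar> \<le> e" using elim(2) i bb by (auto simp: a_def b_def)
      have bds: "\<bar>a\<bar> \<le> C" "\<bar>\<rho>\<bar> \<le> K" using bb C K by (auto simp: a_def \<rho>_def)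
      have "riccati_error s t \<eta> r n i = 2 * h * a * b * \<rho> - 2 * a\<^sup>2 * J"
        by (simp add: riccati_error_def h_def a_def b_def \<rho>_def J_def)
      \<comment> \<open>The first summand contains the oscillation of \<open>\<eta>\<close>, the second one that of \<open>r\<close>.\<close>
      also have "\<dots> = (2 * a) * (h * \<rho> * (b - a) - a * (J - \<rho> * h))"
        by (simp add: power2_eq_square algebra_simps)
      also have "\<bar>\<dots>\<bar> = (2 * \<bar>a\<bar>) * \<bar>h * \<rho> * (b - a) - a * (J - \<rho> * h)\<bar>"
        by (simp add: abs_mult)
      also have "\<dots> \<le> (2 * C) * ((h * K) * e + C * (e * h))"
      proof (intro mult_mono)
        have "\<bar>h * \<rho> * (b - a)\<bar> \<le> (h * K) * e"
          unfolding abs_mult using h bds ab K by (intro mult_mono) auto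
        moreover have "\<bar>a * (J - \<rho> * h)\<bar> \<le> C * (e * h)"
          unfolding abs_mult using bds J C by (intro mult_mono) auto
        ultimately show "\<bar>h * \<rho> * (b - a) - a * (J - \<rho> * h)\<bar> \<le> (h * K) * e + C * (e * h)" by linarith
      qed (use bds C in auto)
      also have "\<dots> = 2 * C * (K + C) * e * h" by (simp add: algebra_simps)
      finally show "\<bar>riccati_error s t \<eta> r n i\<bar> \<le> 2 * C * (K + C) * e * h" .
    qed
    also have "\<dots> = 2 * C * (K + C) * (t - s) * e" using elim by (simp add: h_def)
    finally show ?case using e by (simp add: sum_nonneg)
  qed
  then show "\<exists>no. \<forall>n\<ge>no. norm ((\<Sum>i<n. \<bar>riccati_error s t \<eta> r n i\<bar>) - 0) < d"
    by (simp add: eventually_sequentially)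
qed

section \<open>One step of a squared Bessel process\<close>

text \<open>The filtration and the Brownian motion that drive the equation are fixed here, since the Markov
property is a statement about them.\<close>

locale besq_process = brownian M F B for M :: "'a measure" and F B +
  fixes \<mu> x :: real and R :: "real \<Rightarrow> 'a \<Rightarrow> real"
  assumes continuous: "\<omega> \<in> space M \<Longrightarrow> continuous_on {0..} (\<lambda>t. R t \<omega>)"
    and nonneg: "\<omega> \<in> space M \<Longrightarrow> 0 \<le> t \<Longrightarrow> 0 \<le> R t \<omega>"
    and start: "AE \<omega> in M. R 0 \<omega> = x"
    and adapted: "0 \<le> t \<Longrightarrow> R t \<in> borel_measurable (F t)"
    and sde: "0 \<le> t \<Longrightarrow> \<exists>I. ito_integral M F B (\<lambda>s \<omega>. sqrt (R s \<omega>)) t I \<and>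
           (AE \<omega> in M. R t \<omega> = R 0 \<omega> + 2 * I \<omega> + 2 * (\<mu> + 1) * t)"
    and index_nonneg: "0 \<le> \<mu>"
begin

definition besq_dim :: real where "besq_dim = 2 * (\<mu> + 1)"

lemma besq_dim_nonneg: "0 \<le> besq_dim" using index_nonneg by (simp add: besq_dim_def)

lemma adapted_mono: "0 \<le> s \<Longrightarrow> s \<le> t \<Longrightarrow> R s \<in> borel_measurable (F t)"
  using adapted measurable_F_mono by blast

lemma R_measurable: "0 \<le> t \<Longrightarrow> R t \<in> borel_measurable M"
  using adapted measurable_F_M by blast

lemma continuous_segment: "\<omega> \<in> space M \<Longrightarrow> 0 \<le> s \<Longrightarrow> continuous_on {s..t} (\<lambda>u. R u \<omega>)"
  using continuous by (rule continuous_on_subset) auto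

text \<open>Riemann sums show that the integral of \<open>R\<close> up to time \<open>v\<close> is known at time \<open>v\<close>, not merely measurable.\<close>

lemma integral_adapted:
  assumes "0 \<le> u" "u \<le> v"
  shows "(\<lambda>\<omega>. integral {u..v} (\<lambda>s. R s \<omega>)) \<in> borel_measurable (F v)"
proof (rule borel_measurable_LIMSEQ_real)
  show "(\<lambda>n. \<Sum>i<n. R (grid u v n i) \<omega> * ((v - u) / real n)) \<longlonglongrightarrow> integral {u..v} (\<lambda>s. R s \<omega>)"
    if "\<omega> \<in> space (F v)" for \<omega>
    using that assms by (intro riemann_sum_tendsto continuous_segment) (auto simp: space_F)
  show "(\<lambda>\<omega>. \<Sum>i<n. R (grid u v n i) \<omega> * ((v - u) / real n)) \<in> borel_measurable (F v)" for n
  proof (intro borel_measurable_sum borel_measurable_times adapted_mono)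
    fix i assume "i \<in> {..<n}"
    then show "0 \<le> grid u v n i" "grid u v n i \<le> v"
      using grid_bounds[of u v i n] assms by auto
  qed auto
qed

lemma integral_nonneg_path:
  "\<omega> \<in> space M \<Longrightarrow> 0 \<le> u \<Longrightarrow> 0 \<le> integral {u..v} (\<lambda>s. R s \<omega>)"
  by (intro integral_nonneg integrable_continuous_real continuous_segment) (auto intro: nonneg)

lemma simple_process_jointly_measurable:
  assumes "simple_integrand M F n \<tau> \<xi>"
  shows "(\<lambda>(\<omega>, s). simple_process n \<tau> \<xi> s \<omega>) \<in> borel_measurable (M \<Otimes>\<^sub>M borel)"
proof -
  have "\<xi> k \<in> borel_measurable M" if k: "k < n" for k
  proof -
    have "\<tau> 0 \<le> \<tau> k" by (rule chain_le[of n]) (use assms k in \<open>auto simp: simple_integrand_def\<close>)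
    then show ?thesis using assms k measurable_F_M[of "\<xi> k" "\<tau> k" borel] by (auto simp: simple_integrand_def)
  qed
  then have [measurable]: "(\<lambda>p. \<xi> k (fst p)) \<in> borel_measurable (M \<Otimes>\<^sub>M borel)" if "k < n" for k
    using that by measurable
  show ?thesis
    unfolding simple_process_def case_prod_beta
    by (intro borel_measurable_sum borel_measurable_times) auto
qed

text \<open>The martingale part of \<open>R\<close> on \<open>[u,v]\<close> is an almost sure limit of integrals of step processes over the
window, together with their quadratic variations. The definition of the Ito integral provides one
approximating sequence for the horizon \<open>v\<close> and an unrelated one for \<open>u\<close>. Both approximate \<open>sqrt R\<close> in
\<open>L\<^sup>2([0,u])\<close>, so the integrals of their difference over \<open>[0,u]\<close> tend to zero; hence the sequence for \<open>v\<close>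
alone also yields the integral up to \<open>u\<close>.\<close>

lemma window_approximation:
  assumes u: "0 \<le> u" and uv: "u \<le> v"
  obtains X q where "\<And>m. adapted_sum u (X m) (q m)"
    "AE \<omega> in M. (\<lambda>m. X m \<omega>) \<longlonglongrightarrow> (R v \<omega> - R u \<omega> - besq_dim * (v - u)) / 2"
    "AE \<omega> in M. (\<lambda>m. q m \<omega>) \<longlonglongrightarrow> integral {u..v} (\<lambda>s. R s \<omega>)"
proof -
  have v: "0 \<le> v" using u uv by simp
  define H where "H = (\<lambda>s \<omega>. sqrt (R s \<omega>))"
  obtain Iv where Iv: "ito_integral M F B H v Iv" "AE \<omega> in M. R v \<omega> = R 0 \<omega> + 2 * Iv \<omega> + 2 * (\<mu> + 1) * v"
    using sde[OF v] unfolding H_def by blast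
  obtain Iu where Iu: "ito_integral M F B H u Iu" "AE \<omega> in M. R u \<omega> = R 0 \<omega> + 2 * Iu \<omega> + 2 * (\<mu> + 1) * u"
    using sde[OF u] unfolding H_def by blast
  obtain nv \<tau>v \<xi>v where siv: "\<And>m. simple_integrand M F (nv m) (\<tau>v m) (\<xi>v m)"
    and v1: "vanishes_in_prob M (\<lambda>m \<omega>.
          \<integral>\<^sup>+s\<in>{0..v}. ennreal ((simple_process (nv m) (\<tau>v m) (\<xi>v m) s \<omega> - H s \<omega>)\<^sup>2) \<partial>lborel)"
    and v2: "vanishes_in_prob M (\<lambda>m \<omega>. ennreal \<bar>simple_integral B (nv m) (\<tau>v m) (\<xi>v m) v \<omega> - Iv \<omega>\<bar>)"
    and Hm: "(\<lambda>(s, \<omega>). H s \<omega>) \<in> borel_measurable (restrict_space borel {0..} \<Otimes>\<^sub>M M)"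
    and Ivm [measurable]: "Iv \<in> borel_measurable M"
    using Iv(1) unfolding ito_integral_def by blast
  obtain nu \<tau>u \<xi>u where siu: "\<And>m. simple_integrand M F (nu m) (\<tau>u m) (\<xi>u m)"
    and u1: "vanishes_in_prob M (\<lambda>m \<omega>.
          \<integral>\<^sup>+s\<in>{0..u}. ennreal ((simple_process (nu m) (\<tau>u m) (\<xi>u m) s \<omega> - H s \<omega>)\<^sup>2) \<partial>lborel)"
    and u2: "vanishes_in_prob M (\<lambda>m \<omega>. ennreal \<bar>simple_integral B (nu m) (\<tau>u m) (\<xi>u m) u \<omega> - Iu \<omega>\<bar>)"
    and Ium [measurable]: "Iu \<in> borel_measurable M"
    using Iu(1) unfolding ito_integral_def by blast
  define Pv where "Pv = (\<lambda>m s \<omega>. simple_process (nv m) (\<tau>v m) (\<xi>v m) s \<omega>)"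
  define Pu where "Pu = (\<lambda>m s \<omega>. simple_process (nu m) (\<tau>u m) (\<xi>u m) s \<omega>)"
  define Sv where "Sv = (\<lambda>m t \<omega>. simple_integral B (nv m) (\<tau>v m) (\<xi>v m) t \<omega>)"
  define Su where "Su = (\<lambda>m t \<omega>. simple_integral B (nu m) (\<tau>u m) (\<xi>u m) t \<omega>)"
  \<comment> \<open>\<open>H\<close> is jointly measurable for nonnegative times only; \<open>H'\<close> extends it to all times.\<close>
  define H' where "H' = (\<lambda>s \<omega>. H (max 0 s) \<omega>)"
  have "(\<lambda>p. (max (0::real) (snd p), fst p)) \<in> measurable (M \<Otimes>\<^sub>M borel) (restrict_space borel {0..} \<Otimes>\<^sub>M M)"
    by (intro measurable_Pair measurable_restrict_space2) auto
  from measurable_compose[OF this Hm]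
  have H'm [measurable]: "(\<lambda>(\<omega>, s). H' s \<omega>) \<in> borel_measurable (M \<Otimes>\<^sub>M borel)"
    by (simp add: H'_def case_prod_beta)
  have Pvm [measurable]: "(\<lambda>(\<omega>, s). Pv m s \<omega>) \<in> borel_measurable (M \<Otimes>\<^sub>M borel)" for m
    unfolding Pv_def by (rule simple_process_jointly_measurable[OF siv])
  have Pum [measurable]: "(\<lambda>(\<omega>, s). Pu m s \<omega>) \<in> borel_measurable (M \<Otimes>\<^sub>M borel)" for m
    unfolding Pu_def by (rule simple_process_jointly_measurable[OF siu])
  have 0: "simple_integral B n \<tau> \<xi> 0 \<omega> = 0" if "simple_integrand M F n \<tau> \<xi>" for n \<tau> \<xi> \<omega>
  proof -
    have "0 \<le> \<tau> k" if "k \<le> n" for k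
    proof -
      have "\<tau> 0 \<le> \<tau> k" by (rule chain_le[of n]) (use \<open>simple_integrand M F n \<tau> \<xi>\<close> that in \<open>auto simp: simple_integrand_def\<close>)
      then show ?thesis using \<open>simple_integrand M F n \<tau> \<xi>\<close> by (auto simp: simple_integrand_def)
    qed
    then show ?thesis by (simp add: simple_integral_def min_absorb1)
  qed
  have "\<exists>q. adapted_sum u (\<lambda>\<omega>. Sv m v \<omega> - Sv m u \<omega>) q \<and>
      (\<forall>\<omega>. ennreal (q \<omega>) = (\<integral>\<^sup>+s\<in>{u..v}. ennreal ((Pv m s \<omega>)\<^sup>2) \<partial>lborel))" for m
    unfolding Sv_def Pv_def
    by (rule simple_integral_window[OF siv[of m] siv[of m] u uv, of 0]) auto
  then obtain q where q: "\<And>m. adapted_sum u (\<lambda>\<omega>. Sv m v \<omega> - Sv m u \<omega>) (q m)"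
    "\<And>m \<omega>. ennreal (q m \<omega>) = (\<integral>\<^sup>+s\<in>{u..v}. ennreal ((Pv m s \<omega>)\<^sup>2) \<partial>lborel)" by metis
  have "\<exists>q. adapted_sum 0 (\<lambda>\<omega>. Sv m u \<omega> - Su m u \<omega>) q \<and>
      (\<forall>\<omega>. ennreal (q \<omega>) = (\<integral>\<^sup>+s\<in>{0..u}. ennreal ((Pv m s \<omega> - Pu m s \<omega>)\<^sup>2) \<partial>lborel))" for m
    unfolding Sv_def Pv_def Su_def Pu_def
    by (rule simple_integral_window[OF siv[of m] siu[of m] order_refl u, of 1]) (auto simp: 0[OF siv] 0[OF siu])
  then obtain p where p: "\<And>m. adapted_sum 0 (\<lambda>\<omega>. Sv m u \<omega> - Su m u \<omega>) (p m)"
    "\<And>m \<omega>. ennreal (p m \<omega>) = (\<integral>\<^sup>+s\<in>{0..u}. ennreal ((Pv m s \<omega> - Pu m s \<omega>)\<^sup>2) \<partial>lborel)" by metis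
  have Svm: "Sv m t \<in> borel_measurable M" if t: "0 \<le> t" for m t
  proof -
    obtain q where "adapted_sum 0 (\<lambda>\<omega>. Sv m t \<omega>) q"
      unfolding Sv_def
      by (rule simple_integral_window[OF siv[of m] siv[of m] order_refl t, of 0]) (auto simp: 0[OF siv])
    then show ?thesis by (rule adapted_sum_measurable(1)) simp
  qed
  have Sum: "Su m t \<in> borel_measurable M" if t: "0 \<le> t" for m t
  proof -
    obtain q where "adapted_sum 0 (\<lambda>\<omega>. Su m t \<omega>) q"
      unfolding Su_def
      by (rule simple_integral_window[OF siu[of m] siu[of m] order_refl t, of 0]) (auto simp: 0[OF siu])
    then show ?thesis by (rule adapted_sum_measurable(1)) simp
  qed
  note [measurable] = Svm[OF v] Sum[OF u]
  define D1 where "D1 = (\<lambda>m \<omega>. \<integral>\<^sup>+s\<in>{0..v}. ennreal ((Pv m s \<omega> - H' s \<omega>)\<^sup>2) \<partial>lborel)"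
  define D2 where "D2 = (\<lambda>m \<omega>. ennreal \<bar>Sv m v \<omega> - Iv \<omega>\<bar>)"
  define D3 where "D3 = (\<lambda>m \<omega>. \<integral>\<^sup>+s\<in>{0..u}. ennreal ((Pu m s \<omega> - H' s \<omega>)\<^sup>2) \<partial>lborel)"
  define D4 where "D4 = (\<lambda>m \<omega>. ennreal \<bar>Su m u \<omega> - Iu \<omega>\<bar>)"
  have [measurable]: "D1 m \<in> borel_measurable M" "D2 m \<in> borel_measurable M"
    "D3 m \<in> borel_measurable M" "D4 m \<in> borel_measurable M" for m
    unfolding D1_def D2_def D3_def D4_def by measurable
  have eq1: "(\<integral>\<^sup>+s\<in>{0..w}. ennreal ((f s - H s \<omega>)\<^sup>2) \<partial>lborel) = (\<integral>\<^sup>+s\<in>{0..w}. ennreal ((f s - H' s \<omega>)\<^sup>2) \<partial>lborel)" for w f \<omega>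
    by (intro nn_integral_cong) (auto simp: H'_def indicator_def max_def)
  have van: "vanishes_in_prob M D1" "vanishes_in_prob M D2" "vanishes_in_prob M D3" "vanishes_in_prob M D4"
    using v1 v2 u1 u2 unfolding D1_def D2_def D3_def D4_def Pv_def Pu_def Sv_def Su_def eq1 by auto
  define f where "f = (\<lambda>m \<omega>. min 1 (D1 m \<omega>) + min 1 (D2 m \<omega>) + min 1 (D3 m \<omega>) + min 1 (D4 m \<omega>))"
  have [measurable]: "f m \<in> borel_measurable M" for m unfolding f_def by measurable
  have "(\<lambda>m. (\<integral>\<^sup>+\<omega>. min 1 (D1 m \<omega>) \<partial>M) + (\<integral>\<^sup>+\<omega>. min 1 (D2 m \<omega>) \<partial>M)
      + (\<integral>\<^sup>+\<omega>. min 1 (D3 m \<omega>) \<partial>M) + (\<integral>\<^sup>+\<omega>. min 1 (D4 m \<omega>) \<partial>M)) \<longlonglongrightarrow> 0 + 0 + 0 + 0"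
    by (intro tendsto_add vanishes_in_prob_nn_integral van) auto
  then have fl: "(\<lambda>m. \<integral>\<^sup>+\<omega>. f m \<omega> \<partial>M) \<longlonglongrightarrow> 0"
    unfolding f_def by (simp add: nn_integral_add)
  have "(\<lambda>m. \<integral>\<^sup>+\<omega>. min 1 (f m \<omega>) \<partial>M) \<longlonglongrightarrow> 0"
    by (rule tendsto_sandwich[OF _ _ tendsto_const fl]) (auto intro!: nn_integral_mono always_eventually)
  then obtain r1 :: "nat \<Rightarrow> nat" where r1: "strict_mono r1" "AE \<omega> in M. (\<lambda>m. f (r1 m) \<omega>) \<longlonglongrightarrow> 0"
    using nn_integral_tendsto_0_AE_subseq[of f M] finite_measure_axioms by auto
  have min0: "g \<longlonglongrightarrow> 0" if "h \<longlonglongrightarrow> 0" "\<And>m. min 1 (g m) \<le> h m" for g h :: "nat \<Rightarrow> ennreal"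
  proof -
    have l: "(\<lambda>m. min 1 (g m)) \<longlonglongrightarrow> 0"
      by (rule tendsto_sandwich[OF _ _ tendsto_const that(1)]) (auto intro!: always_eventually that(2))
    have "eventually (\<lambda>m. min 1 (g m) < 1) sequentially" by (rule order_tendstoD(2)[OF l]) simp
    then have "eventually (\<lambda>m. min 1 (g m) = g m) sequentially"
      by eventually_elim (auto simp: min_def split: if_splits)
    then show ?thesis using l by (simp cong: tendsto_cong)
  qed
  have D: "AE \<omega> in M. (\<lambda>m. D1 (r1 m) \<omega>) \<longlonglongrightarrow> 0 \<and> (\<lambda>m. D2 (r1 m) \<omega>) \<longlonglongrightarrow> 0 \<and>
      (\<lambda>m. D3 (r1 m) \<omega>) \<longlonglongrightarrow> 0 \<and> (\<lambda>m. D4 (r1 m) \<omega>) \<longlonglongrightarrow> 0"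
    using r1(2)
  proof eventually_elim
    case (elim \<omega>)
    have le: "min 1 (D1 m \<omega>) \<le> f m \<omega>" "min 1 (D2 m \<omega>) \<le> f m \<omega>" "min 1 (D3 m \<omega>) \<le> f m \<omega>" "min 1 (D4 m \<omega>) \<le> f m \<omega>" for m
      unfolding f_def by (auto simp: add_increasing add_increasing2 add.assoc)
    show ?case by (intro conjI min0[OF elim] le)
  qed
  have pD: "ennreal (p m \<omega>) \<le> 2 * D1 m \<omega> + 2 * D3 m \<omega>" if "\<omega> \<in> space M" for m \<omega>
  proof -
    have [measurable]: "(\<lambda>s. Pv m s \<omega>) \<in> borel_measurable borel" "(\<lambda>s. Pu m s \<omega>) \<in> borel_measurable borel"
      "(\<lambda>s. H' s \<omega>) \<in> borel_measurable borel"
      using measurable_Pair2[OF Pvm that] measurable_Pair2[OF Pum that] measurable_Pair2[OF H'm that] by auto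
    have "ennreal (p m \<omega>) \<le> (\<integral>\<^sup>+s. 2 * (ennreal ((Pv m s \<omega> - H' s \<omega>)\<^sup>2) * indicator {0..v} s)
        + 2 * (ennreal ((Pu m s \<omega> - H' s \<omega>)\<^sup>2) * indicator {0..u} s) \<partial>lborel)"
      unfolding p
    proof (rule nn_integral_mono)
      fix s
      have "(a - b)\<^sup>2 \<le> 2 * (a - c)\<^sup>2 + 2 * (b - c)\<^sup>2" for a b c :: real
        using zero_le_power2[of "(a - c) + (b - c)"] by (simp add: power2_eq_square algebra_simps)
      then have "ennreal ((a - b)\<^sup>2) \<le> 2 * ennreal ((a - c)\<^sup>2) + 2 * ennreal ((b - c)\<^sup>2)" for a b c :: real
        using ennreal_leI[of "(a - b)\<^sup>2" "2 * (a - c)\<^sup>2 + 2 * (b - c)\<^sup>2"] by (simp add: ennreal_plus ennreal_mult)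
      then show "ennreal ((Pv m s \<omega> - Pu m s \<omega>)\<^sup>2) * indicator {0..u} s
        \<le> 2 * (ennreal ((Pv m s \<omega> - H' s \<omega>)\<^sup>2) * indicator {0..v} s)
        + 2 * (ennreal ((Pu m s \<omega> - H' s \<omega>)\<^sup>2) * indicator {0..u} s)"
        using uv by (auto simp: indicator_def)
    qed
    also have "\<dots> = 2 * D1 m \<omega> + 2 * D3 m \<omega>"
      unfolding D1_def D3_def by (simp add: nn_integral_add nn_integral_cmult)
    finally show ?thesis .
  qed
  have p0: "AE \<omega> in M. (\<lambda>m. p (r1 m) \<omega>) \<longlonglongrightarrow> 0"
    using D AE_space
  proof eventually_elim
    case (elim \<omega>)
    have \<omega>: "\<omega> \<in> space M" using elim by simp
    have "(\<lambda>m. 2 * D1 (r1 m) \<omega> + 2 * D3 (r1 m) \<omega>) \<longlonglongrightarrow> 2 * 0 + 2 * 0"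
      using elim by (intro tendsto_add ennreal_tendsto_cmult) auto
    then have l: "(\<lambda>m. 2 * D1 (r1 m) \<omega> + 2 * D3 (r1 m) \<omega>) \<longlonglongrightarrow> 0" by simp
    have "(\<lambda>m. ennreal (p (r1 m) \<omega>)) \<longlonglongrightarrow> 0"
      by (rule tendsto_sandwich[OF _ _ tendsto_const l]) (simp_all add: pD[OF \<omega>])
    then show ?case using adapted_sum_measurable(3)[OF p(1)] by (simp add: ennreal_tendsto_0_iff)
  qed
  have "(\<lambda>m. \<integral>\<^sup>+\<omega>. min 1 (ennreal \<bar>Sv (r1 m) u \<omega> - Su (r1 m) u \<omega>\<bar>) \<partial>M) \<longlonglongrightarrow> 0"
    by (rule adapted_sum_tendsto_0[of 0 "\<lambda>m \<omega>. Sv (r1 m) u \<omega> - Su (r1 m) u \<omega>" "\<lambda>m. p (r1 m)"]) (use p p0 in auto)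
  moreover have "(\<lambda>\<omega>. ennreal \<bar>Sv m u \<omega> - Su m u \<omega>\<bar>) \<in> borel_measurable M" for m
    using Svm[OF u, of m] Sum[OF u, of m] by measurable
  ultimately obtain r2 :: "nat \<Rightarrow> nat" where r2: "strict_mono r2"
    "AE \<omega> in M. (\<lambda>m. ennreal \<bar>Sv (r1 (r2 m)) u \<omega> - Su (r1 (r2 m)) u \<omega>\<bar>) \<longlonglongrightarrow> 0"
    using nn_integral_tendsto_0_AE_subseq[of "\<lambda>m \<omega>. ennreal \<bar>Sv (r1 m) u \<omega> - Su (r1 m) u \<omega>\<bar>" M]
      finite_measure_axioms by auto
  define r where "r = r1 \<circ> r2"
  show thesis
  proof (rule that[of "\<lambda>m \<omega>. Sv (r m) v \<omega> - Sv (r m) u \<omega>" "\<lambda>m. q (r m)"])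
    show "adapted_sum u (\<lambda>\<omega>. Sv (r m) v \<omega> - Sv (r m) u \<omega>) (q (r m))" for m by (rule q)
    show "AE \<omega> in M. (\<lambda>m. Sv (r m) v \<omega> - Sv (r m) u \<omega>) \<longlonglongrightarrow> (R v \<omega> - R u \<omega> - besq_dim * (v - u)) / 2"
      using D r2(2) Iv(2) Iu(2)
    proof eventually_elim
      case (elim \<omega>)
      have "(\<lambda>m. D2 (r m) \<omega>) \<longlonglongrightarrow> 0" "(\<lambda>m. D4 (r m) \<omega>) \<longlonglongrightarrow> 0"
        using elim r2(1) LIMSEQ_subseq_LIMSEQ[of "\<lambda>m. D2 (r1 m) \<omega>" 0 r2] LIMSEQ_subseq_LIMSEQ[of "\<lambda>m. D4 (r1 m) \<omega>" 0 r2]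
        by (auto simp: r_def o_def)
      then have "(\<lambda>m. Sv (r m) v \<omega> - Iv \<omega>) \<longlonglongrightarrow> 0" "(\<lambda>m. Su (r m) u \<omega> - Iu \<omega>) \<longlonglongrightarrow> 0"
        unfolding D2_def D4_def by (auto simp: ennreal_tendsto_0_iff tendsto_rabs_zero_iff)
      moreover have "(\<lambda>m. Sv (r m) u \<omega> - Su (r m) u \<omega>) \<longlonglongrightarrow> 0"
        using elim by (simp add: ennreal_tendsto_0_iff tendsto_rabs_zero_iff r_def)
      ultimately have "(\<lambda>m. (Sv (r m) v \<omega> - Iv \<omega>) - (Sv (r m) u \<omega> - Su (r m) u \<omega>) - (Su (r m) u \<omega> - Iu \<omega>) + (Iv \<omega> - Iu \<omega>))
        \<longlonglongrightarrow> 0 - 0 - 0 + (Iv \<omega> - Iu \<omega>)" by (intro tendsto_intros)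
      moreover have "(Sv (r m) v \<omega> - Iv \<omega>) - (Sv (r m) u \<omega> - Su (r m) u \<omega>) - (Su (r m) u \<omega> - Iu \<omega>) + (Iv \<omega> - Iu \<omega>)
        = Sv (r m) v \<omega> - Sv (r m) u \<omega>" for m by simp
      moreover have "0 - 0 - 0 + (Iv \<omega> - Iu \<omega>) = (R v \<omega> - R u \<omega> - besq_dim * (v - u)) / 2"
        using elim by (simp add: besq_dim_def field_simps)
      ultimately show ?case by (simp only:)
    qed
    show "AE \<omega> in M. (\<lambda>m. q (r m) \<omega>) \<longlonglongrightarrow> integral {u..v} (\<lambda>s. R s \<omega>)"
      using D AE_space
    proof eventually_elim
      case (elim \<omega>)
      then have \<omega>: "\<omega> \<in> space M" by simp
      have [measurable]: "(\<lambda>s. Pv m s \<omega>) \<in> borel_measurable borel" "(\<lambda>s. H' s \<omega>) \<in> borel_measurable borel" for m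
        using measurable_Pair2[OF Pvm \<omega>] measurable_Pair2[OF H'm \<omega>] by auto
      have sq: "ennreal ((indicator S s * y)\<^sup>2) = ennreal (y\<^sup>2) * indicator S s" for S :: "real set" and s y
        by (auto simp: indicator_def)
      show ?case
      proof (rule nn_integral_square_tendsto[where N = lborel and h = "\<lambda>m s. indicator {u..v} s * Pv (r m) s \<omega>"
            and g = "\<lambda>s. indicator {u..v} s * H' s \<omega>"])
        show "(\<integral>\<^sup>+s. ennreal ((indicator {u..v} s * Pv (r m) s \<omega>)\<^sup>2) \<partial>lborel) = ennreal (q (r m) \<omega>)" for m
          unfolding sq q ..
        show "0 \<le> q (r m) \<omega>" for m using adapted_sum_measurable(3)[OF q(1) u] .
        have "((\<lambda>s. R s \<omega>) has_integral integral {u..v} (\<lambda>s. R s \<omega>)) {u..v}"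
          by (intro integrable_integral integrable_continuous_real continuous_segment \<omega> u)
        then have "(\<integral>\<^sup>+s. ennreal (R s \<omega>) * indicator {u..v} s \<partial>lborel) = ennreal (integral {u..v} (\<lambda>s. R s \<omega>))"
          using u by (intro nn_integral_has_integral_lebesgue') (auto intro: nonneg[OF \<omega>])
        moreover have "ennreal ((indicator {u..v} s * H' s \<omega>)\<^sup>2) = ennreal (R s \<omega>) * indicator {u..v} s" for s
          unfolding sq using u nonneg[OF \<omega>, of s] by (auto simp: indicator_def H'_def H_def max_def)
        ultimately show "(\<integral>\<^sup>+s. ennreal ((indicator {u..v} s * H' s \<omega>)\<^sup>2) \<partial>lborel) = ennreal (integral {u..v} (\<lambda>s. R s \<omega>))"
          by simp
        show "0 \<le> integral {u..v} (\<lambda>s. R s \<omega>)" by (rule integral_nonneg_path[OF \<omega> u])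
        have "(\<lambda>m. D1 (r m) \<omega>) \<longlonglongrightarrow> 0"
          using elim r2(1) LIMSEQ_subseq_LIMSEQ[of "\<lambda>m. D1 (r1 m) \<omega>" 0 r2] by (auto simp: r_def o_def)
        then have l: "(\<lambda>m. D1 (r m) \<omega>) \<longlonglongrightarrow> 0" .
        have le: "(\<integral>\<^sup>+s. ennreal ((indicator {u..v} s * Pv (r m) s \<omega> - indicator {u..v} s * H' s \<omega>)\<^sup>2) \<partial>lborel) \<le> D1 (r m) \<omega>" for m
          unfolding D1_def using u by (intro nn_integral_mono) (auto simp: indicator_def)
        show "(\<lambda>m. \<integral>\<^sup>+s. ennreal ((indicator {u..v} s * Pv (r m) s \<omega> - indicator {u..v} s * H' s \<omega>)\<^sup>2) \<partial>lborel) \<longlonglongrightarrow> 0"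
          by (rule tendsto_sandwich[OF _ _ tendsto_const l]) (simp_all add: le)
      qed measurable
    qed
  qed
qed

lemma one_step_limit:
  assumes u: "0 \<le> u" and uv: "u \<le> v"
  obtains X q where "\<And>m. adapted_sum u (X m) (q m)"
    "AE \<omega> in M. (\<lambda>m. X m \<omega> - q m \<omega> / 2) \<longlonglongrightarrow> \<eta> * (R v \<omega> - R u \<omega> - besq_dim * (v - u)) - 2 * \<eta>\<^sup>2 * integral {u..v} (\<lambda>s. R s \<omega>)"
    "AE \<omega> in M. (\<lambda>m. q m \<omega>) \<longlonglongrightarrow> 4 * \<eta>\<^sup>2 * integral {u..v} (\<lambda>s. R s \<omega>)"
proof -
  obtain X q where as: "\<And>m. adapted_sum u (X m) (q m)"
    and X: "AE \<omega> in M. (\<lambda>m. X m \<omega>) \<longlonglongrightarrow> (R v \<omega> - R u \<omega> - besq_dim * (v - u)) / 2"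
    and q: "AE \<omega> in M. (\<lambda>m. q m \<omega>) \<longlonglongrightarrow> integral {u..v} (\<lambda>s. R s \<omega>)"
    by (rule window_approximation[OF u uv]) blast
  show thesis
  proof (rule that[OF adapted_sum_scale[OF as, of "2 * \<eta>"]])
    show "AE \<omega> in M. (\<lambda>m. 2 * \<eta> * X m \<omega> - (2 * \<eta>)\<^sup>2 * q m \<omega> / 2) \<longlonglongrightarrow> \<eta> * (R v \<omega> - R u \<omega> - besq_dim * (v - u)) - 2 * \<eta>\<^sup>2 * integral {u..v} (\<lambda>s. R s \<omega>)"
      using X q
    proof eventually_elim
      case (elim \<omega>)
      have "(\<lambda>m. 2 * \<eta> * X m \<omega> - (2 * \<eta>)\<^sup>2 * q m \<omega> / 2) \<longlonglongrightarrow>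
        2 * \<eta> * ((R v \<omega> - R u \<omega> - besq_dim * (v - u)) / 2) - (2 * \<eta>)\<^sup>2 * integral {u..v} (\<lambda>s. R s \<omega>) / 2"
        by (intro tendsto_intros elim) auto
      then show ?case by (simp add: power_mult_distrib mult.assoc)
    qed
    show "AE \<omega> in M. (\<lambda>m. (2 * \<eta>)\<^sup>2 * q m \<omega>) \<longlonglongrightarrow> 4 * \<eta>\<^sup>2 * integral {u..v} (\<lambda>s. R s \<omega>)"
      using q
    proof eventually_elim
      case (elim \<omega>)
      have "(\<lambda>m. (2 * \<eta>)\<^sup>2 * q m \<omega>) \<longlonglongrightarrow> (2 * \<eta>)\<^sup>2 * integral {u..v} (\<lambda>s. R s \<omega>)"
        by (intro tendsto_intros elim)
      then show ?case by (simp add: power_mult_distrib)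
    qed
  qed
qed

text \<open>The exponential of \<open>\<integral>H dB - \<integral>H\<^sup>2/2\<close> over \<open>[u,v]\<close> for \<open>H = 2 \<eta> sqrt R\<close>, with the stochastic integral expressed
through the increment of \<open>R\<close>.\<close>

definition exponential_factor :: "real \<Rightarrow> real \<Rightarrow> real \<Rightarrow> 'a \<Rightarrow> real" where
  "exponential_factor u v \<eta> \<omega> = exp (\<eta> * (R v \<omega> - R u \<omega> - besq_dim * (v - u)) - 2 * \<eta>\<^sup>2 * integral {u..v} (\<lambda>s. R s \<omega>))"

lemma exponential_factor_pos: "0 < exponential_factor u v \<eta> \<omega>"
  by (simp add: exponential_factor_def)

lemma exponential_factor_adapted:
  assumes "0 \<le> u" "u \<le> v"
  shows "exponential_factor u v \<eta> \<in> borel_measurable (F v)"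
proof -
  note [measurable] = integral_adapted[OF assms] adapted_mono[OF assms]
  have [measurable]: "R v \<in> borel_measurable (F v)" using assms by (intro adapted_mono) auto
  show ?thesis unfolding exponential_factor_def by measurable
qed

text \<open>Fatou's lemma applied to exponentials of mean one. Negative \<open>\<eta>\<close> will give Laplace transforms, positive \<open>\<eta>\<close>
exponential moments.\<close>

lemma one_step_upper:
  assumes u: "0 \<le> u" and uv: "u \<le> v" and Y: "Y \<in> borel_measurable (F u)" and Y0: "\<And>\<omega>. 0 \<le> Y \<omega>"
  shows "(\<integral>\<^sup>+\<omega>. ennreal (Y \<omega> * exponential_factor u v \<eta> \<omega>) \<partial>M) \<le> (\<integral>\<^sup>+\<omega>. ennreal (Y \<omega>) \<partial>M)"
proof -
  obtain X q where as: "\<And>m. adapted_sum u (X m) (q m)"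
    and lim: "AE \<omega> in M. (\<lambda>m. X m \<omega> - q m \<omega> / 2) \<longlonglongrightarrow> \<eta> * (R v \<omega> - R u \<omega> - besq_dim * (v - u)) - 2 * \<eta>\<^sup>2 * integral {u..v} (\<lambda>s. R s \<omega>)"
    by (rule one_step_limit[OF u uv]) blast
  note [measurable] = adapted_sum_measurable(1,2)[OF as u] measurable_F_M[OF Y u]
  have Z: "(\<integral>\<^sup>+\<omega>. ennreal (Y \<omega> * exp (X m \<omega> - q m \<omega> / 2)) \<partial>M) = (\<integral>\<^sup>+\<omega>. ennreal (Y \<omega>) \<partial>M)" for m
    using adapted_sum_exp[OF as u, of "\<lambda>\<omega>. ennreal (Y \<omega>)" m] Y Y0 by (simp add: ennreal_mult)
  have "(\<integral>\<^sup>+\<omega>. ennreal (Y \<omega> * exponential_factor u v \<eta> \<omega>) \<partial>M)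
    = (\<integral>\<^sup>+\<omega>. liminf (\<lambda>m. ennreal (Y \<omega> * exp (X m \<omega> - q m \<omega> / 2))) \<partial>M)"
  proof (rule nn_integral_cong_AE)
    show "AE \<omega> in M. ennreal (Y \<omega> * exponential_factor u v \<eta> \<omega>) = liminf (\<lambda>m. ennreal (Y \<omega> * exp (X m \<omega> - q m \<omega> / 2)))"
      using lim
    proof eventually_elim
      case (elim \<omega>)
      have "(\<lambda>m. ennreal (Y \<omega> * exp (X m \<omega> - q m \<omega> / 2))) \<longlonglongrightarrow> ennreal (Y \<omega> * exponential_factor u v \<eta> \<omega>)"
        unfolding exponential_factor_def by (intro tendsto_ennrealI tendsto_mult tendsto_const tendsto_exp[OF elim])
      then show ?case by (intro lim_imp_Liminf[symmetric]) auto
    qed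
  qed
  also have "\<dots> \<le> liminf (\<lambda>m. \<integral>\<^sup>+\<omega>. ennreal (Y \<omega> * exp (X m \<omega> - q m \<omega> / 2)) \<partial>M)"
    by (rule nn_integral_liminf) measurable
  also have "\<dots> = (\<integral>\<^sup>+\<omega>. ennreal (Y \<omega>) \<partial>M)" unfolding Z by (simp add: Liminf_const)
  finally show ?thesis .
qed

text \<open>The limit of the truncated inequality. The level \<open>L\<close> is free: it is chosen later as a power of the number
of grid steps, so that both error terms are small compared with the mesh.\<close>

lemma one_step_lower:
  assumes u: "0 \<le> u" and uv: "u \<le> v" and Y: "Y \<in> borel_measurable (F u)"
    and Y01: "\<And>\<omega>. 0 \<le> Y \<omega>" "\<And>\<omega>. Y \<omega> \<le> 1" and L: "0 < L"
  shows "(\<integral>\<^sup>+\<omega>. ennreal (Y \<omega>) \<partial>M) \<le> (\<integral>\<^sup>+\<omega>. ennreal (Y \<omega> * exponential_factor u v \<eta> \<omega>) \<partial>M)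
    + ennreal L * emeasure M {\<omega>\<in>space M. 1 / 2 < 4 * \<eta>\<^sup>2 * integral {u..v} (\<lambda>s. R s \<omega>)} + ennreal (exp 1 / L)"
proof -
  define J where "J = (\<lambda>\<omega>. 4 * \<eta>\<^sup>2 * integral {u..v} (\<lambda>s. R s \<omega>))"
  obtain X q where as: "\<And>m. adapted_sum u (X m) (q m)"
    and lim: "AE \<omega> in M. (\<lambda>m. X m \<omega> - q m \<omega> / 2) \<longlonglongrightarrow> \<eta> * (R v \<omega> - R u \<omega> - besq_dim * (v - u)) - 2 * \<eta>\<^sup>2 * integral {u..v} (\<lambda>s. R s \<omega>)"
    and limq: "AE \<omega> in M. (\<lambda>m. q m \<omega>) \<longlonglongrightarrow> J \<omega>"
    unfolding J_def by (rule one_step_limit[OF u uv]) blast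
  have v: "0 \<le> v" using u uv by simp
  note [measurable] = adapted_sum_measurable(1,2)[OF as u] measurable_F_M[OF Y u]
    measurable_F_M[OF integral_adapted[OF u uv] v] measurable_F_M[OF exponential_factor_adapted[OF u uv] v]
  have Jm [measurable]: "J \<in> borel_measurable M" unfolding J_def by measurable
  \<comment> \<open>A continuous function between the indicators of \<open>y > 1\<close> and \<open>y > 1/2\<close>, for which the limit may be taken inside.\<close>
  define \<phi> where "\<phi> = (\<lambda>y::real. max 0 (min 1 (2 * y - 1)))"
  have \<phi>: "0 \<le> \<phi> y" "\<phi> y \<le> 1" "1 < y \<Longrightarrow> \<phi> y = 1" "y \<le> 1 / 2 \<Longrightarrow> \<phi> y = 0" for y
    by (auto simp: \<phi>_def max_def min_def)
  have [measurable]: "\<phi> \<in> borel_measurable borel" unfolding \<phi>_def by measurable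
  define a where "a = (\<lambda>m. \<integral>\<^sup>+\<omega>. ennreal (min (Y \<omega> * exp (X m \<omega> - q m \<omega> / 2)) L) \<partial>M)"
  define b where "b = (\<lambda>m. \<integral>\<^sup>+\<omega>. ennreal (\<phi> (q m \<omega>)) \<partial>M)"
  have a: "a \<longlonglongrightarrow> (\<integral>\<^sup>+\<omega>. ennreal (min (Y \<omega> * exponential_factor u v \<eta> \<omega>) L) \<partial>M)"
    unfolding a_def
  proof (rule nn_integral_dominated_convergence[where w = "\<lambda>_. ennreal L"])
    show "AE \<omega> in M. (\<lambda>m. ennreal (min (Y \<omega> * exp (X m \<omega> - q m \<omega> / 2)) L)) \<longlonglongrightarrow> ennreal (min (Y \<omega> * exponential_factor u v \<eta> \<omega>) L)"
      using lim unfolding exponential_factor_def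
      by eventually_elim (intro tendsto_ennrealI tendsto_min tendsto_mult tendsto_const tendsto_exp)
  qed (auto intro!: ennreal_leI simp: emeasure_eq_measure ennreal_mult_less_top)
  have b: "b \<longlonglongrightarrow> (\<integral>\<^sup>+\<omega>. ennreal (\<phi> (J \<omega>)) \<partial>M)"
    unfolding b_def
  proof (rule nn_integral_dominated_convergence[where w = "\<lambda>_. 1"])
    show "AE \<omega> in M. (\<lambda>m. ennreal (\<phi> (q m \<omega>))) \<longlonglongrightarrow> ennreal (\<phi> (J \<omega>))"
      using limq unfolding \<phi>_def by eventually_elim (intro tendsto_ennrealI tendsto_intros)
    show "AE \<omega> in M. ennreal (\<phi> (q m \<omega>)) \<le> 1" for m
      using \<phi> ennreal_leI[of _ 1] by (intro AE_I2) auto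
  qed (auto simp: emeasure_eq_measure)
  have "(\<integral>\<^sup>+\<omega>. ennreal (Y \<omega>) \<partial>M) \<le> a m + ennreal L * b m + ennreal (exp 1 / L)" for m
  proof -
    have "emeasure M {\<omega>\<in>space M. 1 < q m \<omega>} = (\<integral>\<^sup>+\<omega>. indicator {\<omega>\<in>space M. 1 < q m \<omega>} \<omega> \<partial>M)" by simp
    also have "\<dots> \<le> b m" unfolding b_def using \<phi>(3) by (intro nn_integral_mono) (auto simp: indicator_def)
    finally have "emeasure M {\<omega>\<in>space M. 1 < q m \<omega>} \<le> b m" .
    then have "a m + ennreal L * emeasure M {\<omega>\<in>space M. 1 < q m \<omega>} + ennreal (exp 1 / L) \<le> a m + ennreal L * b m + ennreal (exp 1 / L)"
      by (intro add_mono mult_left_mono) auto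
    with adapted_sum_exp_truncated[OF as u Y Y01 L, of m] show ?thesis unfolding a_def by (rule order_trans)
  qed
  moreover have "(\<lambda>m. a m + ennreal L * b m + ennreal (exp 1 / L)) \<longlonglongrightarrow>
     (\<integral>\<^sup>+\<omega>. ennreal (min (Y \<omega> * exponential_factor u v \<eta> \<omega>) L) \<partial>M) + ennreal L * (\<integral>\<^sup>+\<omega>. ennreal (\<phi> (J \<omega>)) \<partial>M) + ennreal (exp 1 / L)"
    by (intro tendsto_add ennreal_tendsto_cmult a b tendsto_const) auto
  ultimately have "(\<integral>\<^sup>+\<omega>. ennreal (Y \<omega>) \<partial>M) \<le> (\<integral>\<^sup>+\<omega>. ennreal (min (Y \<omega> * exponential_factor u v \<eta> \<omega>) L) \<partial>M) + ennreal L * (\<integral>\<^sup>+\<omega>. ennreal (\<phi> (J \<omega>)) \<partial>M) + ennreal (exp 1 / L)"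
    by (intro LIMSEQ_le_const) auto
  also have "\<dots> \<le> (\<integral>\<^sup>+\<omega>. ennreal (Y \<omega> * exponential_factor u v \<eta> \<omega>) \<partial>M) + ennreal L * (\<integral>\<^sup>+\<omega>. indicator {\<omega>\<in>space M. 1 / 2 < J \<omega>} \<omega> \<partial>M) + ennreal (exp 1 / L)"
  proof (intro add_mono mult_left_mono nn_integral_mono order_refl)
    fix \<omega> assume "\<omega> \<in> space M"
    show "ennreal (min (Y \<omega> * exponential_factor u v \<eta> \<omega>) L) \<le> ennreal (Y \<omega> * exponential_factor u v \<eta> \<omega>)"
      by (intro ennreal_leI) auto
    show "ennreal (\<phi> (J \<omega>)) \<le> indicator {\<omega>\<in>space M. 1 / 2 < J \<omega>} \<omega>"
      using \<phi>(2,4)[of "J \<omega>"] \<open>\<omega> \<in> space M\<close> ennreal_leI[of "\<phi> (J \<omega>)" 1] by (auto simp: indicator_def)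
  qed auto
  also have "(\<integral>\<^sup>+\<omega>. indicator {\<omega>\<in>space M. 1 / 2 < J \<omega>} \<omega> \<partial>M) = emeasure M {\<omega>\<in>space M. 1 / 2 < J \<omega>}"
    by simp
  finally show ?thesis unfolding J_def .
qed

end

section \<open>Exponential tails of the running maximum\<close>

text \<open>Doob's argument by induction: the variable that equals the current value of the process where level \<open>a\<close>
has not yet been reached, and \<open>a\<close> elsewhere, has a mean that does not increase.\<close>

lemma (in prob_space) maximal_inequality:
  fixes V :: "nat \<Rightarrow> 'a \<Rightarrow> ennreal"
  assumes [measurable]: "\<And>i. V i \<in> borel_measurable M"
    and super: "\<And>i. i < n \<Longrightarrow> (\<integral>\<^sup>+\<omega>. indicator {\<omega>\<in>space M. \<forall>j\<le>i. V j \<omega> < a} \<omega> * V (Suc i) \<omega> \<partial>M)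
       \<le> (\<integral>\<^sup>+\<omega>. indicator {\<omega>\<in>space M. \<forall>j\<le>i. V j \<omega> < a} \<omega> * V i \<omega> \<partial>M)"
  shows "a * emeasure M {\<omega>\<in>space M. \<exists>j\<le>n. a \<le> V j \<omega>} \<le> (\<integral>\<^sup>+\<omega>. V 0 \<omega> \<partial>M)"
proof -
  define A where "A = (\<lambda>i. {\<omega>\<in>space M. \<forall>j\<le>i. V j \<omega> < a})"
  define A' where "A' = (\<lambda>i. {\<omega>\<in>space M. \<exists>j\<le>i. a \<le> V j \<omega>})"
  have [measurable]: "A i \<in> sets M" "A' i \<in> sets M" for i unfolding A_def A'_def by measurable
  have A_Suc: "\<omega> \<in> A (Suc i) \<longleftrightarrow> \<omega> \<in> A i \<and> V (Suc i) \<omega> < a" for i \<omega>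
    by (auto simp: A_def le_Suc_eq)
  have A'_iff: "\<omega> \<in> A' i \<longleftrightarrow> \<omega> \<notin> A i" if "\<omega> \<in> space M" for i \<omega>
    using that by (auto simp: A_def A'_def not_less)
  have "i \<le> n \<Longrightarrow> (\<integral>\<^sup>+\<omega>. indicator (A i) \<omega> * V i \<omega> + a * indicator (A' i) \<omega> \<partial>M) \<le> (\<integral>\<^sup>+\<omega>. V 0 \<omega> \<partial>M)" for i
  proof (induction i)
    case 0
    show ?case by (intro nn_integral_mono) (auto simp: A_def A'_def indicator_def)
  next
    case (Suc i)
    have "(\<integral>\<^sup>+\<omega>. indicator (A (Suc i)) \<omega> * V (Suc i) \<omega> + a * indicator (A' (Suc i)) \<omega> \<partial>M)
      \<le> (\<integral>\<^sup>+\<omega>. indicator (A i) \<omega> * V (Suc i) \<omega> + a * indicator (A' i) \<omega> \<partial>M)"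
      by (intro nn_integral_mono)
         (auto simp: A'_iff A_Suc indicator_def not_less)
    also have "\<dots> = (\<integral>\<^sup>+\<omega>. indicator (A i) \<omega> * V (Suc i) \<omega> \<partial>M) + (\<integral>\<^sup>+\<omega>. a * indicator (A' i) \<omega> \<partial>M)"
      by (rule nn_integral_add) auto
    also have "\<dots> \<le> (\<integral>\<^sup>+\<omega>. indicator (A i) \<omega> * V i \<omega> \<partial>M) + (\<integral>\<^sup>+\<omega>. a * indicator (A' i) \<omega> \<partial>M)"
      using super[of i] Suc.prems unfolding A_def by (intro add_right_mono) auto
    also have "\<dots> = (\<integral>\<^sup>+\<omega>. indicator (A i) \<omega> * V i \<omega> + a * indicator (A' i) \<omega> \<partial>M)"
      by (rule nn_integral_add[symmetric]) auto
    finally show ?case using Suc by auto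
  qed
  from this[of n] have "(\<integral>\<^sup>+\<omega>. indicator (A n) \<omega> * V n \<omega> + a * indicator (A' n) \<omega> \<partial>M) \<le> (\<integral>\<^sup>+\<omega>. V 0 \<omega> \<partial>M)" by simp
  moreover have "(\<integral>\<^sup>+\<omega>. a * indicator (A' n) \<omega> \<partial>M) \<le> (\<integral>\<^sup>+\<omega>. indicator (A n) \<omega> * V n \<omega> + a * indicator (A' n) \<omega> \<partial>M)"
    by (intro nn_integral_mono) simp
  ultimately show ?thesis by (simp add: nn_integral_cmult_indicator A'_def)
qed

context besq_process
begin

text \<open>The earlier factors are known at the start of the next step, so the one-step inequality can be applied
with their product as weight.\<close>

lemma exponential_factor_chain:
  assumes s: "0 \<le> s" and st: "s \<le> t" and Y: "Y \<in> borel_measurable (F s)" and Y0: "\<And>\<omega>. 0 \<le> Y \<omega>" and k: "k \<le> n"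
  shows "(\<integral>\<^sup>+\<omega>. ennreal (Y \<omega> * (\<Prod>i<k. exponential_factor (grid s t n i) (grid s t n (Suc i)) (\<eta> (grid s t n i)) \<omega>)) \<partial>M)
     \<le> (\<integral>\<^sup>+\<omega>. ennreal (Y \<omega>) \<partial>M)"
  using k
proof (induction k)
  case (Suc k)
  have b: "0 \<le> grid s t n i" if "i \<le> n" for i using grid_bounds[OF st that] s by simp
  have m: "grid s t n i \<le> grid s t n j" if "i \<le> j" for i j using grid_mono[OF st that] .
  define Y' where "Y' = (\<lambda>\<omega>. Y \<omega> * (\<Prod>i<k. exponential_factor (grid s t n i) (grid s t n (Suc i)) (\<eta> (grid s t n i)) \<omega>))"
  have "Y' \<in> borel_measurable (F (grid s t n k))"
    unfolding Y'_def
  proof (intro borel_measurable_times borel_measurable_prod)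
    show "Y \<in> borel_measurable (F (grid s t n k))" using m[of 0 k] by (intro measurable_F_mono[OF Y]) simp
    fix i assume i: "i \<in> {..<k}"
    show "exponential_factor (grid s t n i) (grid s t n (Suc i)) (\<eta> (grid s t n i)) \<in> borel_measurable (F (grid s t n k))"
      using i Suc.prems by (intro measurable_F_mono[OF exponential_factor_adapted] b m) auto
  qed
  moreover have "0 \<le> Y' \<omega>" for \<omega>
    unfolding Y'_def by (intro mult_nonneg_nonneg Y0 prod_nonneg) (simp add: exponential_factor_pos less_imp_le)
  ultimately have "(\<integral>\<^sup>+\<omega>. ennreal (Y' \<omega> * exponential_factor (grid s t n k) (grid s t n (Suc k)) (\<eta> (grid s t n k)) \<omega>) \<partial>M)
      \<le> (\<integral>\<^sup>+\<omega>. ennreal (Y' \<omega>) \<partial>M)"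
    using Suc.prems by (intro one_step_upper b m) auto
  also have "\<dots> \<le> (\<integral>\<^sup>+\<omega>. ennreal (Y \<omega>) \<partial>M)" using Suc unfolding Y'_def by simp
  finally show ?case by (simp add: Y'_def mult.assoc)
qed simp

text \<open>Summation by parts: if \<open>\<eta>\<close> satisfies the difference form of \<open>\<eta>' = -2\<eta>\<^sup>2\<close>, the product of the factors depends on
the path only through its end points and the Riccati errors.\<close>

lemma exponential_factor_prod:
  assumes n: "0 < n" and riccati: "\<And>i. i < n \<Longrightarrow> \<eta> (grid s t n (Suc i)) - \<eta> (grid s t n i) =
     - 2 * ((t - s) / real n) * \<eta> (grid s t n i) * \<eta> (grid s t n (Suc i))"
  shows "(\<Prod>i<n. exponential_factor (grid s t n i) (grid s t n (Suc i)) (\<eta> (grid s t n i)) \<omega>) =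
    exp (\<eta> t * R t \<omega> - \<eta> s * R s \<omega> - besq_dim * (\<Sum>i<n. \<eta> (grid s t n i) * ((t - s) / real n))
      + (\<Sum>i<n. riccati_error s t \<eta> (\<lambda>u. R u \<omega>) n i))"
proof -
  define h where "h = (t - s) / real n"
  define g where "g = grid s t n"
  have gS: "g (Suc i) - g i = h" for i by (simp add: g_def grid_Suc h_def)
  have "\<eta> (g i) * (R (g (Suc i)) \<omega> - R (g i) \<omega> - besq_dim * (g (Suc i) - g i))
      - 2 * (\<eta> (g i))\<^sup>2 * integral {g i..g (Suc i)} (\<lambda>s. R s \<omega>)
    = (\<eta> (g (Suc i)) * R (g (Suc i)) \<omega> - \<eta> (g i) * R (g i) \<omega>) - besq_dim * (\<eta> (g i) * h)
      + riccati_error s t \<eta> (\<lambda>u. R u \<omega>) n i" if "i < n" for i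
  proof -
    have "\<eta> (g (Suc i)) = \<eta> (g i) - 2 * h * \<eta> (g i) * \<eta> (g (Suc i))"
      using riccati[OF that] unfolding g_def[symmetric] h_def[symmetric] by simp
    then have e: "\<eta> (g (Suc i)) * R (g (Suc i)) \<omega> = \<eta> (g i) * R (g (Suc i)) \<omega> - 2 * h * \<eta> (g i) * \<eta> (g (Suc i)) * R (g (Suc i)) \<omega>"
      by (metis left_diff_distrib)
    have r: "riccati_error s t \<eta> (\<lambda>u. R u \<omega>) n i = 2 * h * \<eta> (g i) * \<eta> (g (Suc i)) * R (g (Suc i)) \<omega>
        - 2 * (\<eta> (g i))\<^sup>2 * integral {g i..g (Suc i)} (\<lambda>s. R s \<omega>)"
      by (simp add: riccati_error_def h_def g_def)
    show ?thesis unfolding r e gS by (simp add: algebra_simps)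
  qed
  then have "(\<Sum>i<n. \<eta> (g i) * (R (g (Suc i)) \<omega> - R (g i) \<omega> - besq_dim * (g (Suc i) - g i))
      - 2 * (\<eta> (g i))\<^sup>2 * integral {g i..g (Suc i)} (\<lambda>s. R s \<omega>))
    = (\<Sum>i<n. (\<eta> (g (Suc i)) * R (g (Suc i)) \<omega> - \<eta> (g i) * R (g i) \<omega>) - besq_dim * (\<eta> (g i) * h)
      + riccati_error s t \<eta> (\<lambda>u. R u \<omega>) n i)" by (intro sum.cong) auto
  also have "\<dots> = (\<Sum>i<n. \<eta> (g (Suc i)) * R (g (Suc i)) \<omega> - \<eta> (g i) * R (g i) \<omega>) - besq_dim * (\<Sum>i<n. \<eta> (g i) * h)
      + (\<Sum>i<n. riccati_error s t \<eta> (\<lambda>u. R u \<omega>) n i)"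
    by (simp add: sum.distrib sum_subtractf sum_distrib_left)
  also have "(\<Sum>i<n. \<eta> (g (Suc i)) * R (g (Suc i)) \<omega> - \<eta> (g i) * R (g i) \<omega>) = \<eta> t * R t \<omega> - \<eta> s * R s \<omega>"
    using sum_lessThan_telescope[of "\<lambda>i. \<eta> (g i) * R (g i) \<omega>" n] n by (simp add: g_def)
  finally show ?thesis
    unfolding exponential_factor_def g_def h_def by (simp add: exp_sum[symmetric])
qed

definition besq_exp :: "real \<Rightarrow> real \<Rightarrow> 'a \<Rightarrow> real" where
  "besq_exp T u \<omega> = exp (R u \<omega> / (2 * (T + u)) - besq_dim * u / (2 * T))"

text \<open>The mesh limit of the chained upper inequality for \<open>\<eta>(u) = 1/(2(T + u))\<close>. The drift \<open>\<delta> \<integral>\<eta>\<close> is replaced by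
the larger \<open>\<delta> (t - s) / (2T)\<close>, which keeps the formulas elementary.\<close>

lemma besq_exp_supermartingale:
  assumes s: "0 \<le> s" and st: "s \<le> t" and T: "0 < T" and Y: "Y \<in> borel_measurable (F s)" and Y0: "\<And>\<omega>. 0 \<le> Y \<omega>"
  shows "(\<integral>\<^sup>+\<omega>. ennreal (Y \<omega> * besq_exp T t \<omega>) \<partial>M) \<le> (\<integral>\<^sup>+\<omega>. ennreal (Y \<omega> * besq_exp T s \<omega>) \<partial>M)"
proof -
  define \<eta> where "\<eta> = (\<lambda>u. 1 / (2 * (T + u)))"
  have t: "0 \<le> t" using s st by simp
  note [measurable] = measurable_F_M[OF Y s] R_measurable[OF t] R_measurable[OF s]
  have Rs [measurable]: "R s \<in> borel_measurable (F s)" by (rule adapted[OF s])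
  define Y' where "Y' = (\<lambda>\<omega>. Y \<omega> * besq_exp T s \<omega>)"
  have Y': "Y' \<in> borel_measurable (F s)" "\<And>\<omega>. 0 \<le> Y' \<omega>"
    using Y Y0 unfolding Y'_def besq_exp_def by (auto simp: less_imp_le)
  define E where "E = (\<lambda>n \<omega>. \<Sum>i<n. riccati_error s t \<eta> (\<lambda>u. R u \<omega>) n i)"
  have E: "(\<lambda>n. E n \<omega>) \<longlonglongrightarrow> 0" if \<omega>: "\<omega> \<in> space M" for \<omega>
  proof (rule tendsto_rabs_zero_cancel, rule tendsto_sandwich[OF _ _ tendsto_const])
    show "(\<lambda>n. \<Sum>i<n. \<bar>riccati_error s t \<eta> (\<lambda>u. R u \<omega>) n i\<bar>) \<longlonglongrightarrow> 0"
      using s T by (intro riccati_error_tendsto_0 continuous_segment \<omega> st) (auto simp: \<eta>_def intro!: continuous_intros)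
  qed (auto simp: E_def sum_abs)
  define Z where "Z = (\<lambda>n \<omega>. Y \<omega> * exp (R t \<omega> / (2 * (T + t)) - besq_dim * t / (2 * T) + E n \<omega>))"
  have [measurable]: "E n \<in> borel_measurable M" for n
    unfolding E_def riccati_error_def
  proof (intro borel_measurable_sum borel_measurable_diff borel_measurable_times)
    fix i assume "i \<in> {..<n}"
    then have b: "0 \<le> grid s t n i" "grid s t n i \<le> grid s t n (Suc i)" "0 \<le> grid s t n (Suc i)"
      using grid_bounds[OF st, of i n] grid_bounds[OF st, of "Suc i" n] grid_mono[OF st, of i "Suc i" n] s by auto
    show "R (grid s t n (Suc i)) \<in> borel_measurable M" by (rule R_measurable[OF b(3)])
    show "(\<lambda>\<omega>. integral {grid s t n i..grid s t n (Suc i)} (\<lambda>u. R u \<omega>)) \<in> borel_measurable M"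
      by (rule measurable_F_M[OF integral_adapted[OF b(1,2)] b(3)])
  qed auto
  have [measurable]: "Z n \<in> borel_measurable M" for n unfolding Z_def by measurable
  have le: "(\<integral>\<^sup>+\<omega>. ennreal (Z n \<omega>) \<partial>M) \<le> (\<integral>\<^sup>+\<omega>. ennreal (Y' \<omega>) \<partial>M)" if n: "0 < n" for n
  proof -
    have riccati: "\<eta> (grid s t n (Suc i)) - \<eta> (grid s t n i) =
     - 2 * ((t - s) / real n) * \<eta> (grid s t n i) * \<eta> (grid s t n (Suc i))" if "i < n" for i
    proof -
      have "0 \<le> grid s t n i" "0 \<le> grid s t n (Suc i)"
        using grid_bounds[OF st, of i n] grid_bounds[OF st, of "Suc i" n] s that by auto
      then have p: "T + grid s t n i \<noteq> 0" "T + grid s t n (Suc i) \<noteq> 0" using T by auto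
      have h: "(t - s) / real n = grid s t n (Suc i) - grid s t n i" by (simp add: grid_Suc)
      show ?thesis unfolding h \<eta>_def using p by (simp add: divide_simps)
    qed
    have S: "(\<Sum>i<n. \<eta> (grid s t n i) * ((t - s) / real n)) \<le> (t - s) / (2 * T)"
    proof -
      have "(\<Sum>i<n. \<eta> (grid s t n i) * ((t - s) / real n)) \<le> (\<Sum>i<n. 1 / (2 * T) * ((t - s) / real n))"
      proof (intro sum_mono mult_right_mono)
        fix i assume "i \<in> {..<n}"
        then have "0 \<le> grid s t n i" using grid_bounds[OF st, of i n] s by auto
        then show "\<eta> (grid s t n i) \<le> 1 / (2 * T)" using T by (simp add: \<eta>_def frac_le)
      qed (use st in auto)
      also have "\<dots> = (t - s) / (2 * T)" using n by simp
      finally show ?thesis .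
    qed
    have "Z n \<omega> \<le> Y' \<omega> * (\<Prod>i<n. exponential_factor (grid s t n i) (grid s t n (Suc i)) (\<eta> (grid s t n i)) \<omega>)" for \<omega>
    proof -
      have "besq_dim * (\<Sum>i<n. \<eta> (grid s t n i) * ((t - s) / real n)) \<le> besq_dim * ((t - s) / (2 * T))"
        by (intro mult_left_mono S besq_dim_nonneg)
      also have "\<dots> = besq_dim * t / (2 * T) - besq_dim * s / (2 * T)" by (simp add: algebra_simps diff_divide_distrib)
      finally have "exp (R t \<omega> / (2 * (T + t)) - besq_dim * t / (2 * T) + E n \<omega>) \<le>
         exp ((R s \<omega> / (2 * (T + s)) - besq_dim * s / (2 * T)) + (\<eta> t * R t \<omega> - \<eta> s * R s \<omega>
           - besq_dim * (\<Sum>i<n. \<eta> (grid s t n i) * ((t - s) / real n)) + E n \<omega>))"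
        by (simp add: \<eta>_def)
      moreover have prod: "(\<Prod>i<n. exponential_factor (grid s t n i) (grid s t n (Suc i)) (\<eta> (grid s t n i)) \<omega>) =
          exp (\<eta> t * R t \<omega> - \<eta> s * R s \<omega> - besq_dim * (\<Sum>i<n. \<eta> (grid s t n i) * ((t - s) / real n)) + E n \<omega>)"
        unfolding E_def by (rule exponential_factor_prod[where \<eta> = \<eta> and s = s and t = t and \<omega> = \<omega>, OF n]) (rule riccati)
      ultimately show ?thesis
        unfolding prod Z_def Y'_def besq_exp_def mult.assoc mult_exp_exp
        by (intro mult_left_mono Y0)
    qed
    then have "(\<integral>\<^sup>+\<omega>. ennreal (Z n \<omega>) \<partial>M) \<le> (\<integral>\<^sup>+\<omega>. ennreal (Y' \<omega> * (\<Prod>i<n. exponential_factor (grid s t n i) (grid s t n (Suc i)) (\<eta> (grid s t n i)) \<omega>)) \<partial>M)"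
      by (intro nn_integral_mono ennreal_leI)
    also have "\<dots> \<le> (\<integral>\<^sup>+\<omega>. ennreal (Y' \<omega>) \<partial>M)"
      by (rule exponential_factor_chain[OF s st Y' order_refl])
    finally show ?thesis .
  qed
  have "(\<integral>\<^sup>+\<omega>. ennreal (Y \<omega> * besq_exp T t \<omega>) \<partial>M) = (\<integral>\<^sup>+\<omega>. liminf (\<lambda>n. ennreal (Z n \<omega>)) \<partial>M)"
  proof (rule nn_integral_cong)
    fix \<omega> assume \<omega>: "\<omega> \<in> space M"
    have "(\<lambda>n. R t \<omega> / (2 * (T + t)) - besq_dim * t / (2 * T) + E n \<omega>) \<longlonglongrightarrow> R t \<omega> / (2 * (T + t)) - besq_dim * t / (2 * T) + 0"
      by (intro tendsto_add tendsto_const E[OF \<omega>])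
    from tendsto_exp[OF this]
    have "(\<lambda>n. ennreal (Z n \<omega>)) \<longlonglongrightarrow> ennreal (Y \<omega> * besq_exp T t \<omega>)"
      unfolding Z_def besq_exp_def by (intro tendsto_ennrealI tendsto_mult tendsto_const) simp
    then show "ennreal (Y \<omega> * besq_exp T t \<omega>) = liminf (\<lambda>n. ennreal (Z n \<omega>))"
      by (intro lim_imp_Liminf[symmetric]) auto
  qed
  also have "\<dots> \<le> liminf (\<lambda>n. \<integral>\<^sup>+\<omega>. ennreal (Z n \<omega>) \<partial>M)"
    by (rule nn_integral_liminf) measurable
  also have "\<dots> \<le> liminf (\<lambda>n. \<integral>\<^sup>+\<omega>. ennreal (Y' \<omega>) \<partial>M)"
    by (intro Liminf_mono eventually_mono[OF eventually_gt_at_top[of 0]]) (rule le)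
  also have "\<dots> = (\<integral>\<^sup>+\<omega>. ennreal (Y' \<omega>) \<partial>M)" by (simp add: Liminf_const)
  finally show ?thesis unfolding Y'_def .
qed

definition exceed :: "real \<Rightarrow> real \<Rightarrow> 'a set" where
  "exceed T L = {\<omega>\<in>space M. \<exists>u\<in>{0..T}. L < R u \<omega>}"

text \<open>If \<open>R > L\<close> at a time in \<open>[0,T]\<close>, the exponential supermartingale exceeds \<open>exp(L/(4T) - \<delta>/2)\<close> there, while its
initial value is \<open>exp(x/(2T))\<close>.\<close>

lemma exceed_grid:
  assumes T: "0 < T" and L: "0 \<le> L" and n: "0 < n"
  shows "emeasure M {\<omega>\<in>space M. \<exists>i\<le>n. L < R (grid 0 T n i) \<omega>} \<le> ennreal (exp (besq_dim / 2 + x / (2 * T) - L / (4 * T)))"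
proof -
  have T0: "0 \<le> T" using T by simp
  have b: "0 \<le> grid 0 T n i \<and> grid 0 T n i \<le> T" if "i \<le> n" for i using grid_bounds[OF T0 that] .
  \<comment> \<open>The cut-off \<open>min i n\<close> makes all members of the sequence measurable.\<close>
  define V where "V = (\<lambda>i \<omega>. ennreal (besq_exp T (grid 0 T n (min i n)) \<omega>))"
  define a where "a = exp (L / (4 * T) - besq_dim / 2)"
  have Vad: "V i \<in> borel_measurable (F (grid 0 T n k))" if "i \<le> k" "k \<le> n" for i k
  proof -
    have [measurable]: "R (grid 0 T n (min i n)) \<in> borel_measurable (F (grid 0 T n k))"
      using that b[of "min i n"] by (intro adapted_mono grid_mono T0) auto
    show ?thesis unfolding V_def besq_exp_def by measurable
  qed
  have Vm [measurable]: "V i \<in> borel_measurable M" for i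
  proof -
    have [measurable]: "R (grid 0 T n (min i n)) \<in> borel_measurable M"
      using b[of "min i n"] by (intro R_measurable) auto
    show ?thesis unfolding V_def besq_exp_def by measurable
  qed
  have "a * emeasure M {\<omega>\<in>space M. \<exists>j\<le>n. ennreal a \<le> V j \<omega>} \<le> (\<integral>\<^sup>+\<omega>. V 0 \<omega> \<partial>M)"
  proof (rule maximal_inequality[OF Vm])
    fix i assume i: "i < n"
    define D where "D = {\<omega>\<in>space M. \<forall>j\<le>i. V j \<omega> < ennreal a}"
    have D: "D \<in> sets (F (grid 0 T n i))"
    proof -
      have Vj: "V j \<in> borel_measurable (F (grid 0 T n i))" if "j \<in> {..i}" for j using that i by (intro Vad) auto
      have "(\<Inter>j\<in>{..i}. {\<omega>\<in>space (F (grid 0 T n i)). V j \<omega> < ennreal a}) \<in> sets (F (grid 0 T n i))"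
        by (intro sets.finite_INT) (auto intro!: borel_measurable_less Vj)
      moreover have "(\<Inter>j\<in>{..i}. {\<omega>\<in>space (F (grid 0 T n i)). V j \<omega> < ennreal a}) = D"
        by (auto simp: D_def space_F)
      ultimately show ?thesis by simp
    qed
    have "(\<integral>\<^sup>+\<omega>. ennreal (indicator D \<omega> * besq_exp T (grid 0 T n (Suc i)) \<omega>) \<partial>M)
        \<le> (\<integral>\<^sup>+\<omega>. ennreal (indicator D \<omega> * besq_exp T (grid 0 T n i) \<omega>) \<partial>M)"
      using b[of i] i D by (intro besq_exp_supermartingale T grid_mono T0) auto
    moreover have "ennreal (indicator D \<omega> * besq_exp T (grid 0 T n k) \<omega>) = indicator D \<omega> * V k \<omega>" if "k \<le> n" for k \<omega>
      using that by (auto simp: V_def indicator_def min_absorb1)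
    ultimately show "(\<integral>\<^sup>+\<omega>. indicator {\<omega>\<in>space M. \<forall>j\<le>i. V j \<omega> < ennreal a} \<omega> * V (Suc i) \<omega> \<partial>M)
       \<le> (\<integral>\<^sup>+\<omega>. indicator {\<omega>\<in>space M. \<forall>j\<le>i. V j \<omega> < ennreal a} \<omega> * V i \<omega> \<partial>M)"
      using i by (simp add: D_def)
  qed
  also have "(\<integral>\<^sup>+\<omega>. V 0 \<omega> \<partial>M) = (\<integral>\<^sup>+\<omega>. ennreal (exp (x / (2 * T))) \<partial>M)"
  proof (rule nn_integral_cong_AE)
    show "AE \<omega> in M. V 0 \<omega> = ennreal (exp (x / (2 * T)))"
      using start by eventually_elim (simp add: V_def besq_exp_def)
  qed
  also have "\<dots> = ennreal (exp (x / (2 * T)))" by (simp add: emeasure_space_1)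
  finally have 1: "ennreal a * emeasure M {\<omega>\<in>space M. \<exists>j\<le>n. ennreal a \<le> V j \<omega>} \<le> ennreal (exp (x / (2 * T)))" .
  have sub: "{\<omega>\<in>space M. \<exists>i\<le>n. L < R (grid 0 T n i) \<omega>} \<subseteq> {\<omega>\<in>space M. \<exists>j\<le>n. ennreal a \<le> V j \<omega>}"
  proof safe
    fix \<omega> i assume \<omega>: "\<omega> \<in> space M" and i: "i \<le> n" and R: "L < R (grid 0 T n i) \<omega>"
    define u where "u = grid 0 T n i"
    have u: "0 \<le> u" "u \<le> T" using b[OF i] by (auto simp: u_def)
    have "L / (4 * T) \<le> R u \<omega> / (2 * (T + u))"
      using R u T L by (intro frac_le) (auto simp: u_def)
    moreover have "besq_dim * u / (2 * T) \<le> besq_dim / 2"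
    proof -
      have "besq_dim * u \<le> besq_dim * T" using u besq_dim_nonneg by (intro mult_left_mono) auto
      then show ?thesis using T by (simp add: field_simps)
    qed
    ultimately have "a \<le> besq_exp T u \<omega>" by (simp add: a_def besq_exp_def)
    then have "ennreal a \<le> V i \<omega>" using i by (simp add: V_def u_def min_absorb1 ennreal_leI)
    then show "\<exists>j\<le>n. ennreal a \<le> V j \<omega>" using i by blast
  qed
  have "emeasure M {\<omega>\<in>space M. \<exists>i\<le>n. L < R (grid 0 T n i) \<omega>} \<le> emeasure M {\<omega>\<in>space M. \<exists>j\<le>n. ennreal a \<le> V j \<omega>}"
    by (rule emeasure_mono[OF sub]) measurable
  also have "\<dots> = ennreal (1 / a) * (ennreal a * emeasure M {\<omega>\<in>space M. \<exists>j\<le>n. ennreal a \<le> V j \<omega>})"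
    by (simp add: mult.assoc[symmetric] ennreal_mult[symmetric] a_def)
  also have "\<dots> \<le> ennreal (1 / a) * ennreal (exp (x / (2 * T)))"
    using 1 by (rule mult_left_mono) simp
  also have "\<dots> = ennreal (exp (besq_dim / 2 + x / (2 * T) - L / (4 * T)))"
    by (simp add: ennreal_mult[symmetric] a_def exp_minus[symmetric] inverse_eq_divide[symmetric] mult_exp_exp)
  finally show ?thesis .
qed

end

context besq_process
begin

text \<open>The paths are continuous and the dyadic grids are dense; as these grids are nested, the union is
increasing, which makes it accessible to the bound on grids.\<close>

lemma exceed_dyadic:
  assumes T: "0 < T"
  shows "exceed T L = (\<Union>N. {\<omega>\<in>space M. \<exists>i\<le>2 ^ N. L < R (grid 0 T (2 ^ N) i) \<omega>})"
proof (intro equalityI subsetI)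
  fix \<omega> assume "\<omega> \<in> exceed T L"
  then obtain u where \<omega>: "\<omega> \<in> space M" and u: "0 \<le> u" "u \<le> T" and Lu: "L < R u \<omega>"
    by (auto simp: exceed_def)
  define k where "k = (\<lambda>N. nat \<lfloor>u * 2 ^ N / T\<rfloor>)"
  have k: "real (k N) \<le> u * 2 ^ N / T" "u * 2 ^ N / T - 1 \<le> real (k N)" for N
  proof -
    have "0 \<le> u * 2 ^ N / T" using u T by simp
    then have "real (k N) = of_int \<lfloor>u * 2 ^ N / T\<rfloor>" by (simp add: k_def)
    then show "real (k N) \<le> u * 2 ^ N / T" "u * 2 ^ N / T - 1 \<le> real (k N)"
      by linarith+
  qed
  have kN: "k N \<le> 2 ^ N" for N
  proof -
    have "u * 2 ^ N / T \<le> 2 ^ N" using u T by (simp add: field_simps)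
    with k(1)[of N] have "real (k N) \<le> 2 ^ N" by (rule order_trans)
    then show ?thesis using of_nat_le_iff[of "k N" "2 ^ N", where ?'a = real] by simp
  qed
  have g: "grid 0 T (2 ^ N) (k N) \<le> u" "u - T / 2 ^ N \<le> grid 0 T (2 ^ N) (k N)" for N
  proof -
    have "T * real (k N) / 2 ^ N \<le> T * (u * 2 ^ N / T) / 2 ^ N"
      using k(1)[of N] T by (intro divide_right_mono mult_left_mono) auto
    then show "grid 0 T (2 ^ N) (k N) \<le> u" using T by (simp add: grid_def)
    have "T * (u * 2 ^ N / T - 1) / 2 ^ N \<le> T * real (k N) / 2 ^ N"
      using k(2)[of N] T by (intro divide_right_mono mult_left_mono) auto
    then show "u - T / 2 ^ N \<le> grid 0 T (2 ^ N) (k N)" using T by (simp add: grid_def algebra_simps diff_divide_distrib)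
  qed
  have "(\<lambda>N. u - T / 2 ^ N) \<longlonglongrightarrow> u" by real_asymp
  then have lim: "(\<lambda>N. grid 0 T (2 ^ N) (k N)) \<longlonglongrightarrow> u"
    by (rule tendsto_sandwich[OF _ _ _ tendsto_const, rotated 2]) (auto intro!: always_eventually g)
  have "(\<lambda>N. R (grid 0 T (2 ^ N) (k N)) \<omega>) \<longlonglongrightarrow> R u \<omega>"
    using continuous_on_tendsto_compose[OF continuous[OF \<omega>] lim] u grid_bounds[of 0 T "k N" "2 ^ N" for N] kN T
    by (auto intro!: always_eventually)
  then have "eventually (\<lambda>N. L < R (grid 0 T (2 ^ N) (k N)) \<omega>) sequentially"
    using Lu by (intro order_tendstoD(1))
  then obtain N where "L < R (grid 0 T (2 ^ N) (k N)) \<omega>" by (auto simp: eventually_sequentially)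
  then show "\<omega> \<in> (\<Union>N. {\<omega>\<in>space M. \<exists>i\<le>2 ^ N. L < R (grid 0 T (2 ^ N) i) \<omega>})"
    using \<omega> kN by auto
next
  fix \<omega> assume "\<omega> \<in> (\<Union>N. {\<omega>\<in>space M. \<exists>i\<le>2 ^ N. L < R (grid 0 T (2 ^ N) i) \<omega>})"
  then obtain N i where "\<omega> \<in> space M" "i \<le> 2 ^ N" "L < R (grid 0 T (2 ^ N) i) \<omega>" by auto
  then show "\<omega> \<in> exceed T L"
    using grid_bounds[of 0 T i "2 ^ N"] T by (auto simp: exceed_def)
qed

lemma exceed_grid_sets:
  assumes "0 < T"
  shows "{\<omega>\<in>space M. \<exists>i\<le>n. L < R (grid 0 T n i) \<omega>} \<in> sets M"
proof -
  have R: "R (grid 0 T n i) \<in> borel_measurable M" if "i \<le> n" for i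
    using grid_bounds[of 0 T i n] that assms by (intro R_measurable) auto
  have e: "{\<omega>\<in>space M. \<exists>i\<le>n. L < R (grid 0 T n i) \<omega>} = (\<Union>i\<in>{..n}. {\<omega>\<in>space M. L < R (grid 0 T n i) \<omega>})"
    by auto
  show ?thesis
    unfolding e by (intro sets.finite_UN) (auto intro!: borel_measurable_less R)
qed

lemma exceed_sets:
  assumes T: "0 < T"
  shows "exceed T L \<in> sets M"
  unfolding exceed_dyadic[OF T] by (intro sets.countable_UN) (auto intro: exceed_grid_sets[OF T])

lemma exceed_tail:
  assumes T: "0 < T" and L: "0 \<le> L"
  shows "emeasure M (exceed T L) \<le> ennreal (exp (besq_dim / 2 + x / (2 * T) - L / (4 * T)))"
proof -
  have inc: "incseq (\<lambda>N. {\<omega>\<in>space M. \<exists>i\<le>2 ^ N. L < R (grid 0 T (2 ^ N) i) \<omega>})"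
  proof (rule incseq_SucI, safe)
    fix N \<omega> i assume i: "i \<le> 2 ^ N" and R: "L < R (grid 0 T (2 ^ N) i) \<omega>"
    have "grid 0 T (2 ^ N) i = grid 0 T (2 ^ Suc N) (2 * i)" by (simp add: grid_def)
    then show "\<exists>i\<le>2 ^ Suc N. L < R (grid 0 T (2 ^ Suc N) i) \<omega>" using i R by (intro exI[of _ "2 * i"]) auto
  qed
  have "range (\<lambda>N. {\<omega>\<in>space M. \<exists>i\<le>2 ^ N. L < R (grid 0 T (2 ^ N) i) \<omega>}) \<subseteq> sets M"
    by (rule image_subsetI) (rule exceed_grid_sets[OF T])
  from SUP_emeasure_incseq[OF this inc]
  have "emeasure M (exceed T L) = (SUP N. emeasure M {\<omega>\<in>space M. \<exists>i\<le>2 ^ N. L < R (grid 0 T (2 ^ N) i) \<omega>})"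
    unfolding exceed_dyadic[OF T] by (rule sym)
  also have "\<dots> \<le> ennreal (exp (besq_dim / 2 + x / (2 * T) - L / (4 * T)))"
    by (rule SUP_least) (rule exceed_grid[OF T L], simp)
  finally show ?thesis .
qed

definition running_max :: "real \<Rightarrow> 'a \<Rightarrow> real" where
  "running_max T \<omega> = (SUP u\<in>{0..T}. R u \<omega>)"

lemma running_max:
  assumes \<omega>: "\<omega> \<in> space M" and T: "0 < T"
  shows "u \<in> {0..T} \<Longrightarrow> R u \<omega> \<le> running_max T \<omega>"
    and "L < running_max T \<omega> \<longleftrightarrow> \<omega> \<in> exceed T L"
proof -
  have "compact ((\<lambda>u. R u \<omega>) ` {0..T})"
    by (intro compact_continuous_image continuous_segment \<omega>) auto
  then have bdd: "bdd_above ((\<lambda>u. R u \<omega>) ` {0..T})"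
    by (intro bounded_imp_bdd_above compact_imp_bounded)
  show "u \<in> {0..T} \<Longrightarrow> R u \<omega> \<le> running_max T \<omega>"
    unfolding running_max_def by (rule cSUP_upper[OF _ bdd])
  show "L < running_max T \<omega> \<longleftrightarrow> \<omega> \<in> exceed T L"
    unfolding running_max_def exceed_def using less_cSUP_iff[OF _ bdd, of L] T \<omega> by auto
qed

lemma running_max_measurable: "0 < T \<Longrightarrow> running_max T \<in> borel_measurable M"
proof (subst borel_measurable_iff_greater, intro allI)
  fix a assume T: "0 < T"
  have "{\<omega> \<in> space M. a < running_max T \<omega>} = exceed T a"
    using running_max(2)[OF _ T] by (auto simp: exceed_def)
  then show "{\<omega> \<in> space M. a < running_max T \<omega>} \<in> sets M" using exceed_sets[OF T] by simp
qed

text \<open>Needed as a dominating function; a variable is at most the number of nonnegative integers below it,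
whose mean is summed with the exponential tail.\<close>

lemma running_max_integrable:
  assumes T: "0 < T"
  shows "integrable M (running_max T)"
proof (rule integrableI_nonneg)
  show "running_max T \<in> borel_measurable M" by (rule running_max_measurable[OF T])
  show "AE \<omega> in M. 0 \<le> running_max T \<omega>"
    using running_max(1)[OF _ T, of _ 0] nonneg[of _ 0] T by (intro AE_I2) (force intro: order_trans)
  define C where "C = exp (besq_dim / 2 + x / (2 * T))"
  have "(\<integral>\<^sup>+\<omega>. ennreal (running_max T \<omega>) \<partial>M) \<le> (\<integral>\<^sup>+\<omega>. (\<Sum>n. indicator (exceed T (real n)) \<omega>) \<partial>M)"
  proof (rule nn_integral_mono)
    fix \<omega> assume \<omega>: "\<omega> \<in> space M"
    define N where "N = nat \<lceil>running_max T \<omega>\<rceil>"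
    have lt: "real n < running_max T \<omega>" if "n < N" for n using that unfolding N_def by linarith
    have "running_max T \<omega> \<le> real N" unfolding N_def by linarith
    then have "ennreal (running_max T \<omega>) \<le> ennreal (real N)" by (rule ennreal_leI)
    also have "\<dots> = (\<Sum>n<N. 1)" by (simp add: ennreal_of_nat_eq_real_of_nat)
    also have "\<dots> = (\<Sum>n<N. indicator (exceed T (real n)) \<omega>)"
      using lt running_max(2)[OF \<omega> T] by (intro sum.cong) auto
    also have "\<dots> \<le> (\<Sum>n. indicator (exceed T (real n)) \<omega>)"
      by (intro sum_le_suminf) auto
    finally show "ennreal (running_max T \<omega>) \<le> (\<Sum>n. indicator (exceed T (real n)) \<omega>)" .
  qed
  also have "\<dots> = (\<Sum>n. emeasure M (exceed T (real n)))"
    using exceed_sets[OF T] by (subst nn_integral_suminf) auto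
  also have "\<dots> \<le> (\<Sum>n. ennreal (C * exp (- 1 / (4 * T)) ^ n))"
  proof (intro suminf_le allI)
    fix n
    have "emeasure M (exceed T (real n)) \<le> ennreal (exp (besq_dim / 2 + x / (2 * T) - real n / (4 * T)))"
      by (rule exceed_tail[OF T]) simp
    also have "exp (besq_dim / 2 + x / (2 * T) - real n / (4 * T)) = C * exp (- 1 / (4 * T)) ^ n"
      by (simp add: C_def exp_of_nat_mult[symmetric] mult_exp_exp)
    finally show "emeasure M (exceed T (real n)) \<le> ennreal (C * exp (- 1 / (4 * T)) ^ n)" .
  qed auto
  also have "\<dots> = ennreal (\<Sum>n. C * exp (- 1 / (4 * T)) ^ n)"
    using T by (intro suminf_ennreal2) (auto simp: C_def intro!: summable_mult summable_geometric)
  also have "\<dots> < \<infinity>" by simp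
  finally show "(\<integral>\<^sup>+\<omega>. ennreal (running_max T \<omega>) \<partial>M) < \<infinity>" .
qed

end

section \<open>The conditional Laplace transform\<close>

text \<open>Errors of the single steps add up without amplification, because each step contracts.\<close>

lemma telescoping_decay:
  fixes g c e :: "nat \<Rightarrow> real"
  assumes c: "\<And>i. i < n \<Longrightarrow> 0 \<le> c i" and step: "\<And>i. i < n \<Longrightarrow> \<bar>g (Suc i) - exp (- c i) * g i\<bar> \<le> e i"
  shows "\<bar>g n - exp (- (\<Sum>i<n. c i)) * g 0\<bar> \<le> (\<Sum>i<n. e i)"
  using assms
proof (induction n)
  case (Suc n)
  have IH: "\<bar>g n - exp (- (\<Sum>i<n. c i)) * g 0\<bar> \<le> (\<Sum>i<n. e i)" using Suc by simp
  have "g (Suc n) - exp (- (\<Sum>i<Suc n. c i)) * g 0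
     = (g (Suc n) - exp (- c n) * g n) + exp (- c n) * (g n - exp (- (\<Sum>i<n. c i)) * g 0)"
    by (simp add: exp_add exp_diff exp_minus field_simps)
  then have "\<bar>g (Suc n) - exp (- (\<Sum>i<Suc n. c i)) * g 0\<bar>
     \<le> \<bar>g (Suc n) - exp (- c n) * g n\<bar> + \<bar>exp (- c n) * (g n - exp (- (\<Sum>i<n. c i)) * g 0)\<bar>" by simp
  also have "\<bar>exp (- c n) * (g n - exp (- (\<Sum>i<n. c i)) * g 0)\<bar> \<le> 1 * (\<Sum>i<n. e i)"
    unfolding abs_mult using IH Suc.prems(1)[of n] by (intro mult_mono) auto
  finally show ?case using Suc.prems(2)[of n] by simp
qed simp

lemma exp_minus_abs_diff:
  fixes a b :: real
  assumes "0 \<le> a" "0 \<le> b"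
  shows "\<bar>exp (- a) - exp (- b)\<bar> \<le> \<bar>a - b\<bar>"
proof -
  have *: "\<bar>exp (- a) - exp (- b)\<bar> \<le> \<bar>a - b\<bar>" if "0 \<le> a" "a \<le> b" for a b :: real
  proof -
    have "exp (- a) * (1 - exp (- (b - a))) \<le> 1 * (b - a)"
    proof (rule mult_mono)
      show "1 - exp (- (b - a)) \<le> b - a" using exp_ge_add_one_self[of "- (b - a)"] by linarith
    qed (use that in auto)
    moreover have "exp (- a) * (1 - exp (- (b - a))) = exp (- a) - exp (- b)"
      by (simp add: algebra_simps mult_exp_exp)
    ultimately show ?thesis using that by simp
  qed
  show ?thesis using *[of a b] *[of b a] assms by (cases "a \<le> b") (auto simp: abs_minus_commute)
qed

context besq_process
begin

lemma laplace_integrable: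
  fixes Y Z :: "'a \<Rightarrow> real"
  assumes [measurable]: "Y \<in> borel_measurable M" "Z \<in> borel_measurable M"
    and "\<And>\<omega>. 0 \<le> Y \<omega>" "\<And>\<omega>. Y \<omega> \<le> 1" and "\<And>\<omega>. \<omega> \<in> space M \<Longrightarrow> 0 \<le> Z \<omega>"
  shows "integrable M (\<lambda>\<omega>. Y \<omega> * exp (- Z \<omega>))"
proof (rule integrable_const_bound[where B = 1])
  show "AE \<omega> in M. norm (Y \<omega> * exp (- Z \<omega>)) \<le> 1"
  proof (rule AE_I2)
    fix \<omega> assume "\<omega> \<in> space M"
    then have "Y \<omega> * exp (- Z \<omega>) \<le> 1" "0 \<le> Y \<omega> * exp (- Z \<omega>)"
      using assms(3-5)[of \<omega>] by (auto intro!: mult_le_one)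
    then show "norm (Y \<omega> * exp (- Z \<omega>)) \<le> 1" by simp
  qed
qed measurable

text \<open>The two one-step inequalities with \<open>\<eta> = -\<theta>\<close> and the weight \<open>Y exp(-\<theta> R\<^sub>u)\<close>, which lies in \<open>[0,1]\<close>. The
quantity \<open>K\<close> still contains the potential \<open>2\<theta>\<^sup>2 \<integral>R\<close>; the change of \<open>\<theta>\<close> from \<open>u\<close> to \<open>v\<close> removes it.\<close>

lemma laplace_step:
  assumes u: "0 \<le> u" and uv: "u \<le> v" and Y: "Y \<in> borel_measurable (F u)"
    and Y01: "\<And>\<omega>. 0 \<le> Y \<omega>" "\<And>\<omega>. Y \<omega> \<le> 1" and L: "0 < L" and \<theta>: "0 \<le> \<theta>"
  defines "J \<equiv> (\<lambda>\<omega>. integral {u..v} (\<lambda>s. R s \<omega>))"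
  defines "K \<equiv> (\<integral>\<omega>. Y \<omega> * exp (- (\<theta> * R v \<omega> + 2 * \<theta>\<^sup>2 * J \<omega>)) \<partial>M)"
  defines "g \<equiv> (\<integral>\<omega>. Y \<omega> * exp (- (\<theta> * R u \<omega>)) \<partial>M)"
  shows "\<bar>K - exp (- (besq_dim * (\<theta> * (v - u)))) * g\<bar> \<le> L * measure M {\<omega>\<in>space M. 1 / 2 < 4 * \<theta>\<^sup>2 * J \<omega>} + exp 1 / L"
proof -
  define d where "d = besq_dim * (\<theta> * (v - u))"
  have d: "0 \<le> d" using \<theta> uv besq_dim_nonneg by (simp add: d_def)
  have v: "0 \<le> v" using u uv by simp
  have [measurable]: "Y \<in> borel_measurable M" "R u \<in> borel_measurable M" "R v \<in> borel_measurable M" "J \<in> borel_measurable M"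
    using measurable_F_M[OF Y u] R_measurable u v measurable_F_M[OF integral_adapted[OF u uv] v] by (auto simp: J_def)
  have J0: "0 \<le> J \<omega>" if "\<omega> \<in> space M" for \<omega> unfolding J_def by (rule integral_nonneg_path[OF that u])
  \<comment> \<open>The maximum with \<open>0\<close> bounds the weight by \<open>1\<close> also outside the underlying space, where nothing is known about \<open>R\<close>.\<close>
  define Y' where "Y' = (\<lambda>\<omega>. Y \<omega> * exp (- (\<theta> * max 0 (R u \<omega>))))"
  have Ru: "R u \<in> borel_measurable (F u)" by (rule adapted[OF u])
  have Y'm: "Y' \<in> borel_measurable (F u)" using Y Ru unfolding Y'_def by measurable
  have Y'01: "0 \<le> Y' \<omega>" "Y' \<omega> \<le> 1" for \<omega>
    using Y01[of \<omega>] \<theta> by (auto simp: Y'_def intro!: mult_le_one)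
  have Y': "Y' \<omega> = Y \<omega> * exp (- (\<theta> * R u \<omega>))" if "\<omega> \<in> space M" for \<omega>
    using nonneg[OF that u] by (simp add: Y'_def)
  have EF: "Y' \<omega> * exponential_factor u v (- \<theta>) \<omega> = exp d * (Y \<omega> * exp (- (\<theta> * R v \<omega> + 2 * \<theta>\<^sup>2 * J \<omega>)))"
    if "\<omega> \<in> space M" for \<omega>
    unfolding Y'[OF that] exponential_factor_def d_def
    by (simp add: J_def mult_exp_exp algebra_simps)
  have iK: "integrable M (\<lambda>\<omega>. Y \<omega> * exp (- (\<theta> * R v \<omega> + 2 * \<theta>\<^sup>2 * J \<omega>)))"
    using Y01 \<theta> nonneg[OF _ v] J0 by (intro laplace_integrable) auto
  have ig: "integrable M (\<lambda>\<omega>. Y \<omega> * exp (- (\<theta> * R u \<omega>)))"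
    using Y01 \<theta> nonneg[OF _ u] by (intro laplace_integrable) auto
  have K0: "0 \<le> K" unfolding K_def using Y01 by (intro integral_nonneg_AE) auto
  have g0: "0 \<le> g" unfolding g_def using Y01 by (intro integral_nonneg_AE) auto
  have nnK: "(\<integral>\<^sup>+\<omega>. ennreal (Y' \<omega> * exponential_factor u v (- \<theta>) \<omega>) \<partial>M) = ennreal (exp d * K)"
  proof -
    have "(\<integral>\<^sup>+\<omega>. ennreal (Y' \<omega> * exponential_factor u v (- \<theta>) \<omega>) \<partial>M)
       = (\<integral>\<^sup>+\<omega>. ennreal (exp d * (Y \<omega> * exp (- (\<theta> * R v \<omega> + 2 * \<theta>\<^sup>2 * J \<omega>)))) \<partial>M)"
      by (intro nn_integral_cong) (simp add: EF)
    also have "\<dots> = ennreal (\<integral>\<omega>. exp d * (Y \<omega> * exp (- (\<theta> * R v \<omega> + 2 * \<theta>\<^sup>2 * J \<omega>))) \<partial>M)"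
      using iK Y01 by (intro nn_integral_eq_integral) auto
    finally show ?thesis by (simp add: K_def)
  qed
  have nng: "(\<integral>\<^sup>+\<omega>. ennreal (Y' \<omega>) \<partial>M) = ennreal g"
  proof -
    have "(\<integral>\<^sup>+\<omega>. ennreal (Y' \<omega>) \<partial>M) = (\<integral>\<^sup>+\<omega>. ennreal (Y \<omega> * exp (- (\<theta> * R u \<omega>))) \<partial>M)"
      by (intro nn_integral_cong) (simp add: Y')
    also have "\<dots> = ennreal g" unfolding g_def using ig Y01 by (intro nn_integral_eq_integral) auto
    finally show ?thesis .
  qed
  define P where "P = measure M {\<omega>\<in>space M. 1 / 2 < 4 * \<theta>\<^sup>2 * J \<omega>}"
  have "ennreal (exp d * K) \<le> ennreal g"
    using one_step_upper[OF u uv Y'm Y'01(1), of "- \<theta>"] unfolding nnK nng .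
  then have up: "exp d * K \<le> g" using g0 by (subst (asm) ennreal_le_iff) auto
  have "ennreal g \<le> ennreal (exp d * K) + ennreal L * ennreal P + ennreal (exp 1 / L)"
    using one_step_lower[OF u uv Y'm Y'01 L, of "- \<theta>"]
    unfolding nnK nng P_def by (simp add: emeasure_eq_measure J_def)
  also have "\<dots> = ennreal (exp d * K + L * P + exp 1 / L)"
    using K0 L by (simp add: ennreal_plus ennreal_mult P_def)
  finally have low: "g \<le> exp d * K + (L * P + exp 1 / L)"
    using K0 L by (subst (asm) ennreal_le_iff) (auto simp: P_def)
  have ed: "exp (- d) * exp d = 1" by (simp add: mult_exp_exp)
  have "exp (- d) * (exp d * K) \<le> exp (- d) * g" using up by (intro mult_left_mono) auto
  then have 1: "K \<le> exp (- d) * g" unfolding mult.assoc[symmetric] ed by simp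
  have "exp (- d) * g \<le> exp (- d) * (exp d * K + (L * P + exp 1 / L))" using low by (intro mult_left_mono) auto
  also have "\<dots> = K + exp (- d) * (L * P + exp 1 / L)"
    unfolding distrib_left mult.assoc[symmetric] ed by simp
  also have "exp (- d) * (L * P + exp 1 / L) \<le> 1 * (L * P + exp 1 / L)"
    using d L by (intro mult_right_mono) (auto simp: P_def intro!: add_nonneg_nonneg)
  finally have 2: "exp (- d) * g \<le> K + (L * P + exp 1 / L)" by simp
  have "0 \<le> L * P + exp 1 / L" using L by (auto simp: P_def intro!: add_nonneg_nonneg)
  then show ?thesis using 1 2 unfolding d_def[symmetric] P_def[symmetric] by (simp add: abs_le_iff)
qed

text \<open>Along a grid from \<open>s\<close> to \<open>t\<close> the exponent is adjusted by the solution \<open>\<theta>(u) = \<rho>/(1 + 2\<rho>(t - u))\<close> of the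
Riccati equation with \<open>\<theta>(t) = \<rho>\<close>. In each step \<open>E[Y exp(-\<theta>(u) R\<^sub>u)]\<close> is multiplied by \<open>exp(-\<delta> \<theta>(u) h)\<close>, up to
the Riccati error and the error of the one-step inequality. The former tend to zero in mean by
dominated convergence with the running maximum, and the products of the factors tend to
\<open>exp(-\<delta> \<integral>\<theta>)\<close>.\<close>

lemma laplace_transition_pos:
  assumes s: "0 \<le> s" and st: "s < t" and Y: "Y \<in> borel_measurable (F s)"
    and Y01: "\<And>\<omega>. 0 \<le> Y \<omega>" "\<And>\<omega>. Y \<omega> \<le> 1" and \<rho>: "0 < \<rho>"
  shows "(\<integral>\<omega>. Y \<omega> * exp (- (\<rho> * R t \<omega>)) \<partial>M) =
    (1 + 2 * \<rho> * (t - s)) powr (- (\<mu> + 1)) * (\<integral>\<omega>. Y \<omega> * exp (- (\<rho> / (1 + 2 * \<rho> * (t - s)) * R s \<omega>)) \<partial>M)"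
proof -
  have t: "0 < t" "0 \<le> t" and st': "s \<le> t" using s st by auto
  define \<theta> where "\<theta> = (\<lambda>u. \<rho> / (1 + 2 * \<rho> * (t - u)))"
  have den: "1 \<le> 1 + 2 * \<rho> * (t - u)" if "u \<le> t" for u using that \<rho> by simp
  have \<theta>0: "0 \<le> \<theta> u" "\<theta> u \<le> \<rho>" if "u \<le> t" for u
  proof -
    show "0 \<le> \<theta> u" using den[OF that] \<rho> by (simp add: \<theta>_def)
    have "\<rho> / (1 + 2 * \<rho> * (t - u)) \<le> \<rho> / 1" using den[OF that] \<rho> by (intro divide_left_mono) auto
    then show "\<theta> u \<le> \<rho>" by (simp add: \<theta>_def)
  qed
  have cont\<theta>: "continuous_on {s..t} \<theta>"
    unfolding \<theta>_def
  proof (intro continuous_intros ballI)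
    fix u assume "u \<in> {s..t}"
    then show "1 + 2 * \<rho> * (t - u) \<noteq> 0" using den[of u] by auto
  qed
  define C where "C = exp (besq_dim / 2 + x / (2 * t))"
  \<comment> \<open>On a cell of length \<open>(t - s)/n\<close>, \<open>4\<theta>\<^sup>2 \<integral>R > 1/2\<close> forces the running maximum above \<open>\<kappa> n\<close>, which has probability
at most \<open>C exp(-\<kappa> n/(4t))\<close>. With \<open>L = n\<^sup>2\<close> the errors of all \<open>n\<close> steps add up to \<open>\<epsilon> n\<close>.\<close>
  define \<kappa> where "\<kappa> = 1 / (8 * \<rho>\<^sup>2 * (t - s))"
  have \<kappa>: "0 < \<kappa>" using \<rho> st by (simp add: \<kappa>_def)
  define W where "W = (\<lambda>n \<omega>. \<Sum>i<n. \<bar>riccati_error s t (\<lambda>u. - \<theta> u) (\<lambda>u. R u \<omega>) n i\<bar>)"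
  define \<epsilon> where "\<epsilon> = (\<lambda>n. real n * (real n ^ 2 * (C * exp (- (\<kappa> * real n) / (4 * t))) + exp 1 / real n ^ 2))"
  define g where "g = (\<lambda>u. \<integral>\<omega>. Y \<omega> * exp (- (\<theta> u * R u \<omega>)) \<partial>M)"
  have errm: "(\<lambda>\<omega>. riccati_error s t (\<lambda>u. - \<theta> u) (\<lambda>u. R u \<omega>) n i) \<in> borel_measurable M" if "i < n" for n i
    unfolding riccati_error_def
  proof (intro borel_measurable_diff borel_measurable_times)
    have b: "0 \<le> grid s t n i" "grid s t n i \<le> grid s t n (Suc i)" "0 \<le> grid s t n (Suc i)"
      using grid_bounds[OF st', of i n] grid_bounds[OF st', of "Suc i" n] grid_mono[OF st', of i "Suc i" n] s that by auto
    show "R (grid s t n (Suc i)) \<in> borel_measurable M" by (rule R_measurable[OF b(3)])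
    show "(\<lambda>\<omega>. integral {grid s t n i..grid s t n (Suc i)} (\<lambda>u. R u \<omega>)) \<in> borel_measurable M"
      by (rule measurable_F_M[OF integral_adapted[OF b(1,2)] b(3)])
  qed auto
  have Wm: "W n \<in> borel_measurable M" for n
    unfolding W_def by (intro borel_measurable_sum borel_measurable_abs errm) auto
  define D where "D = 4 * \<rho>\<^sup>2 * (t - s)"
  have rm0: "0 \<le> running_max t \<omega>" if "\<omega> \<in> space M" for \<omega>
    using running_max(1)[OF that t(1), of 0] nonneg[OF that order_refl] t by auto
  have err_le: "\<bar>riccati_error s t (\<lambda>u. - \<theta> u) (\<lambda>u. R u \<omega>) n i\<bar> \<le> 4 * \<rho>\<^sup>2 * running_max t \<omega> * ((t - s) / real n)"
    if \<omega>: "\<omega> \<in> space M" and i: "i < n" for \<omega> n i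
  proof (rule riccati_error_bound[OF continuous_segment[OF \<omega> s] st' i])
    show "\<bar>- \<theta> w\<bar> \<le> \<rho>" if "w \<in> {s..t}" for w using \<theta>0[of w] that by auto
    show "0 \<le> R w \<omega> \<and> R w \<omega> \<le> running_max t \<omega>" if w: "w \<in> {s..t}" for w
      using w s running_max(1)[OF \<omega> t(1), of w] nonneg[OF \<omega>, of w] by auto
  qed
  have W_le: "W n \<omega> \<le> D * running_max t \<omega>" if "\<omega> \<in> space M" for n \<omega>
  proof -
    have "W n \<omega> \<le> (\<Sum>i<n. 4 * \<rho>\<^sup>2 * running_max t \<omega> * ((t - s) / real n))"
      unfolding W_def using err_le[OF that] by (intro sum_mono) auto
    also have "\<dots> \<le> D * running_max t \<omega>" using rm0[OF that] st by (cases "n = 0") (auto simp: D_def)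
    finally show ?thesis .
  qed
  have int_dom: "integrable M (\<lambda>\<omega>. D * running_max t \<omega>)"
    using running_max_integrable[OF t(1)] by simp
  have err_int: "integrable M (\<lambda>\<omega>. \<bar>riccati_error s t (\<lambda>u. - \<theta> u) (\<lambda>u. R u \<omega>) n i\<bar>)" if "i < n" for n i
  proof (rule Bochner_Integration.integrable_bound[of M "\<lambda>\<omega>. 4 * \<rho>\<^sup>2 * ((t - s) / real n) * running_max t \<omega>"])
    show "integrable M (\<lambda>\<omega>. 4 * \<rho>\<^sup>2 * ((t - s) / real n) * running_max t \<omega>)"
      using running_max_integrable[OF t(1)] by simp
    show "(\<lambda>\<omega>. \<bar>riccati_error s t (\<lambda>u. - \<theta> u) (\<lambda>u. R u \<omega>) n i\<bar>) \<in> borel_measurable M"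
      using errm[OF that] by measurable
    show "AE \<omega> in M. norm \<bar>riccati_error s t (\<lambda>u. - \<theta> u) (\<lambda>u. R u \<omega>) n i\<bar> \<le> norm (4 * \<rho>\<^sup>2 * ((t - s) / real n) * running_max t \<omega>)"
    proof (rule AE_I2)
      fix \<omega> assume \<omega>: "\<omega> \<in> space M"
      show "norm \<bar>riccati_error s t (\<lambda>u. - \<theta> u) (\<lambda>u. R u \<omega>) n i\<bar> \<le> norm (4 * \<rho>\<^sup>2 * ((t - s) / real n) * running_max t \<omega>)"
        using order_trans[OF err_le[OF \<omega> that] abs_ge_self] by (simp add: mult.assoc mult.commute mult.left_commute)
    qed
  qed
  have W0: "(\<lambda>n. \<integral>\<omega>. W n \<omega> \<partial>M) \<longlonglongrightarrow> (\<integral>\<omega>. 0 \<partial>M)"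
  proof (rule integral_dominated_convergence[OF _ Wm int_dom])
    show "AE \<omega> in M. (\<lambda>n. W n \<omega>) \<longlonglongrightarrow> 0"
      unfolding W_def using s cont\<theta>
      by (intro AE_I2 riccati_error_tendsto_0 continuous_segment st' continuous_on_minus)
    show "AE \<omega> in M. norm (W n \<omega>) \<le> D * running_max t \<omega>" for n
      using W_le by (intro AE_I2) (auto simp: W_def sum_nonneg)
  qed simp
  have main: "\<bar>g t - exp (- (besq_dim * (\<Sum>i<n. \<theta> (grid s t n i) * ((t - s) / real n)))) * g s\<bar> \<le> (\<integral>\<omega>. W n \<omega> \<partial>M) + \<epsilon> n"
    if n: "0 < n" for n
  proof -
    define h where "h = (t - s) / real n"
    define G where "G = grid s t n"
    define er where "er = (\<lambda>i \<omega>. riccati_error s t (\<lambda>u. - \<theta> u) (\<lambda>u. R u \<omega>) n i)"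
    define e0 where "e0 = real n ^ 2 * (C * exp (- (\<kappa> * real n) / (4 * t))) + exp 1 / real n ^ 2"
    have h: "0 < h" using st n by (simp add: h_def)
    have step: "\<bar>g (G (Suc i)) - exp (- (besq_dim * (\<theta> (G i) * h))) * g (G i)\<bar> \<le> (\<integral>\<omega>. \<bar>er i \<omega>\<bar> \<partial>M) + e0" if i: "i < n" for i
    proof -
      define u v where "u = G i" and "v = G (Suc i)"
      have b: "s \<le> u" "u \<le> v" "v \<le> t" "0 \<le> u" "0 \<le> v" "u \<le> t" "s \<le> v"
        using grid_bounds[OF st', of i n] grid_bounds[OF st', of "Suc i" n] grid_mono[OF st', of i "Suc i" n] s i
        by (auto simp: u_def v_def G_def)
      have vu: "v - u = h" by (simp add: u_def v_def G_def h_def grid_Suc)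
      have Yu: "Y \<in> borel_measurable (F u)" by (rule measurable_F_mono[OF Y b(1)])
      define J where "J = (\<lambda>\<omega>. integral {u..v} (\<lambda>s. R s \<omega>))"
      define K where "K = (\<integral>\<omega>. Y \<omega> * exp (- (\<theta> u * R v \<omega> + 2 * (\<theta> u)\<^sup>2 * J \<omega>)) \<partial>M)"
      have J0: "0 \<le> J \<omega>" if "\<omega> \<in> space M" for \<omega> unfolding J_def by (rule integral_nonneg_path[OF that b(4)])
      have Jle: "J \<omega> \<le> running_max t \<omega> * h" if \<omega>: "\<omega> \<in> space M" for \<omega>
      proof -
        have "J \<omega> \<le> integral {u..v} (\<lambda>_. running_max t \<omega>)"
          unfolding J_def using b running_max(1)[OF \<omega> t(1)]
          by (intro integral_le integrable_continuous_real continuous_segment \<omega>) auto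
        then show ?thesis using b vu by (simp add: mult.commute)
      qed
      have [measurable]: "Y \<in> borel_measurable M" "R v \<in> borel_measurable M" "J \<in> borel_measurable M"
        using measurable_F_M[OF Y s] R_measurable[OF b(5)] measurable_F_M[OF integral_adapted[OF b(4,2)] b(5)]
        by (auto simp: J_def)
      have "\<bar>K - exp (- (besq_dim * (\<theta> u * (v - u)))) * g u\<bar>
          \<le> real n ^ 2 * measure M {\<omega>\<in>space M. 1 / 2 < 4 * (\<theta> u)\<^sup>2 * J \<omega>} + exp 1 / real n ^ 2"
        unfolding K_def g_def J_def using n \<theta>0[of u] b by (intro laplace_step Yu Y01) auto
      also have "measure M {\<omega>\<in>space M. 1 / 2 < 4 * (\<theta> u)\<^sup>2 * J \<omega>} \<le> C * exp (- (\<kappa> * real n) / (4 * t))"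
      proof -
        have "{\<omega>\<in>space M. 1 / 2 < 4 * (\<theta> u)\<^sup>2 * J \<omega>} \<subseteq> exceed t (\<kappa> * real n)"
        proof safe
          fix \<omega> assume \<omega>: "\<omega> \<in> space M" and l: "1 / 2 < 4 * (\<theta> u)\<^sup>2 * J \<omega>"
          have "(\<theta> u)\<^sup>2 \<le> \<rho>\<^sup>2" using \<theta>0[of u] b by (intro power_mono) auto
          then have "4 * (\<theta> u)\<^sup>2 * J \<omega> \<le> 4 * \<rho>\<^sup>2 * (running_max t \<omega> * h)"
            using J0[OF \<omega>] Jle[OF \<omega>] by (intro mult_mono) auto
          then have "1 / 2 < 4 * \<rho>\<^sup>2 * (running_max t \<omega> * h)" using l by linarith
          then have "\<kappa> * real n < running_max t \<omega>"
            using \<rho> st n by (simp add: \<kappa>_def h_def field_simps)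
          then show "\<omega> \<in> exceed t (\<kappa> * real n)" using running_max(2)[OF \<omega> t(1)] by simp
        qed
        then have "measure M {\<omega>\<in>space M. 1 / 2 < 4 * (\<theta> u)\<^sup>2 * J \<omega>} \<le> measure M (exceed t (\<kappa> * real n))"
          by (intro finite_measure_mono exceed_sets t)
        also have "ennreal (measure M (exceed t (\<kappa> * real n))) \<le> ennreal (exp (besq_dim / 2 + x / (2 * t) - (\<kappa> * real n) / (4 * t)))"
          using exceed_tail[OF t(1), of "\<kappa> * real n"] \<kappa> by (simp add: emeasure_eq_measure)
        then have "measure M (exceed t (\<kappa> * real n)) \<le> exp (besq_dim / 2 + x / (2 * t) - (\<kappa> * real n) / (4 * t))"
          by (subst (asm) ennreal_le_iff) auto
        also have "\<dots> = C * exp (- (\<kappa> * real n) / (4 * t))" by (simp add: C_def mult_exp_exp)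
        finally show ?thesis .
      qed
      finally have 1: "\<bar>K - exp (- (besq_dim * (\<theta> u * (v - u)))) * g u\<bar> \<le> e0"
        by (simp add: e0_def mult_left_mono)
      have er: "\<theta> v * R v \<omega> - (\<theta> u * R v \<omega> + 2 * (\<theta> u)\<^sup>2 * J \<omega>) = er i \<omega>" for \<omega>
      proof -
        have "1 + 2 * \<rho> * (t - u) \<noteq> 0" "1 + 2 * \<rho> * (t - v) \<noteq> 0" using den[of u] den[of v] b by auto
        then have "\<theta> v - \<theta> u = 2 * (v - u) * \<theta> u * \<theta> v"
          unfolding \<theta>_def by (simp add: divide_simps) (simp add: algebra_simps)
        then have "\<theta> v * R v \<omega> - \<theta> u * R v \<omega> = 2 * h * \<theta> u * \<theta> v * R v \<omega>"
          unfolding vu by (metis left_diff_distrib)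
        then show ?thesis
          by (simp add: er_def riccati_error_def u_def v_def G_def h_def J_def)
      qed
      have iK: "integrable M (\<lambda>\<omega>. Y \<omega> * exp (- (\<theta> u * R v \<omega> + 2 * (\<theta> u)\<^sup>2 * J \<omega>)))"
        using \<theta>0[of u] nonneg[OF _ b(5)] J0 b by (intro laplace_integrable Y01) auto
      have ig: "integrable M (\<lambda>\<omega>. Y \<omega> * exp (- (\<theta> v * R v \<omega>)))"
        using \<theta>0[of v] nonneg[OF _ b(5)] b by (intro laplace_integrable Y01) auto
      have "\<bar>g v - K\<bar> = \<bar>\<integral>\<omega>. Y \<omega> * exp (- (\<theta> v * R v \<omega>)) - Y \<omega> * exp (- (\<theta> u * R v \<omega> + 2 * (\<theta> u)\<^sup>2 * J \<omega>)) \<partial>M\<bar>"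
        unfolding g_def K_def using iK ig by simp
      also have "\<dots> \<le> (\<integral>\<omega>. \<bar>Y \<omega> * exp (- (\<theta> v * R v \<omega>)) - Y \<omega> * exp (- (\<theta> u * R v \<omega> + 2 * (\<theta> u)\<^sup>2 * J \<omega>))\<bar> \<partial>M)"
        by (rule integral_abs_bound)
      also have "\<dots> \<le> (\<integral>\<omega>. \<bar>er i \<omega>\<bar> \<partial>M)"
      proof (rule integral_mono)
        show "integrable M (\<lambda>\<omega>. \<bar>Y \<omega> * exp (- (\<theta> v * R v \<omega>)) - Y \<omega> * exp (- (\<theta> u * R v \<omega> + 2 * (\<theta> u)\<^sup>2 * J \<omega>))\<bar>)"
          using iK ig by (intro integrable_abs Bochner_Integration.integrable_diff)
        show "integrable M (\<lambda>\<omega>. \<bar>er i \<omega>\<bar>)" unfolding er_def by (rule err_int[OF i])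
        fix \<omega> assume \<omega>: "\<omega> \<in> space M"
        have "\<bar>Y \<omega> * exp (- (\<theta> v * R v \<omega>)) - Y \<omega> * exp (- (\<theta> u * R v \<omega> + 2 * (\<theta> u)\<^sup>2 * J \<omega>))\<bar>
           = Y \<omega> * \<bar>exp (- (\<theta> v * R v \<omega>)) - exp (- (\<theta> u * R v \<omega> + 2 * (\<theta> u)\<^sup>2 * J \<omega>))\<bar>"
          using Y01(1)[of \<omega>] by (simp add: right_diff_distrib[symmetric] abs_mult)
        also have "\<dots> \<le> 1 * \<bar>\<theta> v * R v \<omega> - (\<theta> u * R v \<omega> + 2 * (\<theta> u)\<^sup>2 * J \<omega>)\<bar>"
          using \<theta>0[of u] \<theta>0[of v] nonneg[OF \<omega> b(5)] J0[OF \<omega>] b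
          by (intro mult_mono Y01 exp_minus_abs_diff) auto
        finally show "\<bar>Y \<omega> * exp (- (\<theta> v * R v \<omega>)) - Y \<omega> * exp (- (\<theta> u * R v \<omega> + 2 * (\<theta> u)\<^sup>2 * J \<omega>))\<bar> \<le> \<bar>er i \<omega>\<bar>"
          by (simp add: er)
      qed
      finally have "\<bar>g v - K\<bar> \<le> (\<integral>\<omega>. \<bar>er i \<omega>\<bar> \<partial>M)" .
      with 1 show ?thesis unfolding u_def[symmetric] v_def[symmetric] vu by linarith
    qed
    have "\<bar>g (G n) - exp (- (\<Sum>i<n. besq_dim * (\<theta> (G i) * h))) * g (G 0)\<bar> \<le> (\<Sum>i<n. (\<integral>\<omega>. \<bar>er i \<omega>\<bar> \<partial>M) + e0)"
    proof (rule telescoping_decay[where g = "\<lambda>i. g (G i)"])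
      show "0 \<le> besq_dim * (\<theta> (G i) * h)" if "i < n" for i
        using grid_bounds[OF st', of i n] \<theta>0[of "G i"] that h besq_dim_nonneg by (simp add: G_def)
    qed (rule step)
    also have "(\<Sum>i<n. (\<integral>\<omega>. \<bar>er i \<omega>\<bar> \<partial>M) + e0) = (\<integral>\<omega>. W n \<omega> \<partial>M) + \<epsilon> n"
      unfolding W_def er_def[symmetric] using err_int
      by (subst Bochner_Integration.integral_sum) (auto simp: er_def sum.distrib \<epsilon>_def e0_def)
    finally show ?thesis using n by (simp add: G_def h_def sum_distrib_left)
  qed
  have \<epsilon>0: "\<epsilon> \<longlonglongrightarrow> 0"
  proof -
    define k where "k = \<kappa> / (4 * t)"
    have "0 < k" using \<kappa> t by (simp add: k_def)
    then have "(\<lambda>n. real n * (real n ^ 2 * (C * exp (- (k * real n))) + exp 1 / real n ^ 2)) \<longlonglongrightarrow> 0"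
      by real_asymp
    then show ?thesis by (simp add: \<epsilon>_def k_def)
  qed
  have RS: "(\<lambda>n. \<Sum>i<n. \<theta> (grid s t n i) * ((t - s) / real n)) \<longlonglongrightarrow> integral {s..t} \<theta>"
    by (rule riemann_sum_tendsto[OF cont\<theta> st'])
  have "(\<lambda>n. \<bar>g t - exp (- (besq_dim * (\<Sum>i<n. \<theta> (grid s t n i) * ((t - s) / real n)))) * g s\<bar>)
      \<longlonglongrightarrow> \<bar>g t - exp (- (besq_dim * integral {s..t} \<theta>)) * g s\<bar>"
    by (intro tendsto_intros RS)
  moreover have "(\<lambda>n. (\<integral>\<omega>. W n \<omega> \<partial>M) + \<epsilon> n) \<longlonglongrightarrow> 0"
    using tendsto_add[OF W0 \<epsilon>0] by simp
  ultimately have "\<bar>g t - exp (- (besq_dim * integral {s..t} \<theta>)) * g s\<bar> \<le> 0"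
    by (rule LIMSEQ_le) (use main in \<open>auto intro!: exI[of _ 1]\<close>)
  then have eq: "g t = exp (- (besq_dim * integral {s..t} \<theta>)) * g s" by simp
  have "(\<theta> has_integral ((- ln (1 + 2 * \<rho> * (t - t)) / 2) - (- ln (1 + 2 * \<rho> * (t - s)) / 2))) {s..t}"
  proof (rule fundamental_theorem_of_calculus[OF st'])
    fix u assume "u \<in> {s..t}"
    then have p: "0 < 1 + 2 * \<rho> * (t - u)" using den[of u] by auto
    have "((\<lambda>u. - ln (1 + 2 * \<rho> * (t - u)) / 2) has_real_derivative \<theta> u) (at u within {s..t})"
      unfolding \<theta>_def using p by (auto intro!: derivative_eq_intros simp: divide_simps)
    then show "((\<lambda>u. - ln (1 + 2 * \<rho> * (t - u)) / 2) has_vector_derivative \<theta> u) (at u within {s..t})"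
      by (simp add: has_real_derivative_iff_has_vector_derivative)
  qed
  then have "integral {s..t} \<theta> = ln (1 + 2 * \<rho> * (t - s)) / 2" by (simp add: integral_unique)
  moreover have "1 + 2 * \<rho> * (t - s) \<noteq> 0" using den[of s] st by auto
  ultimately have "exp (- (besq_dim * integral {s..t} \<theta>)) = (1 + 2 * \<rho> * (t - s)) powr (- (\<mu> + 1))"
    by (simp add: powr_def besq_dim_def algebra_simps)
  then show ?thesis using eq by (simp add: g_def \<theta>_def)
qed

lemma laplace_transition:
  assumes s: "0 \<le> s" and st: "s \<le> t" and Y: "Y \<in> borel_measurable (F s)"
    and Y01: "\<And>\<omega>. 0 \<le> Y \<omega>" "\<And>\<omega>. Y \<omega> \<le> 1" and \<rho>: "0 \<le> \<rho>"
  shows "(\<integral>\<omega>. Y \<omega> * exp (- (\<rho> * R t \<omega>)) \<partial>M) =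
    (1 + 2 * \<rho> * (t - s)) powr (- (\<mu> + 1)) * (\<integral>\<omega>. Y \<omega> * exp (- (\<rho> / (1 + 2 * \<rho> * (t - s)) * R s \<omega>)) \<partial>M)"
proof (cases "s = t \<or> \<rho> = 0")
  case False
  then show ?thesis using assms by (intro laplace_transition_pos) auto
qed auto

end

section \<open>Laplace transforms determine laws\<close>

text \<open>Weierstrass approximation: equal moments on \<open>[0,1]\<close> give equal means of continuous functions. The weights
\<open>U\<close>, \<open>U'\<close> are kept general so that the argument can be repeated coordinate by coordinate.\<close>

lemma continuous_moment_unique:
  fixes f :: "real \<Rightarrow> real"
  assumes "finite_measure M" and [measurable]: "V \<in> borel_measurable M" "V' \<in> borel_measurable M"
    "U \<in> borel_measurable M" "U' \<in> borel_measurable M"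
    and V: "\<And>\<omega>. V \<omega> \<in> {0..1}" "\<And>\<omega>. V' \<omega> \<in> {0..1}" and U: "\<And>\<omega>. U \<omega> \<in> {0..1}" "\<And>\<omega>. U' \<omega> \<in> {0..1}"
    and moments: "\<And>k::nat. (\<integral>\<omega>. U \<omega> * V \<omega> ^ k \<partial>M) = (\<integral>\<omega>. U' \<omega> * V' \<omega> ^ k \<partial>M)"
    and f: "continuous_on {0..1} f" and [measurable]: "f \<in> borel_measurable borel"
  shows "(\<integral>\<omega>. U \<omega> * f (V \<omega>) \<partial>M) = (\<integral>\<omega>. U' \<omega> * f (V' \<omega>) \<partial>M)"
proof -
  interpret finite_measure M by fact
  have int: "integrable M (\<lambda>\<omega>. U \<omega> * h (V \<omega>))" "integrable M (\<lambda>\<omega>. U' \<omega> * h (V' \<omega>))"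
    if [measurable]: "h \<in> borel_measurable borel" and h: "\<And>y. y \<in> {0..1} \<Longrightarrow> \<bar>h y\<bar> \<le> C" for h :: "real \<Rightarrow> real" and C
  proof -
    have b: "\<bar>a * h y\<bar> \<le> C" if "a \<in> {0..1}" "y \<in> {0..1}" for a y :: real
    proof -
      have "\<bar>a * h y\<bar> \<le> 1 * C" unfolding abs_mult using that h[of y] by (intro mult_mono) auto
      then show ?thesis by simp
    qed
    show "integrable M (\<lambda>\<omega>. U \<omega> * h (V \<omega>))"
      using b[OF U(1) V(1)] by (intro integrable_const_bound[where B = C]) auto
    show "integrable M (\<lambda>\<omega>. U' \<omega> * h (V' \<omega>))"
      using b[OF U(2) V(2)] by (intro integrable_const_bound[where B = C]) auto
  qed
  have pow_int: "integrable M (\<lambda>\<omega>. U \<omega> * V \<omega> ^ k)" "integrable M (\<lambda>\<omega>. U' \<omega> * V' \<omega> ^ k)" for k :: nat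
    using int[of "\<lambda>y. y ^ k" 1] by (auto simp: power_abs power_le_one)
  have poly: "(\<integral>\<omega>. U \<omega> * (\<Sum>i\<le>n. a i * V \<omega> ^ i) \<partial>M) = (\<integral>\<omega>. U' \<omega> * (\<Sum>i\<le>n. a i * V' \<omega> ^ i) \<partial>M)" for a :: "nat \<Rightarrow> real" and n
  proof -
    have "(\<integral>\<omega>. U \<omega> * (\<Sum>i\<le>n. a i * V \<omega> ^ i) \<partial>M) = (\<integral>\<omega>. (\<Sum>i\<le>n. a i * (U \<omega> * V \<omega> ^ i)) \<partial>M)"
      by (simp add: sum_distrib_left mult.left_commute)
    also have "\<dots> = (\<Sum>i\<le>n. a i * (\<integral>\<omega>. U \<omega> * V \<omega> ^ i \<partial>M))" using pow_int by simp
    also have "\<dots> = (\<Sum>i\<le>n. a i * (\<integral>\<omega>. U' \<omega> * V' \<omega> ^ i \<partial>M))" by (simp add: moments)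
    also have "\<dots> = (\<integral>\<omega>. (\<Sum>i\<le>n. a i * (U' \<omega> * V' \<omega> ^ i)) \<partial>M)" using pow_int by simp
    also have "\<dots> = (\<integral>\<omega>. U' \<omega> * (\<Sum>i\<le>n. a i * V' \<omega> ^ i) \<partial>M)"
      by (simp add: sum_distrib_left mult.left_commute)
    finally show ?thesis .
  qed
  obtain Cf where Cf: "\<And>y. y \<in> {0..1} \<Longrightarrow> \<bar>f y\<bar> \<le> Cf"
  proof -
    have "bounded (f ` {0..1})" using f by (intro compact_imp_bounded compact_continuous_image) auto
    then obtain a where "\<forall>y\<in>f ` {0..1}. norm y \<le> a" unfolding bounded_iff by blast
    then show ?thesis by (intro that[of a]) auto
  qed
  define D where "D = \<bar>(\<integral>\<omega>. U \<omega> * f (V \<omega>) \<partial>M) - (\<integral>\<omega>. U' \<omega> * f (V' \<omega>) \<partial>M)\<bar>"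
  have small: "D \<le> 2 * e * measure M (space M)" if e: "0 < e" for e
  proof -
    obtain p where p: "real_polynomial_function p" "\<And>y. y \<in> {0..1} \<Longrightarrow> \<bar>f y - p y\<bar> < e"
      using Stone_Weierstrass_real_polynomial_function[of "{0..1::real}" f e] f e by auto
    then obtain a n where pe: "p = (\<lambda>y. \<Sum>i\<le>n. a i * y ^ i)"
      unfolding real_polynomial_function_iff_sum by auto
    have [measurable]: "p \<in> borel_measurable borel" unfolding pe by measurable
    have Cp: "\<bar>p y\<bar> \<le> Cf + e" if "y \<in> {0..1}" for y using p(2)[OF that] Cf[OF that] by linarith
    have dif: "\<bar>(\<integral>\<omega>. u \<omega> * f (v \<omega>) \<partial>M) - (\<integral>\<omega>. u \<omega> * p (v \<omega>) \<partial>M)\<bar> \<le> e * measure M (space M)"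
      if i: "integrable M (\<lambda>\<omega>. u \<omega> * f (v \<omega>))" "integrable M (\<lambda>\<omega>. u \<omega> * p (v \<omega>))"
        and uv: "\<And>\<omega>. u \<omega> \<in> {0..1}" "\<And>\<omega>. v \<omega> \<in> {0..1}" for u v
    proof -
      have "\<bar>(\<integral>\<omega>. u \<omega> * f (v \<omega>) \<partial>M) - (\<integral>\<omega>. u \<omega> * p (v \<omega>) \<partial>M)\<bar> = \<bar>\<integral>\<omega>. u \<omega> * f (v \<omega>) - u \<omega> * p (v \<omega>) \<partial>M\<bar>"
        using i by simp
      also have "\<dots> \<le> (\<integral>\<omega>. \<bar>u \<omega> * f (v \<omega>) - u \<omega> * p (v \<omega>)\<bar> \<partial>M)" by (rule integral_abs_bound)
      also have "\<dots> \<le> (\<integral>\<omega>. e \<partial>M)"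
      proof (rule integral_mono)
        show "integrable M (\<lambda>\<omega>. \<bar>u \<omega> * f (v \<omega>) - u \<omega> * p (v \<omega>)\<bar>)"
          using i by (intro integrable_abs Bochner_Integration.integrable_diff)
        fix \<omega>
        have "\<bar>u \<omega> * f (v \<omega>) - u \<omega> * p (v \<omega>)\<bar> = u \<omega> * \<bar>f (v \<omega>) - p (v \<omega>)\<bar>"
          using uv(1)[of \<omega>] by (simp add: right_diff_distrib[symmetric] abs_mult)
        also have "\<dots> \<le> 1 * e" using uv(1)[of \<omega>] p(2)[OF uv(2)[of \<omega>]] by (intro mult_mono) auto
        finally show "\<bar>u \<omega> * f (v \<omega>) - u \<omega> * p (v \<omega>)\<bar> \<le> e" by simp
      qed simp
      finally show ?thesis by (simp add: mult.commute)
    qed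
    have 1: "\<bar>(\<integral>\<omega>. U \<omega> * f (V \<omega>) \<partial>M) - (\<integral>\<omega>. U \<omega> * p (V \<omega>) \<partial>M)\<bar> \<le> e * measure M (space M)"
      by (intro dif int(1)[of f Cf] int(1)[of p "Cf + e"] Cf Cp U V) auto
    have 2: "\<bar>(\<integral>\<omega>. U' \<omega> * f (V' \<omega>) \<partial>M) - (\<integral>\<omega>. U' \<omega> * p (V' \<omega>) \<partial>M)\<bar> \<le> e * measure M (space M)"
      by (intro dif int(2)[of f Cf] int(2)[of p "Cf + e"] Cf Cp U V) auto
    have 3: "(\<integral>\<omega>. U \<omega> * p (V \<omega>) \<partial>M) = (\<integral>\<omega>. U' \<omega> * p (V' \<omega>) \<partial>M)" unfolding pe by (rule poly)
    show ?thesis using 1 2 3 unfolding D_def by linarith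
  qed
  have "D \<le> 0"
  proof (rule ccontr)
    assume "\<not> D \<le> 0"
    then have D: "0 < D" by simp
    define m where "m = measure M (space M) + 1"
    have m: "0 < m" "measure M (space M) < m" by (auto simp: m_def add_nonneg_pos)
    have "D \<le> 2 * (D / (2 * m)) * measure M (space M)" using D m by (intro small) auto
    also have "\<dots> = D * (measure M (space M) / m)" using m by simp
    also have "\<dots> < D * 1" using D m by (intro mult_strict_left_mono) auto
    finally show False by simp
  qed
  then show ?thesis unfolding D_def by simp
qed

text \<open>The substitution \<open>V = exp(-X)\<close> turns the values of the Laplace transform at the nonnegative integers into the moments
of a variable in \<open>[0,1]\<close>.\<close>

lemma laplace_unique:
  assumes "finite_measure M" and [measurable]: "X \<in> borel_measurable M" "X' \<in> borel_measurable M"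
    "U \<in> borel_measurable M" "U' \<in> borel_measurable M"
    and X: "\<And>\<omega>. 0 \<le> X \<omega>" "\<And>\<omega>. 0 \<le> X' \<omega>" and U: "\<And>\<omega>. U \<omega> \<in> {0..1}" "\<And>\<omega>. U' \<omega> \<in> {0..1}"
    and laplace: "\<And>k::nat. (\<integral>\<omega>. U \<omega> * exp (- (real k * X \<omega>)) \<partial>M) = (\<integral>\<omega>. U' \<omega> * exp (- (real k * X' \<omega>)) \<partial>M)"
    and A [measurable]: "A \<in> sets borel"
  shows "(\<integral>\<omega>. U \<omega> * indicator A (X \<omega>) \<partial>M) = (\<integral>\<omega>. U' \<omega> * indicator A (X' \<omega>) \<partial>M)"
proof -
  interpret finite_measure M by fact
  define V where "V = (\<lambda>\<omega>. exp (- X \<omega>))"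
  define V' where "V' = (\<lambda>\<omega>. exp (- X' \<omega>))"
  have Vm [measurable]: "V \<in> borel_measurable M" "V' \<in> borel_measurable M" unfolding V_def V'_def by measurable
  have V01: "V \<omega> \<in> {0..1}" "V' \<omega> \<in> {0..1}" for \<omega> using X[of \<omega>] by (auto simp: V_def V'_def)
  have mom: "(\<integral>\<omega>. U \<omega> * V \<omega> ^ k \<partial>M) = (\<integral>\<omega>. U' \<omega> * V' \<omega> ^ k \<partial>M)" for k :: nat
    using laplace[of k] by (simp add: V_def V'_def exp_of_nat_mult[symmetric])
  define \<phi> where "\<phi> = (\<lambda>a (n::nat) y. min 1 (real n * max 0 (y - a)) :: real)"
  have \<phi>m [measurable]: "\<phi> a n \<in> borel_measurable borel" for a n unfolding \<phi>_def by measurable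
  have \<phi>01: "0 \<le> \<phi> a n y" "\<phi> a n y \<le> 1" for a n y by (auto simp: \<phi>_def)
  have lim: "(\<lambda>n. \<phi> a n y) \<longlonglongrightarrow> indicator {a<..} y" for a y
  proof (cases "a < y")
    case True
    have "eventually (\<lambda>n. \<phi> a n y = 1) sequentially"
      using eventually_ge_at_top[of "nat \<lceil>1 / (y - a)\<rceil>"]
    proof eventually_elim
      case (elim n)
      then have "1 / (y - a) \<le> real n" by linarith
      then have "1 \<le> real n * (y - a)" using True by (simp add: field_simps)
      then show ?case using True by (simp add: \<phi>_def)
    qed
    then show ?thesis using True by (simp add: tendsto_eventually)
  qed (simp add: \<phi>_def)
  have eq: "(\<integral>\<omega>. U \<omega> * indicator {a<..} (V \<omega>) \<partial>M) = (\<integral>\<omega>. U' \<omega> * indicator {a<..} (V' \<omega>) \<partial>M)" for a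
  proof (rule LIMSEQ_unique)
    show "(\<lambda>n. \<integral>\<omega>. U \<omega> * \<phi> a n (V \<omega>) \<partial>M) \<longlonglongrightarrow> (\<integral>\<omega>. U \<omega> * indicator {a<..} (V \<omega>) \<partial>M)"
      using U \<phi>01
      by (intro integral_dominated_convergence[where w = "\<lambda>_. 1"] AE_I2 tendsto_mult tendsto_const lim)
         (auto simp: abs_mult intro!: mult_le_one)
    have "(\<lambda>n. \<integral>\<omega>. U' \<omega> * \<phi> a n (V' \<omega>) \<partial>M) \<longlonglongrightarrow> (\<integral>\<omega>. U' \<omega> * indicator {a<..} (V' \<omega>) \<partial>M)"
      using U \<phi>01
      by (intro integral_dominated_convergence[where w = "\<lambda>_. 1"] AE_I2 tendsto_mult tendsto_const lim)
         (auto simp: abs_mult intro!: mult_le_one)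
    moreover have "(\<integral>\<omega>. U \<omega> * \<phi> a n (V \<omega>) \<partial>M) = (\<integral>\<omega>. U' \<omega> * \<phi> a n (V' \<omega>) \<partial>M)" for n
    proof (rule continuous_moment_unique[OF \<open>finite_measure M\<close>, where V = V and V' = V' and U = U and U' = U' and f = "\<phi> a n"])
      show "continuous_on {0..1} (\<phi> a n)" unfolding \<phi>_def by (intro continuous_intros)
    qed (rule Vm assms(4,5) V01 U mom \<phi>m)+
    ultimately show "(\<lambda>n. \<integral>\<omega>. U \<omega> * \<phi> a n (V \<omega>) \<partial>M) \<longlonglongrightarrow> (\<integral>\<omega>. U' \<omega> * indicator {a<..} (V' \<omega>) \<partial>M)" by simp
  qed
  have em: "emeasure (distr (density M (\<lambda>\<omega>. ennreal (u \<omega>))) borel v) C = ennreal (\<integral>\<omega>. u \<omega> * indicator C (v \<omega>) \<partial>M)"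
    if [measurable]: "u \<in> borel_measurable M" "v \<in> borel_measurable M" "C \<in> sets borel" and u: "\<And>\<omega>. u \<omega> \<in> {0..1}"
    for u v :: "'a \<Rightarrow> real" and C :: "real set"
  proof -
    have "emeasure (distr (density M (\<lambda>\<omega>. ennreal (u \<omega>))) borel v) C = (\<integral>\<^sup>+\<omega>. ennreal (u \<omega>) * indicator (v -` C \<inter> space M) \<omega> \<partial>M)"
      by (simp add: emeasure_distr emeasure_density)
    also have "\<dots> = (\<integral>\<^sup>+\<omega>. ennreal (u \<omega> * indicator C (v \<omega>)) \<partial>M)"
      by (intro nn_integral_cong) (auto simp: indicator_def)
    also have "\<dots> = ennreal (\<integral>\<omega>. u \<omega> * indicator C (v \<omega>) \<partial>M)"
    proof (rule nn_integral_eq_integral)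
      show "integrable M (\<lambda>\<omega>. u \<omega> * indicator C (v \<omega>))"
        using u by (intro integrable_const_bound[where B = 1]) (auto simp: indicator_def)
    qed (use u in auto)
    finally show ?thesis .
  qed
  note emU = em[OF assms(4) Vm(1) _ U(1)] and emU' = em[OF assms(5) Vm(2) _ U(2)]
  have "distr (density M (\<lambda>\<omega>. ennreal (U \<omega>))) borel V = distr (density M (\<lambda>\<omega>. ennreal (U' \<omega>))) borel V'"
    by (rule measure_eqI_lessThan) (auto simp: emU emU' eq)
  then have "emeasure (distr (density M (\<lambda>\<omega>. ennreal (U \<omega>))) borel V) {y. - ln y \<in> A} = emeasure (distr (density M (\<lambda>\<omega>. ennreal (U' \<omega>))) borel V') {y. - ln y \<in> A}"
    by simp
  moreover have "{y. - ln y \<in> A} \<in> sets borel"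
  proof -
    have "(\<lambda>y::real. - ln y) -` A \<inter> space borel \<in> sets borel" by (rule measurable_sets[OF _ A]) measurable
    then show ?thesis by (simp add: vimage_def)
  qed
  ultimately have "ennreal (\<integral>\<omega>. U \<omega> * indicator {y. - ln y \<in> A} (V \<omega>) \<partial>M) = ennreal (\<integral>\<omega>. U' \<omega> * indicator {y. - ln y \<in> A} (V' \<omega>) \<partial>M)"
    by (simp add: emU emU')
  then have "(\<integral>\<omega>. U \<omega> * indicator {y. - ln y \<in> A} (V \<omega>) \<partial>M) = (\<integral>\<omega>. U' \<omega> * indicator {y. - ln y \<in> A} (V' \<omega>) \<partial>M)"
    using U by (subst (asm) ennreal_inj) (auto intro!: integral_nonneg_AE)
  then show ?thesis by (simp add: V_def V'_def indicator_def)
qed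

text \<open>One coordinate at a time is converted from an exponential into an indicator. The coordinates already
converted and the exponentials of those still to come form the weight in the one-dimensional lemma.\<close>

lemma (in prob_space) finite_dimensional_unique:
  fixes X X' :: "'i \<Rightarrow> 'a \<Rightarrow> real"
  assumes J: "finite J"
    and Xm: "\<And>j. j \<in> J \<Longrightarrow> X j \<in> borel_measurable M" "\<And>j. j \<in> J \<Longrightarrow> X' j \<in> borel_measurable M"
    and X0: "\<And>j \<omega>. j \<in> J \<Longrightarrow> \<omega> \<in> space M \<Longrightarrow> 0 \<le> X j \<omega>" "\<And>j \<omega>. j \<in> J \<Longrightarrow> \<omega> \<in> space M \<Longrightarrow> 0 \<le> X' j \<omega>"
    and laplace: "\<And>l. (\<And>j. j \<in> J \<Longrightarrow> 0 \<le> l j) \<Longrightarrow>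
      (\<integral>\<omega>. exp (- (\<Sum>j\<in>J. l j * X j \<omega>)) \<partial>M) = (\<integral>\<omega>. exp (- (\<Sum>j\<in>J. l j * X' j \<omega>)) \<partial>M)"
    and A: "\<And>j. j \<in> J \<Longrightarrow> A j \<in> sets borel"
  shows "prob {\<omega>\<in>space M. \<forall>j\<in>J. X j \<omega> \<in> A j} = prob {\<omega>\<in>space M. \<forall>j\<in>J. X' j \<omega> \<in> A j}"
proof -
  define Z Z' where "Z = (\<lambda>j \<omega>. max 0 (X j \<omega>))" and "Z' = (\<lambda>j \<omega>. max 0 (X' j \<omega>))"
  have ZX: "Z j \<omega> = X j \<omega>" "Z' j \<omega> = X' j \<omega>" if "j \<in> J" "\<omega> \<in> space M" for j \<omega>
    using X0 that by (auto simp: Z_def Z'_def)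
  have Zm: "Z j \<in> borel_measurable M" "Z' j \<in> borel_measurable M" if "j \<in> J" for j
    unfolding Z_def Z'_def using Xm that by auto
  have Z0: "0 \<le> Z j \<omega>" "0 \<le> Z' j \<omega>" for j \<omega> by (auto simp: Z_def Z'_def)
  have lapZ: "(\<integral>\<omega>. exp (- (\<Sum>j\<in>J. l j * Z j \<omega>)) \<partial>M) = (\<integral>\<omega>. exp (- (\<Sum>j\<in>J. l j * Z' j \<omega>)) \<partial>M)"
    if "\<And>j. j \<in> J \<Longrightarrow> 0 \<le> l j" for l
  proof -
    have "(\<integral>\<omega>. exp (- (\<Sum>j\<in>J. l j * Z j \<omega>)) \<partial>M) = (\<integral>\<omega>. exp (- (\<Sum>j\<in>J. l j * X j \<omega>)) \<partial>M)"
      "(\<integral>\<omega>. exp (- (\<Sum>j\<in>J. l j * Z' j \<omega>)) \<partial>M) = (\<integral>\<omega>. exp (- (\<Sum>j\<in>J. l j * X' j \<omega>)) \<partial>M)"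
      by (auto intro!: Bochner_Integration.integral_cong sum.cong simp: ZX)
    then show ?thesis using laplace[OF that] by simp
  qed
  define W where "W = (\<lambda>K l (Y :: 'i \<Rightarrow> 'a \<Rightarrow> real) \<omega>. (\<Prod>j\<in>K. indicator (A j) (Y j \<omega>)) * exp (- (\<Sum>j\<in>J - K. l j * Y j \<omega>)))"
  have Wm: "W K l Y \<in> borel_measurable M" if "K \<subseteq> J" "\<And>j. j \<in> J \<Longrightarrow> Y j \<in> borel_measurable M" for K l Y
  proof -
    have "(\<lambda>\<omega>. indicator (A j) (Y j \<omega>)) \<in> borel_measurable M" if "j \<in> J" for j
      using that \<open>\<And>j. j \<in> J \<Longrightarrow> Y j \<in> borel_measurable M\<close>[of j] A[OF that] by measurable
    then show ?thesis
      unfolding W_def using that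
      by (intro borel_measurable_times borel_measurable_prod borel_measurable_exp borel_measurable_uminus borel_measurable_sum) auto
  qed
  have W01: "W K l Y \<omega> \<in> {0..1}" if "\<And>j. j \<in> J \<Longrightarrow> 0 \<le> l j" "\<And>j. 0 \<le> Y j \<omega>" for K l Y \<omega>
  proof -
    have "0 \<le> (\<Prod>j\<in>K. indicator (A j) (Y j \<omega>) :: real)" "(\<Prod>j\<in>K. indicator (A j) (Y j \<omega>) :: real) \<le> 1"
      by (auto intro!: prod_nonneg prod_le_1 simp: indicator_def)
    moreover have "exp (- (\<Sum>j\<in>J - K. l j * Y j \<omega>)) \<le> 1" using that by (auto intro!: sum_nonneg)
    ultimately show ?thesis unfolding W_def by (auto intro!: mult_le_one)
  qed
  \<comment> \<open>\<open>K\<close> is the set of coordinates already converted.\<close>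
  have "K \<subseteq> J \<Longrightarrow> (\<And>j. j \<in> J \<Longrightarrow> 0 \<le> l j) \<Longrightarrow> (\<integral>\<omega>. W K l Z \<omega> \<partial>M) = (\<integral>\<omega>. W K l Z' \<omega> \<partial>M)" if "finite K" for K l
    using that
  proof (induction K arbitrary: l rule: finite_induct)
    case empty
    then show ?case by (simp add: W_def lapZ)
  next
    case (insert k K)
    then have k: "k \<in> J" "k \<notin> K" "K \<subseteq> J" by auto
    define l0 where "l0 = l(k := 0)"
    have l0: "0 \<le> l0 j" if "j \<in> J" for j using insert.prems that by (simp add: l0_def)
    have e: "J - K = insert k (J - insert k K)" using k by auto
    have fin: "finite (J - insert k K)" "k \<notin> J - insert k K" using J by auto
    have spl: "W K (l(k := c)) Y \<omega> = W K l0 Y \<omega> * exp (- (c * Y k \<omega>))" for c Y \<omega>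
    proof -
      have "(\<Sum>j\<in>J - insert k K. (l(k := c)) j * Y j \<omega>) = (\<Sum>j\<in>J - insert k K. l0 j * Y j \<omega>)"
        by (intro sum.cong) (auto simp: l0_def)
      then show ?thesis unfolding W_def e sum.insert[OF fin] by (simp add: l0_def exp_add exp_diff exp_minus divide_inverse mult.assoc)
    qed
    have ins: "W (insert k K) l Y \<omega> = W K l0 Y \<omega> * indicator (A k) (Y k \<omega>)" for Y \<omega>
    proof -
      have "(\<Sum>j\<in>J - insert k K. l j * Y j \<omega>) = (\<Sum>j\<in>J - insert k K. l0 j * Y j \<omega>)"
        by (intro sum.cong) (auto simp: l0_def)
      then show ?thesis unfolding W_def e sum.insert[OF fin] using insert.hyps by (simp add: l0_def)
    qed
    show ?case unfolding ins
    proof (rule laplace_unique)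
      show "(\<integral>\<omega>. W K l0 Z \<omega> * exp (- (real n * Z k \<omega>)) \<partial>M) = (\<integral>\<omega>. W K l0 Z' \<omega> * exp (- (real n * Z' k \<omega>)) \<partial>M)" for n
        unfolding spl[symmetric] using insert.prems k by (intro insert.IH) auto
      show "W K l0 Z \<omega> \<in> {0..1}" "W K l0 Z' \<omega> \<in> {0..1}" for \<omega> using l0 Z0 by (auto simp del: atLeastAtMost_iff intro!: W01)
    qed (use k Zm Z0 A Wm finite_measure_axioms in auto)
  qed
  from this[OF J order_refl, of "\<lambda>_. 0"]
  have eq: "(\<integral>\<omega>. (\<Prod>j\<in>J. indicator (A j) (Z j \<omega>) :: real) \<partial>M) = (\<integral>\<omega>. (\<Prod>j\<in>J. indicator (A j) (Z' j \<omega>)) \<partial>M)"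
    by (simp add: W_def)
  have pr: "(\<integral>\<omega>. (\<Prod>j\<in>J. indicator (A j) (Y j \<omega>) :: real) \<partial>M) = prob {\<omega>\<in>space M. \<forall>j\<in>J. Q j \<omega> \<in> A j}"
    if "\<And>j. j \<in> J \<Longrightarrow> Q j \<in> borel_measurable M" "\<And>j \<omega>. j \<in> J \<Longrightarrow> \<omega> \<in> space M \<Longrightarrow> Y j \<omega> = Q j \<omega>" for Y Q :: "'i \<Rightarrow> 'a \<Rightarrow> real"
  proof -
    have "{\<omega>\<in>space M. \<forall>j\<in>J. Q j \<omega> \<in> A j} \<in> sets M"
      using J that(1) A by (intro sets.sets_Collect_finite_All) (auto intro!: measurable_sets_Collect)
    moreover have "(\<integral>\<omega>. (\<Prod>j\<in>J. indicator (A j) (Y j \<omega>) :: real) \<partial>M) = (\<integral>\<omega>. indicator {\<omega>\<in>space M. \<forall>j\<in>J. Q j \<omega> \<in> A j} \<omega> \<partial>M)"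
    proof (rule Bochner_Integration.integral_cong[OF refl])
      fix \<omega> assume \<omega>: "\<omega> \<in> space M"
      show "(\<Prod>j\<in>J. indicator (A j) (Y j \<omega>)) = (indicator {\<omega>\<in>space M. \<forall>j\<in>J. Q j \<omega> \<in> A j} \<omega> :: real)"
      proof (cases "\<forall>j\<in>J. Q j \<omega> \<in> A j")
        case False
        then have "\<exists>j\<in>J. indicator (A j) (Y j \<omega>) = (0 :: real)" using that(2)[OF _ \<omega>] by (auto simp: indicator_def)
        then show ?thesis using False J by (simp add: prod_zero)
      qed (use that(2)[OF _ \<omega>] \<omega> in auto)
    qed
    ultimately show ?thesis by simp
  qed
  have "(\<integral>\<omega>. (\<Prod>j\<in>J. indicator (A j) (Z j \<omega>) :: real) \<partial>M) = prob {\<omega>\<in>space M. \<forall>j\<in>J. X j \<omega> \<in> A j}"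
    by (rule pr[OF Xm(1) ZX(1)])
  moreover have "(\<integral>\<omega>. (\<Prod>j\<in>J. indicator (A j) (Z' j \<omega>) :: real) \<partial>M) = prob {\<omega>\<in>space M. \<forall>j\<in>J. X' j \<omega> \<in> A j}"
    by (rule pr[OF Xm(2) ZX(2)])
  ultimately show ?thesis using eq by simp
qed

lemma (in prob_space) equal_in_lawI:
  assumes X: "\<And>t. 0 \<le> t \<Longrightarrow> X t \<in> borel_measurable M" and Y: "\<And>t. 0 \<le> t \<Longrightarrow> Y t \<in> borel_measurable M"
    and fidi: "\<And>J A. finite J \<Longrightarrow> J \<subseteq> {0..} \<Longrightarrow> (\<And>t. t \<in> J \<Longrightarrow> A t \<in> sets borel) \<Longrightarrow>
      prob {\<omega>\<in>space M. \<forall>t\<in>J. X t \<omega> \<in> A t} = prob {\<omega>\<in>space M. \<forall>t\<in>J. Y t \<omega> \<in> A t}"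
  shows "equal_in_law M X Y"
proof -
  have m: "sample_path Z \<in> measurable M path_space" if "\<And>t. 0 \<le> t \<Longrightarrow> Z t \<in> borel_measurable M" for Z
    unfolding sample_path_def[abs_def] path_space_def using that by (intro measurable_restrict) auto
  have d: "emeasure (distr M path_space (sample_path Z)) (prod_emb {0..} (\<lambda>_. borel) J (Pi\<^sub>E J A))
     = ennreal (prob {\<omega>\<in>space M. \<forall>t\<in>J. Z t \<omega> \<in> A t})"
    if Z: "\<And>t. 0 \<le> t \<Longrightarrow> Z t \<in> borel_measurable M" and J: "finite J" "J \<subseteq> {0..}" and A: "\<And>t. t \<in> J \<Longrightarrow> A t \<in> sets borel" for Z J A
  proof -
    have "prod_emb {0..} (\<lambda>_. borel) J (Pi\<^sub>E J A) \<in> sets path_space"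
      unfolding path_space_def using J A by (intro sets_PiM_I) auto
    moreover have "sample_path Z -` prod_emb {0..} (\<lambda>_. borel) J (Pi\<^sub>E J A) \<inter> space M = {\<omega>\<in>space M. \<forall>t\<in>J. Z t \<omega> \<in> A t}"
      using J by (auto simp: prod_emb_def sample_path_def PiE_def Pi_def extensional_def restrict_def)
    ultimately show ?thesis using m[OF Z] by (simp add: emeasure_distr emeasure_eq_measure)
  qed
  have "distr M path_space (sample_path X) = distr M path_space (sample_path Y)"
  proof (rule measure_eqI_PiM_infinite[where I = "{0..}" and M = "\<lambda>_. borel"])
    show "finite_measure (distr M path_space (sample_path X))"
      by (rule finite_measure_distr[OF m[OF X]])
    show "emeasure (distr M path_space (sample_path X)) (prod_emb {0..} (\<lambda>_. borel) J (Pi\<^sub>E J A)) =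
        emeasure (distr M path_space (sample_path Y)) (prod_emb {0..} (\<lambda>_. borel) J (Pi\<^sub>E J A))"
      if "finite J" "J \<subseteq> {0..}" "\<And>i. i \<in> J \<Longrightarrow> A i \<in> sets borel" for A J
      using that by (simp add: d[OF X that] d[OF Y that] fidi)
  qed (auto simp: path_space_def)
  then show ?thesis unfolding equal_in_law_def using m X Y by auto
qed

section \<open>Finite-dimensional Laplace transforms and scaling\<close>

text \<open>A list of pairs (time, weight) stands for the functional \<open>\<Sum> l R\<^sub>t\<close>. Its Laplace transform, conditional on
time \<open>s\<close>, is \<open>laplace_factor \<cdot> exp(-laplace_exponent \<cdot> R\<^sub>s)\<close>; the recursions below integrate out the latest
time first.\<close>

fun time_chain :: "real \<Rightarrow> (real \<times> real) list \<Rightarrow> bool" where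
  "time_chain s [] \<longleftrightarrow> True"
| "time_chain s ((t, l) # xs) \<longleftrightarrow> s \<le> t \<and> 0 \<le> l \<and> time_chain t xs"

fun laplace_exponent :: "real \<Rightarrow> (real \<times> real) list \<Rightarrow> real" where
  "laplace_exponent s [] = 0"
| "laplace_exponent s ((t, l) # xs) =
     (l + laplace_exponent t xs) / (1 + 2 * (l + laplace_exponent t xs) * (t - s))"

fun laplace_factor :: "real \<Rightarrow> real \<Rightarrow> (real \<times> real) list \<Rightarrow> real" where
  "laplace_factor \<mu> s [] = 1"
| "laplace_factor \<mu> s ((t, l) # xs) =
     laplace_factor \<mu> t xs * (1 + 2 * (l + laplace_exponent t xs) * (t - s)) powr (- (\<mu> + 1))"

lemma laplace_exponent_nonneg: "time_chain s xs \<Longrightarrow> 0 \<le> laplace_exponent s xs"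
  by (induction xs arbitrary: s) auto

lemma laplace_factor_nonneg: "0 \<le> laplace_factor \<mu> s xs"
  by (induction xs arbitrary: s) auto

text \<open>The scaling property of squared Bessel processes. Only differences of times enter, so the shift by \<open>s\<close>
disappears, and a factor \<open>c\<close> in the weights can be moved into the times.\<close>

lemma laplace_exponent_scale:
  assumes c: "c \<noteq> 0"
  shows "laplace_exponent (s + b) (map (\<lambda>(a, l). (s + a, c * l)) xs) = c * laplace_exponent (c * b) (map (\<lambda>(a, l). (c * a, l)) xs)"
proof (induction xs arbitrary: b)
  case (Cons p xs)
  obtain a l where p: "p = (a, l)" by force
  define m where "m = l + laplace_exponent (c * a) (map (\<lambda>(a, l). (c * a, l)) xs)"
  have "c * l + laplace_exponent (s + a) (map (\<lambda>(a, l). (s + a, c * l)) xs) = c * m"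
    unfolding Cons.IH by (simp add: m_def algebra_simps)
  then show ?case by (simp add: p m_def[symmetric]) (simp add: algebra_simps)
qed simp

lemma laplace_factor_scale:
  assumes c: "c \<noteq> 0"
  shows "laplace_factor \<mu> (s + b) (map (\<lambda>(a, l). (s + a, c * l)) xs) = laplace_factor \<mu> (c * b) (map (\<lambda>(a, l). (c * a, l)) xs)"
proof (induction xs arbitrary: b)
  case (Cons p xs)
  obtain a l where p: "p = (a, l)" by force
  define m where "m = l + laplace_exponent (c * a) (map (\<lambda>(a, l). (c * a, l)) xs)"
  have "c * l + laplace_exponent (s + a) (map (\<lambda>(a, l). (s + a, c * l)) xs) = c * m"
    unfolding laplace_exponent_scale[OF c] by (simp add: m_def algebra_simps)
  then show ?case by (simp add: p m_def[symmetric] Cons.IH) (simp add: algebra_simps)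
qed simp

lemma time_chain_sorted:
  assumes "sorted ys" "\<And>y. y \<in> set ys \<Longrightarrow> s \<le> y \<and> 0 \<le> l y"
  shows "time_chain s (map (\<lambda>y. (y, l y)) ys)"
  using assms by (induction ys arbitrary: s) auto

lemma time_chain_map:
  assumes "time_chain b xs" "0 \<le> c" "mono f"
  shows "time_chain (f b) (map (\<lambda>(a, l). (f a, c * l)) xs)"
  using assms(1)
proof (induction xs arbitrary: b)
  case (Cons p xs)
  then show ?case using assms(2) monoD[OF assms(3)] by (cases p) auto
qed simp

context besq_process
begin

text \<open>The Markov property: the variable at the first time is absorbed into the weight \<open>Y\<close>, the rest of the list
is handled by induction from that time on.\<close>

lemma laplace_multi:
  assumes s: "0 \<le> s" and xs: "time_chain s xs" and Y: "Y \<in> borel_measurable (F s)"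
    and Y01: "\<And>\<omega>. 0 \<le> Y \<omega>" "\<And>\<omega>. Y \<omega> \<le> 1"
  shows "(\<integral>\<omega>. Y \<omega> * exp (- (\<Sum>(t, l)\<leftarrow>xs. l * R t \<omega>)) \<partial>M) =
    laplace_factor \<mu> s xs * (\<integral>\<omega>. Y \<omega> * exp (- (laplace_exponent s xs * R s \<omega>)) \<partial>M)"
  using assms
proof (induction xs arbitrary: s Y)
  case (Cons p xs)
  obtain t l where p: "p = (t, l)" by force
  have st: "s \<le> t" "0 \<le> l" "time_chain t xs" "0 \<le> t" using Cons.prems by (auto simp: p)
  define m where "m = l + laplace_exponent t xs"
  have m: "0 \<le> m" using laplace_exponent_nonneg[OF st(3)] st by (simp add: m_def)
  define Y' where "Y' = (\<lambda>\<omega>. Y \<omega> * exp (- (l * max 0 (R t \<omega>))))"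
  have Y': "Y' \<omega> = Y \<omega> * exp (- (l * R t \<omega>))" if "\<omega> \<in> space M" for \<omega>
    using nonneg[OF that st(4)] by (simp add: Y'_def)
  have "R t \<in> borel_measurable (F t)" "Y \<in> borel_measurable (F t)"
    using adapted[OF st(4)] measurable_F_mono[OF Cons.prems(3) st(1)] by auto
  then have Y'm: "Y' \<in> borel_measurable (F t)" unfolding Y'_def by measurable
  have Y'01: "0 \<le> Y' \<omega>" "Y' \<omega> \<le> 1" for \<omega>
    using Cons.prems(4,5)[of \<omega>] st by (auto simp: Y'_def intro!: mult_le_one)
  have "(\<integral>\<omega>. Y \<omega> * exp (- (\<Sum>(t, l)\<leftarrow>p # xs. l * R t \<omega>)) \<partial>M)
      = (\<integral>\<omega>. Y' \<omega> * exp (- (\<Sum>(t, l)\<leftarrow>xs. l * R t \<omega>)) \<partial>M)"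
    by (intro Bochner_Integration.integral_cong) (simp_all add: p Y' mult.assoc mult_exp_exp)
  also have "\<dots> = laplace_factor \<mu> t xs * (\<integral>\<omega>. Y' \<omega> * exp (- (laplace_exponent t xs * R t \<omega>)) \<partial>M)"
    by (rule Cons.IH[OF st(4,3) Y'm Y'01])
  also have "(\<integral>\<omega>. Y' \<omega> * exp (- (laplace_exponent t xs * R t \<omega>)) \<partial>M) = (\<integral>\<omega>. Y \<omega> * exp (- (m * R t \<omega>)) \<partial>M)"
    by (intro Bochner_Integration.integral_cong) (simp_all add: Y' m_def mult.assoc mult_exp_exp algebra_simps)
  also have "\<dots> = (1 + 2 * m * (t - s)) powr (- (\<mu> + 1)) * (\<integral>\<omega>. Y \<omega> * exp (- (m / (1 + 2 * m * (t - s)) * R s \<omega>)) \<partial>M)"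
    by (rule laplace_transition[OF Cons.prems(1) st(1) Cons.prems(3-5) m])
  finally show ?case by (simp add: p m_def[symmetric])
qed simp

text \<open>The event that \<open>R\<close> exceeds \<open>n\<^sup>2/m\<close> somewhere on \<open>[0,n]\<close> has probability of order \<open>exp(-n/(4m))\<close>, which is
summable in \<open>n\<close> for every \<open>m\<close>.\<close>

lemma subquadratic_growth: "AE \<omega> in M. ((\<lambda>u. R u \<omega> / u\<^sup>2) \<longlongrightarrow> 0) at_top"
proof -
  have "AE \<omega> in M. \<forall>m::nat. eventually (\<lambda>n. \<omega> \<in> space M - exceed (real (Suc n)) ((real (Suc n))\<^sup>2 / real (Suc m))) sequentially"
    unfolding AE_all_countable
  proof
    fix m :: nat
    define C where "C = exp (besq_dim / 2 + \<bar>x\<bar> / 2)"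
    define q where "q = exp (- (1 / (4 * real (Suc m))))"
    have q: "0 < q" "q < 1" by (auto simp: q_def)
    show "AE \<omega> in M. eventually (\<lambda>n. \<omega> \<in> space M - exceed (real (Suc n)) ((real (Suc n))\<^sup>2 / real (Suc m))) sequentially"
    proof (rule borel_cantelli_AE1)
      show "exceed (real (Suc n)) ((real (Suc n))\<^sup>2 / real (Suc m)) \<in> sets M" for n
        by (rule exceed_sets) simp
      show "emeasure M (exceed (real (Suc n)) ((real (Suc n))\<^sup>2 / real (Suc m))) < \<infinity>" for n
        by (simp add: emeasure_eq_measure)
      show "summable (\<lambda>n. measure M (exceed (real (Suc n)) ((real (Suc n))\<^sup>2 / real (Suc m))))"
      proof (rule summable_comparison_test')
        show "summable (\<lambda>n. C * q ^ Suc n)"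
          using q by (intro summable_mult summable_ignore_initial_segment[where k = 1, simplified] summable_geometric) auto
        fix n :: nat
        define T where "T = real (Suc n)"
        have T: "1 \<le> T" "0 < T" by (auto simp: T_def)
        have "ennreal (measure M (exceed T (T\<^sup>2 / real (Suc m)))) \<le> ennreal (exp (besq_dim / 2 + x / (2 * T) - T\<^sup>2 / real (Suc m) / (4 * T)))"
          using exceed_tail[OF T(2), of "T\<^sup>2 / real (Suc m)"] by (simp add: emeasure_eq_measure)
        then have "measure M (exceed T (T\<^sup>2 / real (Suc m))) \<le> exp (besq_dim / 2 + x / (2 * T) - T\<^sup>2 / real (Suc m) / (4 * T))"
          by (subst (asm) ennreal_le_iff) auto
        also have "\<dots> \<le> exp ((besq_dim / 2 + \<bar>x\<bar> / 2) + T * (- (1 / (4 * real (Suc m)))))"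
        proof -
          have "x / (2 * T) \<le> \<bar>x\<bar> / (2 * T)" using T by (intro divide_right_mono) auto
          also have "\<dots> \<le> \<bar>x\<bar> / 2" using T by (intro divide_left_mono) auto
          finally have "x / (2 * T) \<le> \<bar>x\<bar> / 2" .
          moreover have "T\<^sup>2 / real (Suc m) / (4 * T) = T * (1 / (4 * real (Suc m)))"
            using T by (simp add: power2_eq_square del: of_nat_Suc)
          ultimately show ?thesis by simp
        qed
        also have "\<dots> = C * q ^ Suc n"
          unfolding exp_add C_def q_def T_def exp_of_nat_mult ..
        finally show "norm (measure M (exceed (real (Suc n)) ((real (Suc n))\<^sup>2 / real (Suc m)))) \<le> C * q ^ Suc n"
          by (simp add: T_def)
      qed
    qed
  qed
  then show ?thesis
    using AE_space
  proof eventually_elim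
    case (elim \<omega>)
    show ?case
    proof (rule tendstoI)
      fix e :: real assume e: "0 < e"
      obtain m :: nat where m: "4 / e < real (Suc m)" using reals_Archimedean2[of "4 / e"] by (metis less_trans lessI of_nat_less_iff)
      then have me: "4 / real (Suc m) < e" using e by (simp add: field_simps)
      obtain N where N: "\<And>n. n \<ge> N \<Longrightarrow> \<omega> \<in> space M - exceed (real (Suc n)) ((real (Suc n))\<^sup>2 / real (Suc m))"
        using spec[OF elim(1), of m] unfolding eventually_sequentially by blast
      show "eventually (\<lambda>u. dist (R u \<omega> / u\<^sup>2) 0 < e) at_top"
        using eventually_ge_at_top[of "real N + 1"]
      proof eventually_elim
        case (elim u)
        define n where "n = nat \<lfloor>u\<rfloor>"
        have n: "real n \<le> u" "u \<le> real (Suc n)" "N \<le> n" using elim unfolding n_def by linarith+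
        have u: "1 \<le> u" using elim by simp
        have "R u \<omega> \<le> (real (Suc n))\<^sup>2 / real (Suc m)"
          using N[OF n(3)] n u \<open>\<omega> \<in> space M\<close> unfolding exceed_def by (auto simp: not_less)
        also have "\<dots> \<le> (2 * u)\<^sup>2 / real (Suc m)"
          using n u by (intro divide_right_mono power_mono) auto
        finally have "R u \<omega> / u\<^sup>2 \<le> ((2 * u)\<^sup>2 / real (Suc m)) / u\<^sup>2"
          by (rule divide_right_mono) simp
        also have "\<dots> = 4 / real (Suc m)" using u by (simp add: power2_eq_square)
        finally have "R u \<omega> / u\<^sup>2 < e" using me by simp
        moreover have "0 \<le> R u \<omega> / u\<^sup>2" using nonneg[OF \<open>\<omega> \<in> space M\<close>, of u] u by simp
        ultimately show ?case by (simp add: dist_real_def)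
      qed
    qed
  qed
qed

lemma inverted_shift_0: "AE \<omega> in M. \<forall>a. inverted_shift R 0 a \<omega> = 0"
  using subquadratic_growth
proof eventually_elim
  case (elim \<omega>)
  show ?case
  proof
    fix a :: real
    have f: "filterlim (\<lambda>s::real. 1 / s + a) at_top (at_right 0)" by real_asymp
    have l: "((\<lambda>s. R (1 / s + a) \<omega> / (1 / s + a)\<^sup>2) \<longlongrightarrow> 0) (at_right 0)"
      using filterlim_compose[OF elim f] .
    \<comment> \<open>Since \<open>1 + a s = s (1/s + a)\<close>, this function is \<open>s\<^sup>2 R(1/s + a)\<close>.\<close>
    have "((\<lambda>s. (R (1 / s + a) \<omega> / (1 / s + a)\<^sup>2) * (1 + a * s)\<^sup>2) \<longlongrightarrow> 0 * (1 + a * 0)\<^sup>2) (at_right 0)"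
      by (intro tendsto_intros l)
    moreover have "eventually (\<lambda>s. (R (1 / s + a) \<omega> / (1 / s + a)\<^sup>2) * (1 + a * s)\<^sup>2 = s\<^sup>2 * R (1 / s + a) \<omega>) (at_right 0)"
    proof -
      have "eventually (\<lambda>s. 1 / s + a > 0) (at_right 0)"
        using f by (simp add: filterlim_at_top_dense)
      moreover have "eventually (\<lambda>s::real. s > 0) (at_right 0)" by (simp add: eventually_at_right_less)
      ultimately show ?thesis
      proof eventually_elim
        case (elim s)
        then have e: "1 + a * s = s * (1 / s + a)" by (simp add: field_simps)
        show ?case unfolding e power_mult_distrib using elim by simp
      qed
    qed
    ultimately have "((\<lambda>s. s\<^sup>2 * R (1 / s + a) \<omega>) \<longlongrightarrow> 0) (at_right 0)"
      by (simp add: tendsto_cong)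
    then have "Lim (at_right 0) (\<lambda>s. s\<^sup>2 * R (1 / s + a) \<omega>) = 0"
      by (intro tendsto_Lim) auto
    then show "inverted_shift R 0 a \<omega> = 0" by (simp add: inverted_shift_def)
  qed
qed

end

text \<open>By continuity, existence of the limit is a Cauchy condition over rational times and hence a measurable
event \<open>C\<close>. On \<open>C\<close> the limit is taken along a sequence. Off \<open>C\<close> the definite description in \<open>Lim\<close> has the same
unsatisfiable predicate for every outcome, so its unspecified value is a constant.\<close>

lemma measurable_Lim_at_right_0:
  fixes f :: "real \<Rightarrow> 'a \<Rightarrow> real"
  assumes fm: "\<And>s. 0 < s \<Longrightarrow> f s \<in> borel_measurable M"
    and cont: "\<And>\<omega>. \<omega> \<in> space M \<Longrightarrow> continuous_on {0<..} (\<lambda>s. f s \<omega>)"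
  shows "(\<lambda>\<omega>. Lim (at_right 0) (\<lambda>s. f s \<omega>)) \<in> borel_measurable M"
proof -
  define g where "g = (\<lambda>s \<omega>. if 0 < s then f s \<omega> else 0)"
  have [measurable]: "g s \<in> borel_measurable M" for s
    using fm[of s] by (cases "0 < s") (auto simp: g_def[abs_def])
  define C where "C = (\<lambda>\<omega>. \<forall>k::nat. \<exists>n::nat. \<forall>p q::rat.
     0 < (of_rat p :: real) \<and> of_rat p < 1 / real (Suc n) \<and> 0 < (of_rat q :: real) \<and> of_rat q < 1 / real (Suc n) \<longrightarrow>
     \<bar>g (of_rat p) \<omega> - g (of_rat q) \<omega>\<bar> \<le> 1 / real (Suc k))"
  have Cm [measurable]: "Measurable.pred M C" unfolding C_def by measurable
  define h where "h = (\<lambda>\<omega>. lim (\<lambda>j. g (1 / real (Suc j)) \<omega>))"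
  have [measurable]: "h \<in> borel_measurable M" unfolding h_def by measurable
  define c0 :: real where "c0 = (THE l. False)"
  have "Lim (at_right 0) (\<lambda>s. f s \<omega>) = (if C \<omega> then h \<omega> else c0)" if \<omega>: "\<omega> \<in> space M" for \<omega>
  proof (cases "C \<omega>")
    case True
    have close: "\<exists>n::nat. \<forall>s\<in>{0<..<1 / real (Suc n)}. \<forall>t\<in>{0<..<1 / real (Suc n)}. \<bar>f s \<omega> - f t \<omega>\<bar> \<le> 1 / real (Suc k)" for k
    proof -
      obtain n where n: "\<And>p q::rat. 0 < (of_rat p :: real) \<Longrightarrow> of_rat p < 1 / real (Suc n) \<Longrightarrow> 0 < (of_rat q :: real) \<Longrightarrow> of_rat q < 1 / real (Suc n) \<Longrightarrow>
        \<bar>g (of_rat p) \<omega> - g (of_rat q) \<omega>\<bar> \<le> 1 / real (Suc k)" using True unfolding C_def by blast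
      define d where "d = 1 / real (Suc n)"
      have "\<bar>f s \<omega> - f t \<omega>\<bar> \<le> 1 / real (Suc k)" if s: "s \<in> {0<..<d}" and t: "t \<in> {0<..<d}" for s t
      proof (rule field_le_epsilon)
        fix e :: real assume e: "0 < e"
        have near: "\<exists>p::rat. 0 < (of_rat p :: real) \<and> of_rat p < d \<and> \<bar>f (of_rat p) \<omega> - f s \<omega>\<bar> < e / 2" if s: "s \<in> {0<..<d}" for s
        proof -
          have "continuous (at s) (\<lambda>s. f s \<omega>)"
            using cont[OF \<omega>] s by (simp add: continuous_on_eq_continuous_at)
          then have "\<forall>\<epsilon>>0. \<exists>\<delta>>0. \<forall>y. \<bar>y - s\<bar> < \<delta> \<longrightarrow> \<bar>f y \<omega> - f s \<omega>\<bar> < \<epsilon>"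
            by (simp only: continuous_at_eps_delta dist_real_def)
          from spec[OF this, of "e / 2"] have "\<exists>\<delta>>0. \<forall>y. \<bar>y - s\<bar> < \<delta> \<longrightarrow> \<bar>f y \<omega> - f s \<omega>\<bar> < e / 2"
            using e by simp
          then obtain \<delta> where \<delta>: "0 < \<delta>" "\<And>y. \<bar>y - s\<bar> < \<delta> \<Longrightarrow> \<bar>f y \<omega> - f s \<omega>\<bar> < e / 2" by blast
          have "s < min d (s + \<delta>)" using s \<delta> by auto
          then obtain p where p: "s < of_rat p" "of_rat p < min d (s + \<delta>)" using of_rat_dense by blast
          have "0 < (of_rat p :: real)" by (rule less_trans[OF _ p(1)]) (use s in auto)
          moreover have "\<bar>f (of_rat p) \<omega> - f s \<omega>\<bar> < e / 2" using p by (intro \<delta>(2)) auto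
          moreover have "of_rat p < d" using p by simp
          ultimately show ?thesis by blast
        qed
        obtain p where p: "0 < (of_rat p :: real)" "of_rat p < d" "\<bar>f (of_rat p) \<omega> - f s \<omega>\<bar> < e / 2" using near[OF s] by blast
        obtain q where q: "0 < (of_rat q :: real)" "of_rat q < d" "\<bar>f (of_rat q) \<omega> - f t \<omega>\<bar> < e / 2" using near[OF t] by blast
        have "\<bar>f (of_rat p) \<omega> - f (of_rat q) \<omega>\<bar> \<le> 1 / real (Suc k)"
          using n[folded d_def, OF p(1,2) q(1,2)] p(1) q(1) by (simp add: g_def)
        then show "\<bar>f s \<omega> - f t \<omega>\<bar> \<le> 1 / real (Suc k) + e" using p(3) q(3) by linarith
      qed
      then show ?thesis unfolding d_def by blast
    qed
    have gf: "g (1 / real (Suc j)) \<omega> = f (1 / real (Suc j)) \<omega>" for j by (simp add: g_def)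
    have in_d: "1 / real (Suc j) \<in> {0<..<1 / real (Suc n)}" if "n < j" for j n using that by (auto simp: field_simps)
    have small: "\<exists>k. 1 / real (Suc k) < e" if "0 < e" for e
      using reals_Archimedean[OF that] by (simp add: inverse_eq_divide)
    have "Cauchy (\<lambda>j. f (1 / real (Suc j)) \<omega>)"
    proof (rule metric_CauchyI)
      fix e :: real assume "0 < e"
      then obtain k where k: "1 / real (Suc k) < e" using small by blast
      obtain n where n: "\<And>s t. s \<in> {0<..<1 / real (Suc n)} \<Longrightarrow> t \<in> {0<..<1 / real (Suc n)} \<Longrightarrow> \<bar>f s \<omega> - f t \<omega>\<bar> \<le> 1 / real (Suc k)" using close by blast
      show "\<exists>N. \<forall>i\<ge>N. \<forall>j\<ge>N. dist (f (1 / real (Suc i)) \<omega>) (f (1 / real (Suc j)) \<omega>) < e"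
      proof (intro exI[of _ "Suc n"] allI impI)
        fix i j assume "Suc n \<le> i" "Suc n \<le> j"
        then have "\<bar>f (1 / real (Suc i)) \<omega> - f (1 / real (Suc j)) \<omega>\<bar> \<le> 1 / real (Suc k)"
          by (intro n in_d) auto
        then show "dist (f (1 / real (Suc i)) \<omega>) (f (1 / real (Suc j)) \<omega>) < e"
          using k unfolding dist_real_def by linarith
      qed
    qed
    then obtain l where l: "(\<lambda>j. f (1 / real (Suc j)) \<omega>) \<longlonglongrightarrow> l"
      using Cauchy_convergent convergent_def by blast
    have "((\<lambda>s. f s \<omega>) \<longlongrightarrow> l) (at_right 0)"
    proof (rule tendstoI)
      fix e :: real assume "0 < e"
      then obtain k where k: "1 / real (Suc k) < e" using small by blast
      obtain n where n: "\<And>s t. s \<in> {0<..<1 / real (Suc n)} \<Longrightarrow> t \<in> {0<..<1 / real (Suc n)} \<Longrightarrow> \<bar>f s \<omega> - f t \<omega>\<bar> \<le> 1 / real (Suc k)" using close by blast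
      have "eventually (\<lambda>s. s \<in> {0<..<1 / real (Suc n)}) (at_right 0)"
        by (rule eventually_at_right_real) simp
      then show "eventually (\<lambda>s. dist (f s \<omega>) l < e) (at_right 0)"
      proof eventually_elim
        case (elim s)
        have "(\<lambda>j. \<bar>f s \<omega> - f (1 / real (Suc j)) \<omega>\<bar>) \<longlonglongrightarrow> \<bar>f s \<omega> - l\<bar>" by (intro tendsto_intros l)
        then have "\<bar>f s \<omega> - l\<bar> \<le> 1 / real (Suc k)"
        proof (rule LIMSEQ_le_const2)
          show "\<exists>N. \<forall>j\<ge>N. \<bar>f s \<omega> - f (1 / real (Suc j)) \<omega>\<bar> \<le> 1 / real (Suc k)"
          proof (intro exI[of _ "Suc n"] allI impI)
            fix j assume "Suc n \<le> j"
            then show "\<bar>f s \<omega> - f (1 / real (Suc j)) \<omega>\<bar> \<le> 1 / real (Suc k)"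
              by (intro n elim in_d) auto
          qed
        qed
        then show ?case using k by (simp add: dist_real_def)
      qed
    qed
    then have "Lim (at_right 0) (\<lambda>s. f s \<omega>) = l" by (intro tendsto_Lim) auto
    moreover have "h \<omega> = l" unfolding h_def gf using l by (rule limI)
    ultimately show ?thesis using True by simp
  next
    case False
    have "\<not> ((\<lambda>s. f s \<omega>) \<longlongrightarrow> l) (at_right 0)" for l
    proof
      assume l: "((\<lambda>s. f s \<omega>) \<longlongrightarrow> l) (at_right 0)"
      have "C \<omega>" unfolding C_def
      proof
        fix k :: nat
        define e where "e = 1 / real (Suc k)"
        have "eventually (\<lambda>s. dist (f s \<omega>) l < e / 2) (at_right 0)"
          by (rule tendstoD[OF l]) (simp add: e_def)
        then obtain b where b: "0 < b" "\<And>s. 0 < s \<Longrightarrow> s < b \<Longrightarrow> \<bar>f s \<omega> - l\<bar> < e / 2"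
          unfolding eventually_at_right_field by (auto simp: dist_real_def)
        obtain n where n: "1 / real (Suc n) < b" using reals_Archimedean[OF b(1)] by (auto simp: inverse_eq_divide)
        show "\<exists>n::nat. \<forall>p q::rat. 0 < (of_rat p :: real) \<and> of_rat p < 1 / real (Suc n) \<and> 0 < (of_rat q :: real) \<and> of_rat q < 1 / real (Suc n) \<longrightarrow>
          \<bar>g (of_rat p) \<omega> - g (of_rat q) \<omega>\<bar> \<le> 1 / real (Suc k)"
        proof (intro exI[of _ n] allI impI)
          fix p q :: rat
          assume pq: "0 < (of_rat p :: real) \<and> of_rat p < 1 / real (Suc n) \<and> 0 < (of_rat q :: real) \<and> of_rat q < 1 / real (Suc n)"
          then have "\<bar>f (of_rat p) \<omega> - l\<bar> < e / 2" "\<bar>f (of_rat q) \<omega> - l\<bar> < e / 2" using b(2) n by (auto intro: less_trans)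
          then have "\<bar>f (of_rat p) \<omega> - f (of_rat q) \<omega>\<bar> \<le> e" by linarith
          then show "\<bar>g (of_rat p) \<omega> - g (of_rat q) \<omega>\<bar> \<le> 1 / real (Suc k)" using pq by (simp add: g_def e_def)
        qed
      qed
      then show False using False by simp
    qed
    then have "(\<lambda>l. ((\<lambda>s. f s \<omega>) \<longlongrightarrow> l) (at_right 0)) = (\<lambda>l. False)" by blast
    then show ?thesis using False unfolding c0_def t2_space_class.Lim_def by simp
  qed
  moreover have "(\<lambda>\<omega>. if C \<omega> then h \<omega> else c0) \<in> borel_measurable M" by measurable
  ultimately show ?thesis by (simp cong: measurable_cong)
qed

lemma besq_obtain_process:
  assumes "besq M \<mu> x R" "0 \<le> \<mu>"
  obtains F B where "besq_process M F B \<mu> x R"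
proof -
  obtain F B where FB: "brownian_motion M F B" "\<forall>t\<ge>0. R t \<in> borel_measurable (F t)"
    "\<forall>t\<ge>0. \<exists>I. ito_integral M F B (\<lambda>s \<omega>. sqrt (R s \<omega>)) t I \<and>
           (AE \<omega> in M. R t \<omega> = R 0 \<omega> + 2 * I \<omega> + 2 * (\<mu> + 1) * t)"
    using assms(1) unfolding besq_def by blast
  have "prob_space M" using FB(1) by (simp add: brownian_motion_def)
  then have "besq_process M F B \<mu> x R"
    unfolding besq_process_def besq_process_axioms_def brownian_def brownian_axioms_def
    using assms FB by (auto simp: besq_def)
  then show ?thesis by (rule that)
qed

lemma besq_laplace_multi:
  assumes "besq M \<mu> x R" "0 \<le> \<mu>" "0 \<le> s" "time_chain s xs"
  shows "(\<integral>\<omega>. exp (- (\<Sum>(t, l)\<leftarrow>xs. l * R t \<omega>)) \<partial>M) =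
    laplace_factor \<mu> s xs * (\<integral>\<omega>. exp (- (laplace_exponent s xs * R s \<omega>)) \<partial>M)"
proof -
  obtain F B where "besq_process M F B \<mu> x R" using besq_obtain_process[OF assms(1,2)] .
  then interpret besq_process M F B \<mu> x R .
  show ?thesis using laplace_multi[OF assms(3,4), of "\<lambda>_. 1"] by simp
qed

lemma besq_measurable:
  assumes "besq M \<mu> x R" "0 \<le> \<mu>" "0 \<le> s"
  shows "R s \<in> borel_measurable M"
proof -
  obtain F B where "besq_process M F B \<mu> x R" using besq_obtain_process[OF assms(1,2)] .
  then interpret besq_process M F B \<mu> x R .
  show ?thesis by (rule R_measurable[OF assms(3)])
qed

lemma process_sigma_measurable:
  assumes "0 \<le> t"
  shows "X t \<in> borel_measurable (process_sigma M X)"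
proof -
  have "sample_path X \<in> space M \<rightarrow> space path_space"
    by (auto simp: sample_path_def path_space_def space_PiM)
  then have "sample_path X \<in> measurable (process_sigma M X) path_space"
    unfolding process_sigma_def by (rule measurable_vimage_algebra1)
  moreover have "(\<lambda>p. p t) \<in> measurable path_space borel"
    unfolding path_space_def using assms by (intro measurable_component_singleton) simp
  ultimately have "(\<lambda>\<omega>. sample_path X \<omega> t) \<in> borel_measurable (process_sigma M X)"
    by (rule measurable_compose)
  then show ?thesis using assms by (simp add: sample_path_def)
qed

text \<open>The joint measurability of the family with respect to \<open>G\<close> and the independence of \<open>\<xi>\<close> from \<open>G\<close> allow the
starting point to be frozen: for each fixed \<open>y\<close> the inner expectation is the Laplace transform of the
process started at \<open>y\<close>.\<close>

lemma besq_random_start_laplace: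
  assumes M: "prob_space M" and \<mu>: "0 \<le> \<mu>" and S: "besq_family M G \<mu> S"
    and \<xi>: "\<xi> \<in> borel_measurable M" and \<xi>0: "\<And>\<omega>. \<omega> \<in> space M \<Longrightarrow> 0 \<le> \<xi> \<omega>"
    and ind: "prob_space.indep_set M (sets G) D"
    and D: "\<And>C. C \<in> sets borel \<Longrightarrow> \<xi> -` C \<inter> space M \<in> D"
    and xs: "time_chain 0 xs"
  shows "(\<integral>\<omega>. exp (- (\<Sum>(u, l)\<leftarrow>xs. l * S (\<xi> \<omega>) u \<omega>)) \<partial>M) =
    laplace_factor \<mu> 0 xs * (\<integral>\<omega>. exp (- (laplace_exponent 0 xs * \<xi> \<omega>)) \<partial>M)"
proof -
  interpret prob_space M by fact
  have sub: "space G = space M" "sets G \<subseteq> sets M" and bS: "\<And>y. 0 \<le> y \<Longrightarrow> besq M \<mu> y (S y)"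
    and Sm: "\<And>u. 0 \<le> u \<Longrightarrow> (\<lambda>(y, \<omega>). S y u \<omega>) \<in> borel_measurable (restrict_space borel {0..} \<Otimes>\<^sub>M G)"
    using S by (auto simp: besq_family_def subalgebra_def)
  define N where "N = (restrict_space borel {0..} :: real measure)"
  have times: "0 \<le> u \<and> 0 \<le> l" if "(u, l) \<in> set xs" for u l
  proof -
    have "time_chain s ys \<Longrightarrow> (u, l) \<in> set ys \<Longrightarrow> s \<le> u \<and> 0 \<le> l" for s ys
      by (induction s ys rule: time_chain.induct) force+
    from this[OF xs that] show ?thesis .
  qed
  have id: "(\<lambda>\<omega>. \<omega>) \<in> measurable M G"
    using measurable_mono[of G G G M] sub by (auto intro: measurable_ident_sets)
  have \<xi>N: "\<xi> \<in> measurable M N"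
    unfolding N_def using \<xi> \<xi>0 by (intro measurable_restrict_space2) auto
  define f where "f = (\<lambda>p. exp (- (\<Sum>(u, l)\<leftarrow>xs. l * S (snd p) u (fst p))))"
  have fm: "f \<in> borel_measurable (G \<Otimes>\<^sub>M N)"
  proof -
    have 1: "(\<lambda>p. S (snd p) u (fst p)) \<in> borel_measurable (G \<Otimes>\<^sub>M N)" if "0 \<le> u" for u
    proof -
      have "(\<lambda>p. (snd p, fst p)) \<in> measurable (G \<Otimes>\<^sub>M N) (N \<Otimes>\<^sub>M G)" by measurable
      from measurable_compose[OF this Sm[OF that, folded N_def]] show ?thesis by simp
    qed
    have "(\<lambda>p. \<Sum>(u, l)\<leftarrow>ys. l * S (snd p) u (fst p)) \<in> borel_measurable (G \<Otimes>\<^sub>M N)"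
      if "\<And>u l. (u, l) \<in> set ys \<Longrightarrow> 0 \<le> u" for ys :: "(real \<times> real) list"
      using that
    proof (induction ys)
      case (Cons a ys)
      obtain u l where a: "a = (u, l)" by force
      have "0 \<le> u" using Cons.prems[of u l] by (simp add: a)
      then show ?case using Cons 1[of u] by (auto simp: a intro!: borel_measurable_add)
    qed simp
    from this[of xs] times show ?thesis unfolding f_def by (intro measurable_compose[OF _ borel_measurable_exp] borel_measurable_uminus) auto
  qed
  have pair: "(\<lambda>\<omega>. (\<omega>, \<xi> \<omega>)) \<in> measurable M (G \<Otimes>\<^sub>M N)" by (rule measurable_Pair[OF id \<xi>N])
  have dist: "distr M (G \<Otimes>\<^sub>M N) (\<lambda>\<omega>. (\<omega>, \<xi> \<omega>)) = distr M G (\<lambda>\<omega>. \<omega>) \<Otimes>\<^sub>M distr M N \<xi>"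
  proof (rule distr_pair_indep[OF id \<xi>N ind _ sub(1)])
    fix C assume "C \<in> sets N"
    then obtain C' where C': "C' \<in> sets borel" "C = C' \<inter> {0..}"
      by (auto simp: N_def sets_restrict_space)
    then have "\<xi> -` C \<inter> space M = \<xi> -` C' \<inter> space M" using \<xi>0 by auto
    then show "\<xi> -` C \<inter> space M \<in> D" using D[OF C'(1)] by simp
  qed
  interpret P1: prob_space "distr M G (\<lambda>\<omega>. \<omega>)" by (rule prob_space_distr[OF id])
  interpret P2: prob_space "distr M N \<xi>" by (rule prob_space_distr[OF \<xi>N])
  interpret P: pair_sigma_finite "distr M G (\<lambda>\<omega>. \<omega>)" "distr M N \<xi>" by unfold_locales
  have Snn: "0 \<le> (\<Sum>(u, l)\<leftarrow>xs. l * S y u \<omega>)" if "0 \<le> y" "\<omega> \<in> space M" for y \<omega>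
    using times bS[OF that(1)] that(2) by (intro sum_list_nonneg) (auto simp: besq_def)
  have f01: "0 \<le> f p" for p by (simp add: f_def)
  have f1: "f (\<omega>, y) \<le> 1" if "0 \<le> y" "\<omega> \<in> space M" for y \<omega> using Snn[OF that] by (simp add: f_def)
  have inner: "(\<integral>\<^sup>+\<omega>. ennreal (f (\<omega>, y)) \<partial>distr M G (\<lambda>\<omega>. \<omega>)) = ennreal (laplace_factor \<mu> 0 xs * exp (- (laplace_exponent 0 xs * y)))"
    if y: "0 \<le> y" for y
  proof -
    have yN: "y \<in> space N" using y by (simp add: N_def space_restrict_space)
    have fy: "(\<lambda>\<omega>. f (\<omega>, y)) \<in> borel_measurable G" using measurable_Pair1[OF fm yN] .
    then have fyM: "(\<lambda>\<omega>. f (\<omega>, y)) \<in> borel_measurable M" using measurable_compose[OF id] by auto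
    have "(\<integral>\<^sup>+\<omega>. ennreal (f (\<omega>, y)) \<partial>distr M G (\<lambda>\<omega>. \<omega>)) = (\<integral>\<^sup>+\<omega>. ennreal (f (\<omega>, y)) \<partial>M)"
      using fy id by (subst nn_integral_distr) auto
    also have "\<dots> = ennreal (\<integral>\<omega>. f (\<omega>, y) \<partial>M)"
    proof (rule nn_integral_eq_integral)
      show "integrable M (\<lambda>\<omega>. f (\<omega>, y))"
        using fyM f01 f1[OF y] by (intro integrable_const_bound[where B = 1]) auto
    qed (simp add: f01)
    also have "(\<integral>\<omega>. f (\<omega>, y) \<partial>M) = laplace_factor \<mu> 0 xs * (\<integral>\<omega>. exp (- (laplace_exponent 0 xs * S y 0 \<omega>)) \<partial>M)"
      unfolding f_def using besq_laplace_multi[OF bS[OF y] \<mu> order_refl xs] by simp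
    also have "(\<integral>\<omega>. exp (- (laplace_exponent 0 xs * S y 0 \<omega>)) \<partial>M) = (\<integral>\<omega>. exp (- (laplace_exponent 0 xs * y)) \<partial>M)"
    proof (rule integral_cong_AE)
      have "AE \<omega> in M. S y 0 \<omega> = y" using bS[OF y] by (simp add: besq_def)
      then show "AE \<omega> in M. exp (- (laplace_exponent 0 xs * S y 0 \<omega>)) = exp (- (laplace_exponent 0 xs * y))"
        by eventually_elim simp
    qed (use besq_measurable[OF bS[OF y] \<mu> order_refl] in auto)
    finally show ?thesis by (simp add: prob_space)
  qed
  have int1: "integrable M (\<lambda>\<omega>. f (\<omega>, \<xi> \<omega>))"
    using measurable_compose[OF pair fm] f01 f1[OF \<xi>0] by (intro integrable_const_bound[where B = 1]) auto
  have int2: "integrable M (\<lambda>\<omega>. exp (- (laplace_exponent 0 xs * \<xi> \<omega>)))"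
    using laplace_exponent_nonneg[OF xs] \<xi>0 \<xi> by (intro integrable_const_bound[where B = 1]) auto
  have "ennreal (\<integral>\<omega>. f (\<omega>, \<xi> \<omega>) \<partial>M) = (\<integral>\<^sup>+\<omega>. ennreal (f (\<omega>, \<xi> \<omega>)) \<partial>M)"
    using int1 f01 by (intro nn_integral_eq_integral[symmetric]) auto
  also have "\<dots> = (\<integral>\<^sup>+p. ennreal (f p) \<partial>distr M (G \<Otimes>\<^sub>M N) (\<lambda>\<omega>. (\<omega>, \<xi> \<omega>)))"
    using fm pair by (subst nn_integral_distr) auto
  also have "\<dots> = (\<integral>\<^sup>+y. \<integral>\<^sup>+\<omega>. ennreal (f (\<omega>, y)) \<partial>distr M G (\<lambda>\<omega>. \<omega>) \<partial>distr M N \<xi>)"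
    unfolding dist using fm by (subst P.nn_integral_snd[symmetric]) (auto cong: measurable_cong_sets)
  also have "\<dots> = (\<integral>\<^sup>+y. ennreal (laplace_factor \<mu> 0 xs * exp (- (laplace_exponent 0 xs * y))) \<partial>distr M N \<xi>)"
    by (intro nn_integral_cong inner) (simp add: N_def space_restrict_space)
  also have "\<dots> = (\<integral>\<^sup>+\<omega>. ennreal (laplace_factor \<mu> 0 xs * exp (- (laplace_exponent 0 xs * \<xi> \<omega>))) \<partial>M)"
    using \<xi>N by (subst nn_integral_distr) (auto simp: N_def intro!: measurable_restrict_space1)
  also have "\<dots> = ennreal (\<integral>\<omega>. laplace_factor \<mu> 0 xs * exp (- (laplace_exponent 0 xs * \<xi> \<omega>)) \<partial>M)"
    using int2 laplace_factor_nonneg by (intro nn_integral_eq_integral) auto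
  finally have "(\<integral>\<omega>. f (\<omega>, \<xi> \<omega>) \<partial>M) = (\<integral>\<omega>. laplace_factor \<mu> 0 xs * exp (- (laplace_exponent 0 xs * \<xi> \<omega>)) \<partial>M)"
    using f01 laplace_factor_nonneg by (subst (asm) ennreal_inj) (auto intro!: integral_nonneg_AE)
  then show ?thesis by (simp add: f_def)
qed

lemma besq_random_start_measurable:
  assumes S: "besq_family M G \<mu> S" and \<xi>: "\<xi> \<in> borel_measurable M" and \<xi>0: "\<And>\<omega>. \<omega> \<in> space M \<Longrightarrow> 0 \<le> \<xi> \<omega>"
    and u: "0 \<le> u"
  shows "(\<lambda>\<omega>. S (\<xi> \<omega>) u \<omega>) \<in> borel_measurable M"
proof -
  have "(\<lambda>\<omega>. \<omega>) \<in> measurable M G"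
    using S measurable_mono[of G G G M] by (auto simp: besq_family_def subalgebra_def intro: measurable_ident_sets)
  then have "(\<lambda>\<omega>. (\<xi> \<omega>, \<omega>)) \<in> measurable M (restrict_space borel {0..} \<Otimes>\<^sub>M G)"
    using \<xi> \<xi>0 by (intro measurable_Pair measurable_restrict_space2) auto
  from measurable_compose[OF this, of "\<lambda>(y, \<omega>). S y u \<omega>" borel] S u show ?thesis
    by (simp add: besq_family_def)
qed

theorem theorem2p15:
  fixes M G :: "'a measure" and \<mu> t :: real
    and R :: "real \<Rightarrow> 'a \<Rightarrow> real" and S :: "real \<Rightarrow> real \<Rightarrow> 'a \<Rightarrow> real"
  assumes "prob_space M"
    and "\<mu> \<ge> 0"
    and "besq M \<mu> 1 R"
    and "besq_family M G \<mu> S"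
    and "prob_space.indep_set M (sets G) (sets (process_sigma M (time_inversion R)))"
    and "t \<ge> 0"
  shows "equal_in_law M (\<lambda>a. inverted_shift R t a)
           (\<lambda>a \<omega>. S (time_inversion R t \<omega>) (t\<^sup>2 * a) \<omega>)"
proof -
  obtain F B where "besq_process M F B \<mu> 1 R" using besq_obtain_process[OF assms(3,2)] .
  then interpret besq_process M F B \<mu> 1 R .
  define \<xi> where "\<xi> = time_inversion R t"
  have \<xi>m: "\<xi> \<in> borel_measurable M"
    using R_measurable[of "1 / t"] assms(6) by (cases "t = 0") (auto simp: \<xi>_def time_inversion_def[abs_def])
  have \<xi>0: "0 \<le> \<xi> \<omega>" if "\<omega> \<in> space M" for \<omega>
    using nonneg[OF that, of "1 / t"] assms(6) by (auto simp: \<xi>_def time_inversion_def)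
  have Ym: "(\<lambda>\<omega>. S (\<xi> \<omega>) (t\<^sup>2 * a) \<omega>) \<in> borel_measurable M" if "0 \<le> a" for a
    using that by (intro besq_random_start_measurable[OF assms(4) \<xi>m \<xi>0]) auto
  show ?thesis
  proof (cases "t = 0")
    case False
    then have t: "0 < t" using assms(6) by simp
    have X: "inverted_shift R t a \<omega> = t\<^sup>2 * R (1 / t + a) \<omega>" for a \<omega>
      using False by (simp add: inverted_shift_def)
    have \<xi>R: "\<xi> \<omega> = t\<^sup>2 * R (1 / t) \<omega>" for \<omega> using False by (simp add: \<xi>_def time_inversion_def)
    have Xm: "inverted_shift R t a \<in> borel_measurable M" if "0 \<le> a" for a
    proof -
      have [measurable]: "R (1 / t + a) \<in> borel_measurable M" using that t by (intro R_measurable) auto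
      show ?thesis unfolding X[abs_def] by measurable
    qed
    show ?thesis unfolding \<xi>_def[symmetric]
    proof (rule equal_in_lawI)
      show "inverted_shift R t a \<in> borel_measurable M" if "0 \<le> a" for a using Xm[OF that] .
      show "(\<lambda>\<omega>. S (\<xi> \<omega>) (t\<^sup>2 * a) \<omega>) \<in> borel_measurable M" if "0 \<le> a" for a using Ym[OF that] .
      fix J :: "real set" and A :: "real \<Rightarrow> real set"
      assume J: "finite J" "J \<subseteq> {0..}" and A: "\<And>a. a \<in> J \<Longrightarrow> A a \<in> sets borel"
      show "prob {\<omega>\<in>space M. \<forall>a\<in>J. inverted_shift R t a \<omega> \<in> A a} =
        prob {\<omega>\<in>space M. \<forall>a\<in>J. S (\<xi> \<omega>) (t\<^sup>2 * a) \<omega> \<in> A a}"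
      proof (rule finite_dimensional_unique[OF J(1) _ _ _ _ _ A])
        show "inverted_shift R t a \<in> borel_measurable M" "(\<lambda>\<omega>. S (\<xi> \<omega>) (t\<^sup>2 * a) \<omega>) \<in> borel_measurable M" if "a \<in> J" for a
          using that J by (auto intro: Xm Ym)
        show "0 \<le> inverted_shift R t a \<omega>" if "a \<in> J" "\<omega> \<in> space M" for a \<omega>
          unfolding X using nonneg[OF that(2), of "1 / t + a"] that J t by auto
        show "0 \<le> S (\<xi> \<omega>) (t\<^sup>2 * a) \<omega>" if "a \<in> J" "\<omega> \<in> space M" for a \<omega>
          using assms(4) \<xi>0[OF that(2)] that J by (auto simp: besq_family_def besq_def)
        fix l :: "real \<Rightarrow> real" assume l: "\<And>a. a \<in> J \<Longrightarrow> 0 \<le> l a"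
        define xs where "xs = map (\<lambda>a. (a, l a)) (sorted_list_of_set J)"
        have chain: "time_chain 0 xs"
          unfolding xs_def using J l by (intro time_chain_sorted) auto
        have sum: "(\<Sum>a\<in>J. l a * g a) = (\<Sum>(a, l)\<leftarrow>xs. l * g a)" for g :: "real \<Rightarrow> real"
          unfolding xs_def using J by (simp add: o_def sum_list_distinct_conv_sum_set)
        define xs1 where "xs1 = map (\<lambda>(a, l). (1 / t + a, t\<^sup>2 * l)) xs"
        define xs2 where "xs2 = map (\<lambda>(a, l). (t\<^sup>2 * a, l)) xs"
        have c1: "time_chain (1 / t) xs1"
          using time_chain_map[OF chain, of "t\<^sup>2" "\<lambda>a. 1 / t + a"] by (simp add: xs1_def mono_def)
        have c2: "time_chain 0 xs2"
          using time_chain_map[OF chain, of 1 "\<lambda>a. t\<^sup>2 * a"] by (simp add: xs2_def mono_def mult_left_mono)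
        \<comment> \<open>\<open>xs1\<close> describes the left-hand process through \<open>R\<close>, \<open>xs2\<close> the right-hand one through \<open>S\<close>.\<close>
        have ex: "laplace_exponent (1 / t) xs1 = t\<^sup>2 * laplace_exponent 0 xs2"
          using laplace_exponent_scale[of "t\<^sup>2" "1 / t" 0 xs] t by (simp add: xs1_def xs2_def)
        have fa: "laplace_factor \<mu> (1 / t) xs1 = laplace_factor \<mu> 0 xs2"
          using laplace_factor_scale[of "t\<^sup>2" \<mu> "1 / t" 0 xs] t by (simp add: xs1_def xs2_def)
        have s1: "(\<Sum>(a, l)\<leftarrow>xs. l * (t\<^sup>2 * R (1 / t + a) \<omega>)) = (\<Sum>(u, l)\<leftarrow>xs1. l * R u \<omega>)" for \<omega>
          unfolding xs1_def by (simp add: o_def case_prod_unfold ac_simps)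
        have s2: "(\<Sum>(a, l)\<leftarrow>xs. l * S (\<xi> \<omega>) (t\<^sup>2 * a) \<omega>) = (\<Sum>(u, l)\<leftarrow>xs2. l * S (\<xi> \<omega>) u \<omega>)" for \<omega>
          unfolding xs2_def by (simp add: o_def case_prod_unfold)
        have "(\<integral>\<omega>. exp (- (\<Sum>a\<in>J. l a * inverted_shift R t a \<omega>)) \<partial>M) = (\<integral>\<omega>. exp (- (\<Sum>(u, l)\<leftarrow>xs1. l * R u \<omega>)) \<partial>M)"
          unfolding X sum s1 ..
        also have "\<dots> = laplace_factor \<mu> 0 xs2 * (\<integral>\<omega>. exp (- (laplace_exponent 0 xs2 * \<xi> \<omega>)) \<partial>M)"
          using besq_laplace_multi[OF assms(3,2) _ c1] t by (simp add: ex fa \<xi>R ac_simps)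
        also have "\<dots> = (\<integral>\<omega>. exp (- (\<Sum>(u, l)\<leftarrow>xs2. l * S (\<xi> \<omega>) u \<omega>)) \<partial>M)"
        proof (rule besq_random_start_laplace[symmetric, OF assms(1,2,4) \<xi>m \<xi>0 assms(5) _ c2])
          fix C :: "real set" assume C: "C \<in> sets borel"
          have "\<xi> \<in> borel_measurable (process_sigma M (time_inversion R))"
            unfolding \<xi>_def by (rule process_sigma_measurable[OF assms(6)])
          from measurable_sets[OF this C] show "\<xi> -` C \<inter> space M \<in> sets (process_sigma M (time_inversion R))"
            by (simp add: process_sigma_def)
        qed
        also have "\<dots> = (\<integral>\<omega>. exp (- (\<Sum>a\<in>J. l a * S (\<xi> \<omega>) (t\<^sup>2 * a) \<omega>)) \<partial>M)"
          unfolding sum s2 ..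
        finally show "(\<integral>\<omega>. exp (- (\<Sum>a\<in>J. l a * inverted_shift R t a \<omega>)) \<partial>M)
          = (\<integral>\<omega>. exp (- (\<Sum>a\<in>J. l a * S (\<xi> \<omega>) (t\<^sup>2 * a) \<omega>)) \<partial>M)" .
      qed
    qed
  next
    case True
    have Xm: "inverted_shift R t a \<in> borel_measurable M" if a: "0 \<le> a" for a
    proof -
      have "(\<lambda>\<omega>. Lim (at_right 0) (\<lambda>s. s\<^sup>2 * R (1 / s + a) \<omega>)) \<in> borel_measurable M"
      proof (rule measurable_Lim_at_right_0)
        fix s :: real assume "0 < s"
        then have "R (1 / s + a) \<in> borel_measurable M" using a by (intro R_measurable) auto
        then show "(\<lambda>\<omega>. s\<^sup>2 * R (1 / s + a) \<omega>) \<in> borel_measurable M" by measurable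
      next
        fix \<omega> assume \<omega>: "\<omega> \<in> space M"
        have "continuous_on {0<..} (\<lambda>s. R (1 / s + a) \<omega>)"
          using a by (intro continuous_on_compose2[OF continuous[OF \<omega>]] continuous_intros) auto
        then show "continuous_on {0<..} (\<lambda>s. s\<^sup>2 * R (1 / s + a) \<omega>)" by (intro continuous_intros)
      qed
      then show ?thesis using True by (simp add: inverted_shift_def[abs_def])
    qed
    have "besq M \<mu> 0 (S 0)" using assms(4) by (simp add: besq_family_def)
    then have S0: "AE \<omega> in M. S 0 0 \<omega> = 0" by (simp add: besq_def)
    show ?thesis unfolding \<xi>_def[symmetric]
    proof (rule equal_in_lawI)
      show "inverted_shift R t a \<in> borel_measurable M" if "0 \<le> a" for a using Xm[OF that] .
      show "(\<lambda>\<omega>. S (\<xi> \<omega>) (t\<^sup>2 * a) \<omega>) \<in> borel_measurable M" if "0 \<le> a" for a using Ym[OF that] .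
      fix J :: "real set" and A :: "real \<Rightarrow> real set"
      assume J: "finite J" "J \<subseteq> {0..}" and A: "\<And>a. a \<in> J \<Longrightarrow> A a \<in> sets borel"
      have ev: "{\<omega>\<in>space M. \<forall>a\<in>J. Z a \<omega> \<in> A a} \<in> sets M" if "\<And>a. 0 \<le> a \<Longrightarrow> Z a \<in> borel_measurable M" for Z :: "real \<Rightarrow> 'a \<Rightarrow> real"
      proof (rule sets.sets_Collect_finite_All[OF _ J(1)])
        fix a assume a: "a \<in> J"
        then have "Z a \<in> borel_measurable M" using that J by auto
        from measurable_sets[OF this A[OF a]] show "{\<omega>\<in>space M. Z a \<omega> \<in> A a} \<in> sets M"
          by (simp add: vimage_def Int_def conj_commute)
      qed
      show "prob {\<omega>\<in>space M. \<forall>a\<in>J. inverted_shift R t a \<omega> \<in> A a} =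
        prob {\<omega>\<in>space M. \<forall>a\<in>J. S (\<xi> \<omega>) (t\<^sup>2 * a) \<omega> \<in> A a}"
      proof (rule finite_measure_eq_AE)
        show "AE \<omega> in M. \<omega> \<in> {\<omega>\<in>space M. \<forall>a\<in>J. inverted_shift R t a \<omega> \<in> A a} \<longleftrightarrow>
          \<omega> \<in> {\<omega>\<in>space M. \<forall>a\<in>J. S (\<xi> \<omega>) (t\<^sup>2 * a) \<omega> \<in> A a}"
          using S0 inverted_shift_0
          by eventually_elim (simp add: True \<xi>_def time_inversion_def)
      qed (rule ev[OF Xm] ev[OF Ym], assumption)+
    qed
  qed
qed

end
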